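(* Let $K=\mathbb{Q}(i)$, let $f,g,h\in\mathbb{Z}[i]$ be pairwise coprime and square free, let $m=fg^2h^3$, let $\alpha=\sqrt[4]{m}$ be a fourth root of $m$, and let $N=K(\alpha)$, where $[N:K]=4$. Then an integral basis of $N$ over $K$, i.e. a basis of $\mathcal{O}_N$ as a $\mathbb{Z}[i]$-module, is given as follows. (1) If $m\equiv 1\pmod 8$: $$\left\{1,\ \frac{1+\alpha}{1+i},\ \frac{|gh|^2\big(i+(1+i)\alpha\big)+\alpha^2}{2(1+i)gh},\ \frac{|gh^2|^2(1+\alpha+\alpha^2)+\alpha^3}{4gh^2}\right\}.$$ (2) If $m\equiv 1+4i\pmod 8$: $$\left\{1,\ \frac{1+\alpha}{1+i},\ \frac{|gh|^2\big(-i+(1+i)\alpha\big)+\alpha^2}{2(1+i)gh},\ \frac{|gh^2|^2(2-i+\alpha+i\alpha^2)+\alpha^3}{4gh^2}\right\}.$$ (3) If $m\equiv 2i\pmod 4$ and $fh\equiv 1\pmod 4$: $$\left\{1,\ \alpha,\ \frac{gh+\alpha^2}{2gh},\ \frac{\alpha+\alpha^3/(gh^2)}{2}\right\}.$$ (4) If $m\equiv 2i\pmod 4$ and $fh\equiv -1\pmod 4$: $$\left\{1,\ \alpha,\ \frac{i\,gh+\alpha^2}{2gh},\ \frac{i\alpha+\alpha^3/(gh^2)}{2}\right\}.$$ (5) If $m\equiv 2i\pmod 4$, $fh\equiv \pm1\pmod{2(1+i)}$ and $f\bar h\equiv 1\pmod{2(1+i)}$: $$\left\{1,\ \alpha,\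 \frac{gh+\alpha^2}{(1+i)gh},\ \frac{\alpha+\alpha^3/(gh^2)}{2}\right\}.$$ (6) If $m\equiv 2i\pmod 4$, $fh\equiv \pm1\pmod{2(1+i)}$ and $f\bar h\equiv -1\pmod{2(1+i)}$: $$\left\{1,\ \alpha,\ \frac{gh+\alpha^2}{(1+i)gh},\ \frac{i\alpha+\alpha^3/(gh^2)}{2}\right\}.$$ (7) If $m\equiv 3+2i\pmod 4$: $$\left\{1,\ \alpha,\ \frac{|gh|^2+\alpha^2}{(1+i)gh},\ \frac{|gh^2|^2(1+\alpha+\alpha^2)+\alpha^3}{2gh^2}\right\}.$$ (8) If $m\equiv 1+2i\pmod 4$: $$\left\{1,\ \alpha,\ \frac{|gh|^2\big(1+(1+i)\alpha\big)+\alpha^2}{2gh},\ \frac{|gh^2|^2\big(\alpha+(1+i)\alpha^2\big)+\alpha^3}{2gh^2}\right\}.$$ (9) If $m\equiv 3\pmod 4$: $$\left\{1,\ \alpha,\ \frac{i|gh|^2+\alpha^2}{2gh},\ \frac{|gh^2|^2(i+i\alpha+\alpha^2)+\alpha^3}{2gh^2}\right\}.$$ (10) If $m\equiv 5\pmod 8$ or $m\equiv 5+4i\pmod 8$: $$\left\{1,\ \frac{1+\alpha}{1+i},\ \frac{|gh|^2+\alpha^2}{2gh},\ \frac{|gh^2|^2(1+\alpha+\alpha^2)+\alpha^3}{2(1+i)gh^2}\right\}.$$ (11) If $f$ is even, or $h$ is even, or $m\equiv i\pmod 2$: $$\left\{1,\ \alpha,\ \frac{\alpha^2}{gh},\ \frac{\alpha^3}{gh^2}\right\}.$$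 (12) If $fh\equiv i\pmod 2$ and $g$ is even: $$\left\{1,\ \alpha,\ \frac{\alpha^2}{gh},\ \frac{i\alpha+\alpha^3/(gh^2)}{1+i}\right\}.$$
   Context: All congruences are in the ring $\mathbb{Z}[i]$; in cases (5) and (6) the sign in $fh\equiv\pm1$ may be either one. An element of $\mathbb{Z}[i]$ is called even if it is divisible by the prime $1+i$. $\mathcal{O}_N$ denotes the ring of integers of $N$. $|z|$ denotes the complex absolute value, so $|z|^2=z\bar z$, and $\bar z$ is the complex conjugate of $z$.
   Formalization: (3) adds f·h̄≡1 and (4) adds f·h̄≡−1 mod 2(1+i); for the opposite sign the fourth element is (iα+α³/(gh²))/2 resp. (α+α³/(gh²))/2. (5),(6) exclude fh≡±1 mod 4. As printed, (3) fails for f=3i, g=1+i, h=i; (5) for f=−3, g=1+i, h=1. *)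

theory Defs
  imports
    "HOL-Analysis.Analysis"
    "HOL-Computational_Algebra.Computational_Algebra"
    "HOL-Algebra.Generated_Fields"
    "HOL-Algebra.Embedded_Algebras"
    "HOL-Algebra.Algebraic_Closure_Type"
begin

section \<open>Gaussian integers\<close>

datatype gauss_int = GaussInt (gRe: int) (gIm: int)

lemma gauss_int_eq_iff: "x = y \<longleftrightarrow> gRe x = gRe y \<and> gIm x = gIm y"
  by (cases x; cases y) auto

instantiation gauss_int :: comm_ring_1
begin

definition "0 = GaussInt 0 0"
definition "1 = GaussInt 1 0"
definition "x + y = GaussInt (gRe x + gRe y) (gIm x + gIm y)"
definition "x - y = GaussInt (gRe x - gRe y) (gIm x - gIm y)"
definition "- x = GaussInt (- gRe x) (- gIm x)"
definition "x * y = GaussInt (gRe x * gRe y - gIm x * gIm y) (gRe x * gIm y + gIm x * gRe y)"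

instance
  by standard
    (simp_all add: zero_gauss_int_def one_gauss_int_def plus_gauss_int_def minus_gauss_int_def
       uminus_gauss_int_def times_gauss_int_def algebra_simps)

end

lemma gauss_int_sel [simp]:
  "gRe 0 = 0" "gIm 0 = 0" "gRe 1 = 1" "gIm 1 = 0"
  "gRe (x + y) = gRe x + gRe y" "gIm (x + y) = gIm x + gIm y"
  "gRe (x - y) = gRe x - gRe y" "gIm (x - y) = gIm x - gIm y"
  "gRe (- x) = - gRe x" "gIm (- x) = - gIm x"
  "gRe (x * y) = gRe x * gRe y - gIm x * gIm y"
  "gIm (x * y) = gRe x * gIm y + gIm x * gRe y"
  by (simp_all add: zero_gauss_int_def one_gauss_int_def plus_gauss_int_def minus_gauss_int_def
       uminus_gauss_int_def times_gauss_int_def)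

definition gauss_i :: gauss_int
  where "gauss_i = GaussInt 0 1"

definition gauss_cnj :: "gauss_int \<Rightarrow> gauss_int"
  where "gauss_cnj x = GaussInt (gRe x) (- gIm x)"

definition of_gauss :: "gauss_int \<Rightarrow> complex"
  where "of_gauss x = Complex (of_int (gRe x)) (of_int (gIm x))"

lemma of_gauss_hom [simp]:
  "of_gauss 0 = 0" "of_gauss 1 = 1" "of_gauss gauss_i = \<i>"
  "of_gauss (x + y) = of_gauss x + of_gauss y"
  "of_gauss (x - y) = of_gauss x - of_gauss y"
  "of_gauss (- x) = - of_gauss x"
  "of_gauss (x * y) = of_gauss x * of_gauss y"
  "of_gauss (gauss_cnj x) = cnj (of_gauss x)"
  by (simp_all add: of_gauss_def gauss_i_def gauss_cnj_def complex_eq_iff)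

lemma of_gauss_power [simp]: "of_gauss (x ^ n) = of_gauss x ^ n"
  by (induction n) simp_all

lemma of_gauss_inject [simp]: "of_gauss x = of_gauss y \<longleftrightarrow> x = y"
  by (simp add: of_gauss_def gauss_int_eq_iff)

lemma of_gauss_eq_0_iff [simp]: "of_gauss x = 0 \<longleftrightarrow> x = 0"
  using of_gauss_inject[of x 0] by (simp del: of_gauss_inject)

instance gauss_int :: idom
proof
  fix x y :: gauss_int
  assume "x \<noteq> 0" "y \<noteq> 0"
  then show "x * y \<noteq> 0"
    by (metis mult_eq_0_iff of_gauss_eq_0_iff of_gauss_hom(7))
qed

text \<open>
  Division rounds the complex quotient to a nearest Gaussian integer. It makes the Gaussian
  integers an instance of the classes in which the library notion \<^const>\<open>coprime\<close> is
  available; neither division nor remainder occurs in the definitions below.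
\<close>

instantiation gauss_int :: idom_modulo
begin

definition divide_gauss_int :: "gauss_int \<Rightarrow> gauss_int \<Rightarrow> gauss_int"
  where "x div y =
    GaussInt (round (Re (of_gauss x / of_gauss y))) (round (Im (of_gauss x / of_gauss y)))"

definition modulo_gauss_int :: "gauss_int \<Rightarrow> gauss_int \<Rightarrow> gauss_int"
  where "x mod y = x - x div y * (y :: gauss_int)"

instance
proof
  fix x y :: gauss_int
  show "x div 0 = 0"
    by (simp add: divide_gauss_int_def gauss_int_eq_iff)
  show "x * y div y = x" if "y \<noteq> 0"
    using that by (simp add: divide_gauss_int_def) (simp add: of_gauss_def)
  show "x div y * y + x mod y = x"
    by (simp add: modulo_gauss_int_def)
qed

end

lemma cmod_of_gauss_mod_less:
  assumes "y \<noteq> 0"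
  shows "cmod (of_gauss (x mod y)) < cmod (of_gauss y)"
proof -
  define q where "q = of_gauss x / of_gauss y"
  define e where "e = q - of_gauss (x div y)"
  have Re: "\<bar>Re e\<bar> \<le> 1/2" and Im: "\<bar>Im e\<bar> \<le> 1/2"
    using of_int_round_abs_le[of "Re q"] of_int_round_abs_le[of "Im q"]
    by (simp_all add: e_def divide_gauss_int_def q_def of_gauss_def abs_minus_commute)
  have "(cmod e)\<^sup>2 \<le> (1/2)\<^sup>2 + (1/2)\<^sup>2"
    unfolding cmod_power2 using Re Im by (intro add_mono) (metis abs_le_square_iff abs_of_nonneg zero_le_divide_1_iff zero_le_numeral)+
  then have "(cmod e)\<^sup>2 < 1\<^sup>2"
    by (simp add: power2_eq_square)
  then have "cmod e < 1"
    by (rule power2_less_imp_less) simp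
  moreover have "of_gauss (x mod y) = e * of_gauss y"
    using assms by (simp add: modulo_gauss_int_def e_def q_def field_simps)
  ultimately show ?thesis
    using assms by (simp add: norm_mult)
qed

definition gauss_norm :: "gauss_int \<Rightarrow> nat"
  where "gauss_norm x = nat ((gRe x)\<^sup>2 + (gIm x)\<^sup>2)"

lemma gauss_norm_eq: "real (gauss_norm x) = (cmod (of_gauss x))\<^sup>2"
proof -
  have "real (gauss_norm x) = of_int ((gRe x)\<^sup>2 + (gIm x)\<^sup>2)"
    by (simp add: gauss_norm_def of_nat_nat)
  then show ?thesis
    by (simp add: cmod_power2 of_gauss_def)
qed

instantiation gauss_int :: euclidean_ring
begin

definition euclidean_size_gauss_int :: "gauss_int \<Rightarrow> nat"
  where "euclidean_size_gauss_int = gauss_norm"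

instance
proof
  fix x y :: gauss_int
  show "euclidean_size (0 :: gauss_int) = 0"
    by (simp add: euclidean_size_gauss_int_def gauss_norm_def)
  assume y: "y \<noteq> 0"
  have "(cmod (of_gauss (x mod y)))\<^sup>2 < (cmod (of_gauss y))\<^sup>2"
    using cmod_of_gauss_mod_less[OF y] by (intro power_strict_mono) auto
  then show "euclidean_size (x mod y) < euclidean_size y"
    by (simp add: euclidean_size_gauss_int_def flip: gauss_norm_eq)
  have mult: "gauss_norm (x * y) = gauss_norm x * gauss_norm y"
  proof -
    have "real (gauss_norm (x * y)) = real (gauss_norm x * gauss_norm y)"
      by (simp add: gauss_norm_eq norm_mult power_mult_distrib)
    then show ?thesis by linarith
  qed
  have "real (gauss_norm y) \<noteq> 0"
    using y by (simp only: gauss_norm_eq) simp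
  then show "euclidean_size x \<le> euclidean_size (x * y)"
    by (simp add: euclidean_size_gauss_int_def mult)
qed

end

text \<open>
  The library's \<open>cong\<close> is confined to rings with a uniquely determined remainder, which the
  Gaussian integers do not have.
\<close>

definition gauss_cong :: "gauss_int \<Rightarrow> gauss_int \<Rightarrow> gauss_int \<Rightarrow> bool"
    (\<open>(1[_ = _] '(' gmod _'))\<close>)
  where "[a = b] (gmod c) \<longleftrightarrow> c dvd a - b"

definition gauss_even :: "gauss_int \<Rightarrow> bool"
  where "gauss_even x \<longleftrightarrow> 1 + gauss_i dvd x"


section \<open>Subfields of the complex numbers and their integers\<close>

text \<open>
  \<open>gauss_field\<close> is $\mathbb{Q}(i)$, \<open>gauss_adjoin \<alpha>\<close> is $\mathbb{Q}(i)(\alpha)$, and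
  \<open>gauss_degree F n\<close> says $[F : \mathbb{Q}(i)] = n$.
\<close>

abbreviation complex_ring :: "complex ring"
  where "complex_ring \<equiv> ring_of_type_algebra"

definition gauss_field :: "complex set"
  where "gauss_field = generate_field complex_ring {\<i>}"

definition gauss_adjoin :: "complex \<Rightarrow> complex set"
  where "gauss_adjoin \<alpha> = generate_field complex_ring (insert \<alpha> gauss_field)"

definition gauss_degree :: "complex set \<Rightarrow> nat \<Rightarrow> bool"
  where "gauss_degree F n \<longleftrightarrow> ring.dimension complex_ring n gauss_field F"

definition ring_of_integers :: "complex set \<Rightarrow> complex set"
  where "ring_of_integers F = {x \<in> F. algebraic_int x}"

definition gauss_scale :: "gauss_int \<Rightarrow> complex \<Rightarrow> complex"
  where "gauss_scale c z = of_gauss c * z"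

interpretation gauss: Modules.module gauss_scale
  by standard (simp_all add: gauss_scale_def algebra_simps)

text \<open>
  A basis is given as a set, so elements listed with repetitions are counted once. For a field of
  degree 4 this is harmless: a basis of its ring of integers has exactly four elements.
\<close>

definition gauss_integral_basis :: "complex set \<Rightarrow> complex set \<Rightarrow> bool"
  where "gauss_integral_basis B F \<longleftrightarrow>
    gauss.independent B \<and> gauss.span B = ring_of_integers F"

end

theory Submission
  imports Defs "Jordan_Normal_Form.Char_Poly"
begin

text \<open>
  Put $\pi = 1 + i$, $\beta = \alpha^2 / (gh)$ and $\gamma = \alpha^3 / (gh^2)$. Taking traces of an integer
  $x \in N$ and using that $f, g, h$ are square free and coprime gives
  $4 x \in R = \mathbb{Z}[i] \langle 1, \alpha, \beta, \gamma \rangle$, so that only the prime $\pi$ (with $\pi^4 = -4$)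
  matters. Hence four integers of $N$ whose span contains $R$ form an integral basis as soon as they are
  linearly independent over $\mathbb{F}_2$ modulo $\pi$ times the ring of all algebraic integers: if $\pi y$ lies in
  their span and $y$ is integral, then all coefficients of $\pi y$ are divisible by $\pi$.
  This independence is read off a filtration by powers of a uniformizer where $\pi$ is totally ramified, and
  from the unramified quadratic subfield otherwise.
\<close>

text \<open>Congruences are taken in the ring of all algebraic integers, because O_N is the unknown;
  that ring meets Q(i) in Z[i], so coefficients can still be compared modulo 1 + i. No prime ideal
  is constructed: l with l^2 = (1 + i) times a unit modulo 1 + i, and P with P^2 \<equiv> l, stand
  for elements of valuation 2 and 1 when 1 + i has valuation 4. They arise from natural integers of
  N by subtracting the residue in F_2, which explains the correction terms built from the quotient
  in the congruence for m. The factors |c|^2 with c = gh or gh^2 reflect that the conjugate of an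
  odd c inverts c modulo 4; they reduce the odd cases to computations with \<alpha> alone. For even
  g, two separate congruences act. Whether (\<delta> + \<beta>)/2 is integral depends on fh modulo
  4, as \<beta>^2 = fh. Whether (\<epsilon> \<alpha> + \<gamma>)/2 is integral depends on f against
  \<epsilon>^2 h, as (\<epsilon> \<alpha> + \<gamma>)^2 = g ((\<epsilon>^2 h + f) \<beta> + 2
  \<epsilon> f h); this is what the product of f with the conjugate of h measures.\<close>

section \<open>The ring of algebraic integers\<close>

definition int_scale :: "int \<Rightarrow> complex \<Rightarrow> complex"
  where "int_scale c z = of_int c * z"

interpretation int_module: Modules.module int_scale
  by standard (simp_all add: int_scale_def algebra_simps)

text \<open>The determinant trick: on the enumerated set \<open>S\<close> multiplication by
  \<open>x\<close> is an integer matrix, and the vector of elements of \<open>S\<close> is an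
  eigenvector, nonzero because of \<open>s0\<close>. So \<open>x\<close> is a root of a monic
  integral characteristic polynomial. The set \<open>S\<close> may be linearly dependent.\<close>

lemma algebraic_int_if_eigenvalue:
  fixes x :: complex
  assumes "finite S" "s0 \<in> S" "s0 \<noteq> 0" and st: "\<And>s. s \<in> S \<Longrightarrow> x * s \<in> int_module.span S"
  shows "algebraic_int x"
proof -
  have "\<exists>u. \<forall>s\<in>S. x * s = (\<Sum>t\<in>S. of_int (u s t) * t)"
    using st by (intro bchoice) (auto simp: int_module.span_finite[OF \<open>finite S\<close>] int_scale_def)
  then obtain u where u: "x * s = (\<Sum>t\<in>S. of_int (u s t) * t)" if "s \<in> S" for s
    by auto
  define n where "n = card S"
  obtain v where v: "bij_betw v {..<n} S"
    using ex_bij_betw_nat_finite[OF \<open>finite S\<close>] by (auto simp: n_def atLeast0LessThan)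
  define A where "A = mat n n (\<lambda>(i, j). u (v i) (v j))"
  define B where "B = (map_mat of_int A :: complex mat)"
  have [simp]: "A \<in> carrier_mat n n" "B \<in> carrier_mat n n"
    by (simp_all add: A_def B_def)
  have "B *\<^sub>v vec n v = x \<cdot>\<^sub>v vec n v"
  proof (rule eq_vecI)
    fix i assume "i < dim_vec (x \<cdot>\<^sub>v vec n v)"
    then have i: "i < n" by simp
    then have "v i \<in> S"
      using v by (auto simp: bij_betw_def)
    have "(B *\<^sub>v vec n v) $ i = (\<Sum>j<n. of_int (u (v i) (v j)) * v j)"
      using i by (simp add: B_def A_def scalar_prod_def atLeast0LessThan)
    also have "\<dots> = x * v i"
      unfolding u[OF \<open>v i \<in> S\<close>] using v by (rule sum.reindex_bij_betw)
    finally show "(B *\<^sub>v vec n v) $ i = (x \<cdot>\<^sub>v vec n v) $ i"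
      using i by simp
  qed (simp add: B_def A_def)
  moreover have "vec n v \<noteq> 0\<^sub>v n"
  proof
    obtain i where "i < n" "v i = s0"
      using v \<open>s0 \<in> S\<close> by (auto simp: bij_betw_def)
    moreover assume "vec n v = 0\<^sub>v n"
    ultimately show False
      using \<open>s0 \<noteq> 0\<close> by (metis index_vec index_zero_vec(1))
  qed
  ultimately have "eigenvalue B x"
    unfolding eigenvalue_def eigenvector_def by (intro exI[of _ "vec n v"]) (simp add: B_def A_def)
  then have "poly (char_poly B) x = 0"
    using eigenvalue_root_char_poly[of B n] by simp
  moreover have "char_poly B = map_poly of_int (char_poly A)"
    unfolding B_def by (rule of_int_hom.char_poly_hom[of A n]) simp
  ultimately show ?thesis
    unfolding algebraic_int_altdef_ipoly
    using degree_monic_char_poly[of A n] by auto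
qed

lemma int_span_mult_stable:
  assumes "\<And>s. s \<in> S \<Longrightarrow> x * s \<in> int_module.span T" "y \<in> int_module.span S"
  shows "x * y \<in> int_module.span T"
  using assms(2)
proof (induction rule: int_module.span_induct_alt)
  case base
  show ?case by (simp add: int_module.span_zero)
next
  case (step c s y)
  have "x * (int_scale c s + y) = int_scale c (x * s) + x * y"
    by (simp add: int_scale_def algebra_simps)
  then show ?case
    using step assms(1) by (auto intro: int_module.span_add int_module.span_scale)
qed

text \<open>The powers of \<open>x\<close> below the degree of a monic integral polynomial work,
  since that polynomial rewrites \<open>x ^ n\<close>. The element \<open>1\<close> later serves as
  the nonzero \<open>s0\<close> of the eigenvalue criterion.\<close>

lemma algebraic_int_imp_stable:
  fixes x :: complex
  assumes "algebraic_int x"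
  obtains S where "finite S" "1 \<in> S" "\<And>s. s \<in> S \<Longrightarrow> x * s \<in> int_module.span S"
proof -
  obtain p where p: "poly (map_poly of_int p) x = 0" "Polynomial.lead_coeff p = 1"
    using assms by (auto simp: algebraic_int_altdef_ipoly)
  define n where "n = Polynomial.degree p"
  have "n > 0"
  proof (rule ccontr)
    assume "\<not> n > 0"
    then have "p = 1"
      using p(2) by (auto simp: n_def elim!: degree_eq_zeroE)
    then show False using p(1) by simp
  qed
  define S where "S = (\<lambda>i. x ^ i) ` {..<n}"
  have "0 = (\<Sum>i\<le>n. of_int (Polynomial.coeff p i) * x ^ i)"
    using p(1) by (simp add: poly_altdef n_def)
  also have "\<dots> = x ^ n + (\<Sum>i<n. of_int (Polynomial.coeff p i) * x ^ i)"
    using p(2) by (simp add: n_def flip: lessThan_Suc_atMost)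
  finally have "x ^ n = - (\<Sum>i<n. int_scale (Polynomial.coeff p i) (x ^ i))"
    by (simp add: int_scale_def add_eq_0_iff2)
  then have xn: "x ^ n \<in> int_module.span S"
    by (simp only:, intro int_module.span_neg int_module.span_sum int_module.span_scale
          int_module.span_base) (auto simp: S_def)
  show ?thesis
  proof
    show "finite S" by (simp add: S_def)
    show "1 \<in> S" using \<open>n > 0\<close> by (auto simp: S_def intro!: image_eqI[of _ _ 0])
    fix s assume "s \<in> S"
    then obtain i where i: "i < n" "s = x ^ i" by (auto simp: S_def)
    show "x * s \<in> int_module.span S"
    proof (cases "Suc i = n")
      case True
      then show ?thesis using xn i by auto
    next
      case False
      then have "x ^ Suc i \<in> S" using i(1) unfolding S_def by (intro imageI) simp
      then show ?thesis using i(2) by (auto intro: int_module.span_base)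
    qed
  qed
qed

text \<open>Products of the two stable sets: \<open>x\<close> acts on one factor and
  \<open>y\<close> on the other. Closure under sums and products follows from one common
  module.\<close>

lemma algebraic_int_common_stable:
  fixes x y :: complex
  assumes "algebraic_int x" "algebraic_int y"
  obtains S where "finite S" "1 \<in> S" "\<And>s. s \<in> int_module.span S \<Longrightarrow> x * s \<in> int_module.span S"
    "\<And>s. s \<in> int_module.span S \<Longrightarrow> y * s \<in> int_module.span S"
proof -
  obtain S where S: "finite S" "1 \<in> S" "\<And>s. s \<in> S \<Longrightarrow> x * s \<in> int_module.span S"
    using algebraic_int_imp_stable[OF assms(1)] by blast
  obtain T where T: "finite T" "1 \<in> T" "\<And>s. s \<in> T \<Longrightarrow> y * s \<in> int_module.span T"
    using algebraic_int_imp_stable[OF assms(2)] by blast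
  define P where "P = (\<lambda>(s, t). s * t) ` (S \<times> T)"
  have ST: "s * t \<in> P" if "s \<in> S" "t \<in> T" for s t
    using that by (auto simp: P_def)
  have 1: "x * p \<in> int_module.span P" if p: "p \<in> P" for p
  proof -
    obtain s t where st: "s \<in> S" "t \<in> T" "p = s * t" using p by (auto simp: P_def)
    have "t * (x * s) \<in> int_module.span P"
      by (rule int_span_mult_stable[of S])
        (use st S ST in \<open>auto intro: int_module.span_base simp: mult.commute[of t]\<close>)
    then show ?thesis using st by (simp add: mult_ac)
  qed
  have 2: "y * p \<in> int_module.span P" if p: "p \<in> P" for p
  proof -
    obtain s t where st: "s \<in> S" "t \<in> T" "p = s * t" using p by (auto simp: P_def)
    have "s * (y * t) \<in> int_module.span P"
      by (rule int_span_mult_stable[of T])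
        (use st T ST in \<open>auto intro: int_module.span_base\<close>)
    then show ?thesis using st by (simp add: mult_ac)
  qed
  show ?thesis
  proof
    show "finite P" using S T by (simp add: P_def)
    show "1 \<in> P" using ST[of 1 1] S T by simp
    show "x * s \<in> int_module.span P" if "s \<in> int_module.span P" for s
      using int_span_mult_stable[OF 1 that] .
    show "y * s \<in> int_module.span P" if "s \<in> int_module.span P" for s
      using int_span_mult_stable[OF 2 that] .
  qed
qed

lemma algebraic_int_add [intro]:
  fixes x y :: complex
  assumes "algebraic_int x" "algebraic_int y"
  shows "algebraic_int (x + y)"
proof -
  obtain S where S: "finite S" "1 \<in> S"
    "\<And>s. s \<in> int_module.span S \<Longrightarrow> x * s \<in> int_module.span S"
    "\<And>s. s \<in> int_module.span S \<Longrightarrow> y * s \<in> int_module.span S"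
    using algebraic_int_common_stable[OF assms] by blast
  show ?thesis
    by (rule algebraic_int_if_eigenvalue[of S 1])
      (use S in \<open>auto simp: distrib_right intro!: int_module.span_add intro: int_module.span_base\<close>)
qed

lemma algebraic_int_mult [intro]:
  fixes x y :: complex
  assumes "algebraic_int x" "algebraic_int y"
  shows "algebraic_int (x * y)"
proof -
  obtain S where S: "finite S" "1 \<in> S"
    "\<And>s. s \<in> int_module.span S \<Longrightarrow> x * s \<in> int_module.span S"
    "\<And>s. s \<in> int_module.span S \<Longrightarrow> y * s \<in> int_module.span S"
    using algebraic_int_common_stable[OF assms] by blast
  show ?thesis
    by (rule algebraic_int_if_eigenvalue[of S 1])
      (use S in \<open>auto simp: mult.assoc intro: int_module.span_base\<close>)
qed

text \<open>Transitivity of integrality for monic quadratics: \<open>S\<close> together with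
  \<open>x\<close> times \<open>S\<close> is stable because x^2 s = x (a s) + b s. Most integrality
  claims about basis elements rest on this.\<close>

lemma algebraic_int_quadratic:
  fixes x a b :: complex
  assumes "algebraic_int a" "algebraic_int b" "x\<^sup>2 = a * x + b"
  shows "algebraic_int x"
proof -
  obtain S where S: "finite S" "1 \<in> S"
    "\<And>s. s \<in> int_module.span S \<Longrightarrow> a * s \<in> int_module.span S"
    "\<And>s. s \<in> int_module.span S \<Longrightarrow> b * s \<in> int_module.span S"
    using algebraic_int_common_stable[OF assms(1,2)] by blast
  define T where "T = S \<union> (*) x ` S"
  have sub: "int_module.span S \<subseteq> int_module.span T"
    by (rule int_module.span_mono) (auto simp: T_def)
  have xS: "x * s \<in> int_module.span T" if "s \<in> int_module.span S" for s
    by (rule int_span_mult_stable[OF _ that]) (auto simp: T_def intro: int_module.span_base)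
  have "x * t \<in> int_module.span T" if t: "t \<in> T" for t
  proof (cases "t \<in> S")
    case True
    then show ?thesis using xS by (auto intro: int_module.span_base)
  next
    case False
    then obtain s where s: "s \<in> S" "t = x * s" using t by (auto simp: T_def)
    have "x * t = x\<^sup>2 * s"
      using s by (simp add: power2_eq_square)
    also have "\<dots> = x * (a * s) + b * s"
      by (simp add: assms(3) algebra_simps)
    finally have "x * t = x * (a * s) + b * s" .
    then show ?thesis
      using s S sub xS by (auto intro!: int_module.span_add intro: int_module.span_base)
  qed
  then show ?thesis
    using S by (intro algebraic_int_if_eigenvalue[of T 1]) (auto simp: T_def)
qed

section \<open>The quartic field\<close>

lemma complex_ring_sel [simp]:
  "carrier complex_ring = UNIV" "\<zero>\<^bsub>complex_ring\<^esub> = 0" "\<one>\<^bsub>complex_ring\<^esub> = 1"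
  "x \<oplus>\<^bsub>complex_ring\<^esub> y = x + y" "x \<otimes>\<^bsub>complex_ring\<^esub> y = x * y"
  by (simp_all add: ring_of_type_algebra_def)

lemma field_complex_ring: "field complex_ring"
  by (rule field_from_type_algebra)

interpretation complex_ring: domain complex_ring
  using field_complex_ring by (rule field.axioms(1))

lemma complex_ring_uminus [simp]: "\<ominus>\<^bsub>complex_ring\<^esub> x = - x"
  by (metis complex_ring.add.inv_equality complex_ring_sel add.left_inverse UNIV_I)

lemma complex_ring_inverse: "x \<noteq> 0 \<Longrightarrow> inv\<^bsub>complex_ring\<^esub> x = inverse x"
  by (rule complex_ring.comm_inv_char) auto

lemma complex_ring_power [simp]: "x [^]\<^bsub>complex_ring\<^esub> (n :: nat) = x ^ n"
  by (induction n) (simp_all add: mult.commute)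

section \<open>Subfields of the complex numbers, Q(i) and the power basis of N\<close>

lemma subfield_complex_ringI:
  fixes E :: "complex set"
  assumes "1 \<in> E" "\<And>x y. x \<in> E \<Longrightarrow> y \<in> E \<Longrightarrow> x + y \<in> E" "\<And>x. x \<in> E \<Longrightarrow> - x \<in> E"
    "\<And>x y. x \<in> E \<Longrightarrow> y \<in> E \<Longrightarrow> x * y \<in> E" "\<And>x. x \<in> E \<Longrightarrow> inverse x \<in> E"
  shows "subfield E complex_ring"
  by (intro field.subfieldI'[OF field_complex_ring] complex_ring.subringI)
    (use assms in \<open>auto simp: complex_ring_inverse\<close>)

lemma subfield_complex_ringD:
  fixes E :: "complex set"
  assumes "subfield E complex_ring"
  shows "0 \<in> E" "1 \<in> E" "\<And>x y. x \<in> E \<Longrightarrow> y \<in> E \<Longrightarrow> x + y \<in> E" "\<And>x. x \<in> E \<Longrightarrow> - x \<in> E"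
    "\<And>x y. x \<in> E \<Longrightarrow> y \<in> E \<Longrightarrow> x - y \<in> E" "\<And>x y. x \<in> E \<Longrightarrow> y \<in> E \<Longrightarrow> x * y \<in> E"
    "\<And>x y. x \<in> E \<Longrightarrow> y \<in> E \<Longrightarrow> x / y \<in> E" "\<And>x n. x \<in> E \<Longrightarrow> x ^ n \<in> E"
proof -
  note sub = subringE[OF subfieldE(1)[OF assms]]
  show 0: "0 \<in> E" and 1: "1 \<in> E"
    using sub(2,3) by simp_all
  show add: "x + y \<in> E" if "x \<in> E" "y \<in> E" for x y
    using sub(7)[OF that] by simp
  show neg: "- x \<in> E" if "x \<in> E" for x
    using sub(5)[OF that] by simp
  show "x - y \<in> E" if "x \<in> E" "y \<in> E" for x y
    using add[OF that(1) neg[OF that(2)]] by simp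
  show mult: "x * y \<in> E" if "x \<in> E" "y \<in> E" for x y
    using sub(6)[OF that] by simp
  show "x / y \<in> E" if "x \<in> E" "y \<in> E" for x y
  proof (cases "y = 0")
    case False
    then have "inverse y \<in> E"
      using complex_ring.subfield_m_inv(1)[OF assms, of y] that(2) by (simp add: complex_ring_inverse)
    then show ?thesis
      using mult that(1) by (simp add: divide_inverse)
  qed (simp add: 0)
  show "x ^ n \<in> E" if "x \<in> E" for x n
    using that by (induction n) (auto intro: 1 mult)
qed

lemma subfield_gauss_field: "subfield gauss_field complex_ring"
  unfolding gauss_field_def by (rule field.generate_field_is_subfield[OF field_complex_ring]) simp

lemmas gauss_field_closed [simp, intro] = subfield_complex_ringD[OF subfield_gauss_field]

lemma of_gauss_in_subfield:
  assumes "subfield E complex_ring" "\<i> \<in> E"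
  shows "of_gauss c \<in> E"
proof -
  note E = subfield_complex_ringD[OF assms(1)]
  have nat: "of_nat n \<in> E" for n
    by (induction n) (auto intro: E)
  have "of_int k \<in> E" for k
    using nat E(4) by (cases k rule: int_cases2) auto
  then have "of_int (gRe c) + \<i> * of_int (gIm c) \<in> E"
    by (intro E assms)
  also have "of_int (gRe c) + \<i> * of_int (gIm c) = of_gauss c"
    by (simp add: of_gauss_def complex_eq_iff)
  finally show ?thesis .
qed

lemma ii_in_gauss_field: "\<i> \<in> gauss_field"
  by (simp add: gauss_field_def generate_field.incl)

lemma of_gauss_in_gauss_field [simp]: "of_gauss c \<in> gauss_field"
  by (rule of_gauss_in_subfield) (simp_all add: subfield_gauss_field ii_in_gauss_field)

lemma gauss_field_Rats:
  assumes "x \<in> gauss_field"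
  shows "Re x \<in> \<rat>" "Im x \<in> \<rat>"
proof -
  define E where "E = {x. Re x \<in> \<rat> \<and> Im x \<in> \<rat>}"
  have "subfield E complex_ring"
    by (rule subfield_complex_ringI) (auto simp: E_def)
  then have "gauss_field \<subseteq> E"
    unfolding gauss_field_def by (intro field.generate_field_min_subfield1[OF field_complex_ring]) (auto simp: E_def)
  then show "Re x \<in> \<rat>" "Im x \<in> \<rat>"
    using assms by (auto simp: E_def)
qed

lemma gauss_field_fraction:
  assumes "x \<in> gauss_field"
  obtains a b where "b \<noteq> 0" "x = of_gauss a / of_gauss b"
proof -
  obtain p q where pq: "q \<noteq> 0" "Re x = real_of_int p / real_of_int q"
    using gauss_field_Rats(1)[OF assms] by (elim Rats_cases') (metis less_irrefl)
  obtain r s where rs: "s \<noteq> 0" "Im x = real_of_int r / real_of_int s"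
    using gauss_field_Rats(2)[OF assms] by (elim Rats_cases') (metis less_irrefl)
  have "x * of_gauss (GaussInt (q * s) 0) = of_gauss (GaussInt (p * s) (r * q))"
    using pq rs by (auto simp: of_gauss_def complex_eq_iff)
  moreover have "GaussInt (q * s) 0 \<noteq> 0"
    using pq rs by (auto simp: gauss_int_eq_iff)
  ultimately show ?thesis
    using that[of "GaussInt (q * s) 0" "GaussInt (p * s) (r * q)"]
    by (simp add: eq_divide_eq)
qed

text \<open>Uniqueness of the dimension forces the minimal polynomial of \<alpha> to have degree 4,
  so the powers of \<alpha> below 4 are a basis. The degree hypothesis enters later arguments only
  through these two coordinate statements.\<close>

lemma gauss_adjoin_degree_4:
  assumes "gauss_degree (gauss_adjoin \<alpha>) 4"
  shows gauss_adjoin_eq: "gauss_adjoin \<alpha> = {a + b * \<alpha> + c * \<alpha>\<^sup>2 + d * \<alpha> ^ 3 |a b c d.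
            a \<in> gauss_field \<and> b \<in> gauss_field \<and> c \<in> gauss_field \<and> d \<in> gauss_field}"
    and gauss_adjoin_independent:
      "\<And>a b c d. \<lbrakk>a \<in> gauss_field; b \<in> gauss_field; c \<in> gauss_field; d \<in> gauss_field;
          a + b * \<alpha> + c * \<alpha>\<^sup>2 + d * \<alpha> ^ 3 = 0\<rbrakk> \<Longrightarrow> a = 0 \<and> b = 0 \<and> c = 0 \<and> d = 0"
proof -
  note K = subfield_gauss_field
  define L where "L = complex_ring.simple_extension gauss_field \<alpha>"
  have sub: "subfield (gauss_adjoin \<alpha>) complex_ring"
    unfolding gauss_adjoin_def by (rule field.generate_field_is_subfield[OF field_complex_ring]) simp
  have dim: "complex_ring.dimension 4 gauss_field (gauss_adjoin \<alpha>)"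
    using assms by (simp add: gauss_degree_def)
  have alg: "(complex_ring.algebraic over gauss_field) \<alpha>"
    by (rule complex_ring.finite_dimension_imp_algebraic[OF K subfieldE(1)[OF sub]])
      (use dim in \<open>auto simp: gauss_adjoin_def generate_field.incl
         intro: complex_ring.finite_dimensionI\<close>)
  have "subfield L complex_ring"
    using alg complex_ring.simple_extension_is_subfield[OF K] by (simp add: L_def)
  moreover have "insert \<alpha> gauss_field \<subseteq> L"
    using complex_ring.simple_extension_incl[of gauss_field \<alpha>]
      complex_ring.simple_extension_mem[OF subfieldE(1)[OF K], of \<alpha>] by (simp add: L_def)
  ultimately have "gauss_adjoin \<alpha> \<subseteq> L"
    unfolding gauss_adjoin_def by (intro field.generate_field_min_subfield1[OF field_complex_ring]) simp_all
  moreover have "L \<subseteq> gauss_adjoin \<alpha>"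
    unfolding L_def
    by (rule complex_ring.simple_extension_subring_incl[OF subfieldE(1)[OF sub]])
      (auto simp: gauss_adjoin_def generate_field.incl)
  ultimately have L: "gauss_adjoin \<alpha> = L" by simp
  have "(complex_ring.dimension (Polynomials.degree (complex_ring.Irr gauss_field \<alpha>)) gauss_field L)"
    unfolding L_def by (rule complex_ring.dimension_simple_extension[OF K _ alg]) simp
  then have deg: "Polynomials.degree (complex_ring.Irr gauss_field \<alpha>) = 4"
    using dim complex_ring.dimension_is_inj[OF K] unfolding L by metis
  define Us where "Us = [\<alpha> ^ 3, \<alpha>\<^sup>2, \<alpha>, 1]"
  have exp_base: "complex_ring.exp_base \<alpha> 4 = Us"
    by (simp add: complex_ring.exp_base_def Us_def numeral_eq_Suc)
  have indep: "complex_ring.independent gauss_field Us"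
    using complex_ring.exp_base_independent[OF K _ alg] unfolding deg exp_base by simp
  have Span: "complex_ring.Span gauss_field Us = L"
    using complex_ring.Span_exp_base[OF K _ alg] unfolding deg exp_base L_def by simp
  have mem: "x \<in> gauss_adjoin \<alpha> \<longleftrightarrow> (\<exists>Ks. set Ks \<subseteq> gauss_field \<and> length Ks = length Us \<and>
      x = complex_ring.combine Ks Us)" for x
    unfolding L Span[symmetric] by (rule complex_ring.Span_mem_iff_length_version[OF K]) simp
  have combine: "complex_ring.combine [d, c, b, a] Us = a + b * \<alpha> + c * \<alpha>\<^sup>2 + d * \<alpha> ^ 3" for a b c d
    by (simp add: Us_def)
  show "gauss_adjoin \<alpha> = {a + b * \<alpha> + c * \<alpha>\<^sup>2 + d * \<alpha> ^ 3 |a b c d.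
            a \<in> gauss_field \<and> b \<in> gauss_field \<and> c \<in> gauss_field \<and> d \<in> gauss_field}"
    (is "_ = ?S")
  proof (intro Set.set_eqI iffI)
    fix x assume "x \<in> gauss_adjoin \<alpha>"
    then obtain Ks where Ks: "set Ks \<subseteq> gauss_field" "length Ks = length Us"
        "x = complex_ring.combine Ks Us"
      unfolding mem by blast
    obtain d c b a where "Ks = [d, c, b, a]"
      using Ks(2) by (auto simp: Us_def numeral_eq_Suc length_Suc_conv)
    then show "x \<in> ?S"
      using Ks(1,3) combine[of d c b a] by auto
  next
    fix x assume "x \<in> ?S"
    then obtain a b c d where "set [d, c, b, a] \<subseteq> gauss_field"
        "x = complex_ring.combine [d, c, b, a] Us"
      unfolding combine by auto
    then show "x \<in> gauss_adjoin \<alpha>"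
      unfolding mem by (intro exI[of _ "[d, c, b, a]"]) (simp add: Us_def)
  qed
  fix a b c d
  assume "a \<in> gauss_field" "b \<in> gauss_field" "c \<in> gauss_field" "d \<in> gauss_field"
    "a + b * \<alpha> + c * \<alpha>\<^sup>2 + d * \<alpha> ^ 3 = 0"
  then show "a = 0 \<and> b = 0 \<and> c = 0 \<and> d = 0"
    using complex_ring.independent_imp_trivial_combine[OF K indep, of "[d, c, b, a]"]
    unfolding combine by (simp add: Us_def)
qed

section \<open>Arithmetic of Gaussian integers\<close>

lemma of_gauss_numeral [simp]: "of_gauss (numeral k) = numeral k"
proof -
  have "of_gauss (of_nat n) = of_nat n" for n
    by (induction n) simp_all
  from this[of "numeral k"] show ?thesis by simp
qed

lemma gauss_int_numeral_sel [simp]: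
  "gRe (numeral k) = numeral k" "gIm (numeral k) = 0"
proof -
  have "real_of_int (gRe (numeral k)) = real_of_int (numeral k)"
    "real_of_int (gIm (numeral k)) = real_of_int 0"
    using of_gauss_numeral[of k] by (simp_all add: of_gauss_def complex_eq_iff)
  then show "gRe (numeral k) = numeral k" "gIm (numeral k) = 0"
    by (simp_all only: of_int_eq_iff)
qed

lemma algebraic_int_of_int [simp, intro]: "algebraic_int (of_int k :: complex)"
  by (rule int_imp_algebraic_int) simp

lemma algebraic_int_numeral [simp, intro]: "algebraic_int (numeral k :: complex)"
  using algebraic_int_of_int[of "numeral k"] by simp

lemma algebraic_int_1 [simp, intro]: "algebraic_int (1 :: complex)"
  using algebraic_int_of_int[of 1] by simp

lemma algebraic_int_diff [intro]:
  "algebraic_int x \<Longrightarrow> algebraic_int y \<Longrightarrow> algebraic_int (x - y :: complex)"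
  using algebraic_int_add[of x "- y"] by auto

lemma algebraic_int_power [intro]: "algebraic_int x \<Longrightarrow> algebraic_int (x ^ n :: complex)"
  by (induction n) auto

lemmas algebraic_int_intros =
  algebraic_int_add algebraic_int_diff algebraic_int_mult algebraic_int_power

lemma algebraic_int_powerD:
  assumes "algebraic_int (x ^ n :: complex)" "n > 0"
  shows "algebraic_int x"
proof (rule algebraic_int_root[OF assms(1)])
  show "poly (Polynomial.monom 1 n) x = x ^ n"
    by (simp add: poly_monom)
qed (use assms in \<open>auto simp: Polynomial.degree_monom_eq\<close>)

lemma of_gauss_eq: "of_gauss c = of_int (gRe c) + \<i> * of_int (gIm c)"
  by (simp add: of_gauss_def complex_eq_iff)

lemma algebraic_int_of_gauss [simp, intro]: "algebraic_int (of_gauss c)"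
  unfolding of_gauss_eq by auto

text \<open>Z[i] is integrally closed: trace and norm of \<open>x\<close>, and of \<open>x\<close>
  times i, show that a = 2 Re x, b = 2 Im x and (a^2 + b^2)/4 are integers, and squares modulo 4
  then force a and b to be even.\<close>

lemma gauss_field_algebraic_int:
  assumes "x \<in> gauss_field" "algebraic_int x"
  obtains c where "x = of_gauss c"
proof -
  have real: "r \<in> \<int>" if "algebraic_int (complex_of_real r)" "r \<in> \<rat>" for r
    using that by (simp add: rational_algebraic_int_is_int)
  have cnj: "algebraic_int (cnj x)"
    using assms by simp
  note rats = gauss_field_Rats[OF assms(1)]
  have "complex_of_real (2 * Re x) = x + cnj x"
    by (simp add: complex_eq_iff)
  then have "2 * Re x \<in> \<int>"
    using assms cnj rats by (intro real) auto
  then obtain a where a: "2 * Re x = of_int a"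
    by (auto elim: Ints_cases)
  have "complex_of_real (2 * Im x) = \<i> * (cnj x - x)"
    by (simp add: complex_eq_iff)
  then have "2 * Im x \<in> \<int>"
    using assms cnj rats by (intro real) auto
  then obtain b where b: "2 * Im x = of_int b"
    by (auto elim: Ints_cases)
  have "complex_of_real ((Re x)\<^sup>2 + (Im x)\<^sup>2) = x * cnj x"
    by (simp add: complex_eq_iff power2_eq_square)
  then have "(Re x)\<^sup>2 + (Im x)\<^sup>2 \<in> \<int>"
    using assms cnj rats by (intro real) auto
  then obtain n where n: "(Re x)\<^sup>2 + (Im x)\<^sup>2 = of_int n"
    by (auto elim: Ints_cases)
  have "real_of_int (a\<^sup>2 + b\<^sup>2) = (2 * Re x)\<^sup>2 + (2 * Im x)\<^sup>2"
    by (simp add: a b)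
  also have "\<dots> = real_of_int (4 * n)"
    by (simp add: power_mult_distrib flip: n)
  finally have sum: "a\<^sup>2 + b\<^sup>2 = 4 * n"
    by linarith
  have "even a \<and> even b"
  proof (rule ccontr)
    assume "\<not> (even a \<and> even b)"
    moreover have "even a \<longleftrightarrow> even b"
      using sum by (metis dvd_triv_left even_add even_mult_iff even_numeral even_power pos2)
    ultimately obtain k l where "a = 2 * k + 1" "b = 2 * l + 1"
      by (auto elim!: oddE)
    then have "2 * (2 * (k\<^sup>2 + k + l\<^sup>2 + l)) + 2 = 4 * n"
      using sum by (simp add: power2_eq_square algebra_simps)
    then show False by presburger
  qed
  then obtain k l where "a = 2 * k" "b = 2 * l"
    by (auto elim!: evenE)
  then have "x = of_gauss (GaussInt k l)"
    using a b by (simp add: of_gauss_def complex_eq_iff)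
  then show ?thesis using that by blast
qed

section \<open>Divisibility and square-free elements in Z[i]\<close>

lemma gauss_bezout:
  fixes a b :: gauss_int
  shows "\<exists>u v. u * a + v * b dvd a \<and> u * a + v * b dvd b"
proof (induction "euclidean_size b" arbitrary: a b rule: less_induct)
  case less
  show ?case
  proof (cases "b = 0")
    case True
    then show ?thesis by (intro exI[of _ 1]) simp
  next
    case False
    then obtain u v where uv: "u * b + v * (a mod b) dvd b" "u * b + v * (a mod b) dvd a mod b"
      using less[of "a mod b" b] by (auto simp: mod_size_less)
    have eq: "u * b + v * (a mod b) = v * a + (u - v * (a div b)) * b"
      by (simp add: modulo_gauss_int_def algebra_simps)
    have "u * b + v * (a mod b) dvd a div b * b + a mod b"
      using uv by (intro dvd_add dvd_mult)
    then show ?thesis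
      using uv(1) unfolding eq by (auto intro!: exI)
  qed
qed

lemma gauss_coprime_bezout:
  fixes a b :: gauss_int
  assumes "coprime a b"
  obtains u v where "u * a + v * b = 1"
proof -
  obtain u v where "u * a + v * b dvd a" "u * a + v * b dvd b"
    using gauss_bezout by blast
  then have "u * a + v * b dvd 1"
    using assms by (meson coprime_common_divisor)
  then obtain k where "1 = (u * a + v * b) * k" ..
  then have "(u * k) * a + (v * k) * b = 1"
    by (simp add: algebra_simps)
  then show ?thesis using that by blast
qed

lemma gauss_coprime_dvd_mult:
  fixes a b c :: gauss_int
  assumes "coprime a b" "a dvd b * c"
  shows "a dvd c"
proof -
  obtain u v where "u * a + v * b = 1"
    using gauss_coprime_bezout[OF assms(1)] .
  then have "c = a * (u * c) + v * (b * c)"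
    by (metis distrib_right mult.assoc mult.commute mult_1)
  then show ?thesis
    using assms(2) by (metis dvd_add dvd_mult dvd_triv_left)
qed

text \<open>Coprimality splits off one factor \<open>a\<close> of \<open>c\<close>; after cancelling
  it, the same argument applies to the cofactor.\<close>

lemma gauss_coprime_square_dvd_mult:
  fixes a b c :: gauss_int
  assumes "coprime a b" "a\<^sup>2 dvd b * c"
  shows "a\<^sup>2 dvd c"
proof -
  have "a dvd b * c"
    using assms(2) by (metis dvd_mult_left power2_eq_square)
  then obtain d where d: "c = a * d"
    using gauss_coprime_dvd_mult[OF assms(1)] by blast
  show ?thesis
  proof (cases "a = 0")
    case False
    have "a * a dvd a * (b * d)"
      using assms(2) by (simp add: d power2_eq_square mult_ac)
    then have "a dvd b * d"
      using False by (simp only: dvd_mult_cancel_left) simp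
    then have "a dvd d"
      by (rule gauss_coprime_dvd_mult[OF assms(1)])
    then show ?thesis
      unfolding d power2_eq_square by (rule mult_dvd_mono[OF dvd_refl])
  qed (simp add: d)
qed

lemma gauss_gcd_cofactors:
  fixes a b :: gauss_int
  assumes "b \<noteq> 0"
  obtains d a' b' where "d \<noteq> 0" "a = d * a'" "b = d * b'" "coprime a' b'"
proof -
  obtain u v where uv: "u * a + v * b dvd a" "u * a + v * b dvd b"
    using gauss_bezout by blast
  define d where "d = u * a + v * b"
  obtain a' b' where ab: "a = d * a'" "b = d * b'"
    using uv unfolding d_def[symmetric] by (metis dvdE)
  have "d \<noteq> 0"
    using ab assms by auto
  have "d * (u * a' + v * b') = u * (d * a') + v * (d * b')"
    by (simp add: algebra_simps)
  also have "\<dots> = d * 1"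
    unfolding ab[symmetric] by (simp add: d_def)
  finally have "u * a' + v * b' = 1"
    using \<open>d \<noteq> 0\<close> by (metis mult_left_cancel)
  have "coprime a' b'"
  proof (rule coprimeI)
    fix c assume "c dvd a'" "c dvd b'"
    then have "c dvd u * a' + v * b'"
      by (intro dvd_add dvd_mult)
    then show "c dvd 1"
      by (simp only: \<open>u * a' + v * b' = 1\<close>)
  qed
  then show ?thesis using that \<open>d \<noteq> 0\<close> ab by blast
qed

lemma gauss_squarefree_nonzero: "squarefree a \<Longrightarrow> a \<noteq> (0 :: gauss_int)"
  by (auto simp: squarefree_def dest: spec[of _ 0])

lemma gauss_squarefree_mult:
  fixes a b :: gauss_int
  assumes "coprime a b" "squarefree a" "squarefree b"
  shows "squarefree (a * b)"
proof (rule squarefreeI)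
  fix x assume x: "x\<^sup>2 dvd a * b"
  have "a \<noteq> 0"
    using assms(2) by (rule gauss_squarefree_nonzero)
  \<comment> \<open>Here d is a gcd of x and a. The square of the cofactor x' has to divide b, so x'
    is a unit and x itself divides a; then x is coprime to b and its whole square falls on
    a.\<close>
  obtain d x' a' where d: "d \<noteq> 0" "x = d * x'" "a = d * a'" "coprime x' a'"
    using gauss_gcd_cofactors[OF \<open>a \<noteq> 0\<close>, of x] .
  have "d * (d * x'\<^sup>2) dvd d * (a' * b)"
    using x by (simp add: d power2_eq_square mult_ac)
  then have *: "d * x'\<^sup>2 dvd a' * b"
    using d(1) by (simp only: dvd_mult_cancel_left) simp
  then have "x'\<^sup>2 dvd b"
    using gauss_coprime_square_dvd_mult[OF d(4)] dvd_mult_right by blast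
  then have "x' dvd 1"
    using assms(3) by (auto simp: squarefree_def)
  then have "x dvd a"
    unfolding d(2,3) by (intro mult_dvd_mono dvd_refl dvd_trans[of x' 1 a'] one_dvd)
  then have "coprime x b"
    using assms(1) by (meson coprime_divisors dvd_refl)
  then have "x\<^sup>2 dvd a"
    using x gauss_coprime_square_dvd_mult[of x b a] by (simp add: mult.commute)
  then show "x dvd 1"
    using assms(2) by (auto simp: squarefree_def)
qed

text \<open>In lowest terms the square of the denominator divides \<open>d\<close>, so the
  denominator is a unit. This is how square-freeness clears the denominators of coordinates.\<close>

lemma gauss_field_square_mult:
  assumes "x \<in> gauss_field" "squarefree d" "x\<^sup>2 * of_gauss d = of_gauss c"
  obtains e where "x = of_gauss e"
proof -
  obtain a b where ab: "b \<noteq> 0" "x = of_gauss a / of_gauss b"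
    using gauss_field_fraction[OF assms(1)] .
  obtain q a' b' where q: "q \<noteq> 0" "a = q * a'" "b = q * b'" "coprime a' b'"
    using gauss_gcd_cofactors[OF ab(1), of a] .
  have x: "x = of_gauss a' / of_gauss b'" and b': "b' \<noteq> 0"
    using ab q by (simp_all add: field_simps)
  have "of_gauss (a'\<^sup>2 * d) = of_gauss (c * b'\<^sup>2)"
    using assms(3) b' by (simp add: x field_simps)
  then have "b'\<^sup>2 dvd a' * (a' * d)"
    by (simp only: of_gauss_inject) (simp add: power2_eq_square mult.assoc)
  then have "b'\<^sup>2 dvd d"
    using q(4) by (metis coprime_commute gauss_coprime_square_dvd_mult)
  then have "b' dvd 1"
    using assms(2) by (auto simp: squarefree_def)
  then obtain u where u: "1 = b' * u" ..
  then have "of_gauss b' * of_gauss u = 1"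
    by (metis of_gauss_hom(2,7))
  then have "x = of_gauss (a' * u)"
    using b' by (simp add: x field_simps)
  then show ?thesis using that by blast
qed

section \<open>Pure quartic extensions\<close>

locale pure_quartic =
  fixes f g h :: gauss_int and \<alpha> :: complex
  assumes coprime: "coprime f g" "coprime f h" "coprime g h"
    and squarefree: "squarefree f" "squarefree g" "squarefree h"
    and \<alpha>4: "\<alpha> ^ 4 = of_gauss (f * g\<^sup>2 * h ^ 3)"
    and degree: "gauss_degree (gauss_adjoin \<alpha>) 4"
begin

abbreviation "F \<equiv> of_gauss f"
abbreviation "G \<equiv> of_gauss g"
abbreviation "H \<equiv> of_gauss h"

text \<open>Since m = (gh)^2 fh, the square of \<beta> is fh; and \<gamma>^4 = f^3 g^2 h, so
  exchanging f and h exchanges \<alpha> and \<gamma>. The products computed below show that 1,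
  \<alpha>, \<beta>, \<gamma> span a ring.\<close>

definition "\<beta> = \<alpha>\<^sup>2 / (G * H)"
definition "\<gamma> = \<alpha> ^ 3 / (G * H\<^sup>2)"

lemma nonzero: "F \<noteq> 0" "G \<noteq> 0" "H \<noteq> 0"
  using squarefree by (auto dest: gauss_squarefree_nonzero)

lemma alpha_squared: "\<alpha>\<^sup>2 = G * H * \<beta>"
  and alpha_cubed: "\<alpha> ^ 3 = G * H\<^sup>2 * \<gamma>"
  using nonzero by (simp_all add: \<beta>_def \<gamma>_def)

lemma alpha_beta: "\<alpha> * \<beta> = H * \<gamma>"
  using nonzero by (simp add: \<beta>_def \<gamma>_def field_simps power2_eq_square power3_eq_cube)

lemma beta_squared: "\<beta>\<^sup>2 = F * H"
proof -
  have "\<beta>\<^sup>2 = \<alpha> ^ 4 / (G * H)\<^sup>2"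
    by (simp add: \<beta>_def power_divide flip: power_mult)
  also have "\<dots> = F * H"
    using nonzero by (simp add: \<alpha>4 field_simps power2_eq_square power3_eq_cube)
  finally show ?thesis .
qed

lemma beta_gamma: "\<beta> * \<gamma> = F * \<alpha>"
proof -
  have "H * (\<beta> * \<gamma>) = \<alpha> * \<beta>\<^sup>2"
    using alpha_beta by (simp add: power2_eq_square mult_ac)
  also have "\<dots> = H * (F * \<alpha>)"
    by (simp add: beta_squared mult_ac)
  finally show ?thesis using nonzero by simp
qed

lemma alpha_gamma: "\<alpha> * \<gamma> = F * G * H"
proof -
  have "H * (\<alpha> * \<gamma>) = \<alpha>\<^sup>2 * \<beta>"
    using alpha_beta by (simp add: power2_eq_square mult_ac)
  also have "\<dots> = G * H * \<beta>\<^sup>2"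
    unfolding alpha_squared by (simp add: power2_eq_square mult_ac)
  also have "\<dots> = H * (F * G * H)"
    by (simp add: beta_squared mult_ac)
  finally show ?thesis using nonzero by simp
qed

lemma gamma_squared: "\<gamma>\<^sup>2 = F * G * \<beta>"
proof -
  have "H * \<gamma>\<^sup>2 = (\<alpha> * \<beta>) * \<gamma>"
    using alpha_beta by (simp add: power2_eq_square mult_ac)
  also have "\<dots> = (\<alpha> * \<gamma>) * \<beta>"
    by (simp add: mult_ac)
  also have "\<dots> = H * (F * G * \<beta>)"
    by (simp add: alpha_gamma mult_ac)
  finally show ?thesis using nonzero by simp
qed

lemma algebraic_int_generators [simp, intro]:
  "algebraic_int \<alpha>" "algebraic_int \<beta>" "algebraic_int \<gamma>"
proof -
  have "algebraic_int (\<alpha> ^ 4)"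
    unfolding \<alpha>4 by (rule algebraic_int_of_gauss)
  then show "algebraic_int \<alpha>"
    by (rule algebraic_int_powerD) simp
  show *: "algebraic_int \<beta>"
    by (rule algebraic_int_powerD[of _ 2]) (auto simp: beta_squared)
  show "algebraic_int \<gamma>"
    by (rule algebraic_int_powerD[of _ 2]) (use * in \<open>auto simp: gamma_squared\<close>)
qed

section \<open>Conjugates and traces over Q(i)\<close>

definition coord :: "complex \<Rightarrow> complex \<Rightarrow> complex \<Rightarrow> complex \<Rightarrow> complex \<Rightarrow> complex"
  where "coord a b c d z = a + b * z + c * z\<^sup>2 + d * z ^ 3"

text \<open>Elements of Q(i)[z] modulo z^4 - \<alpha>^4, seen as functions on the four roots. The
  point is the order of the quantifiers: one choice of coordinates has to serve all roots.\<close>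

definition representable :: "(complex \<Rightarrow> complex) \<Rightarrow> bool"
  where "representable P \<longleftrightarrow> (\<exists>a\<in>gauss_field. \<exists>b\<in>gauss_field. \<exists>c\<in>gauss_field. \<exists>d\<in>gauss_field.
    \<forall>z. z ^ 4 = \<alpha> ^ 4 \<longrightarrow> P z = coord a b c d z)"

lemma representable_const: "x \<in> gauss_field \<Longrightarrow> representable (\<lambda>_. x)"
  unfolding representable_def coord_def by (rule bexI[of _ x], rule bexI[of _ 0], rule bexI[of _ 0], rule bexI[of _ 0]) simp_all

lemma representable_add:
  assumes "representable P" "representable Q"
  shows "representable (\<lambda>z. P z + Q z)"
proof -
  obtain a b c d where P: "a \<in> gauss_field" "b \<in> gauss_field" "c \<in> gauss_field" "d \<in> gauss_field"
    "\<And>z. z ^ 4 = \<alpha> ^ 4 \<Longrightarrow> P z = coord a b c d z"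
    using assms(1) unfolding representable_def by blast
  obtain a' b' c' d' where Q: "a' \<in> gauss_field" "b' \<in> gauss_field" "c' \<in> gauss_field" "d' \<in> gauss_field"
    "\<And>z. z ^ 4 = \<alpha> ^ 4 \<Longrightarrow> Q z = coord a' b' c' d' z"
    using assms(2) unfolding representable_def by blast
  show ?thesis
    unfolding representable_def
    by (rule bexI[of _ "a + a'"], rule bexI[of _ "b + b'"], rule bexI[of _ "c + c'"], rule bexI[of _ "d + d'"])
      (use P Q in \<open>auto simp: coord_def algebra_simps\<close>)
qed

lemma representable_mult:
  assumes "representable P" "representable Q"
  shows "representable (\<lambda>z. P z * Q z)"
proof -
  obtain a b c d where P: "a \<in> gauss_field" "b \<in> gauss_field" "c \<in> gauss_field" "d \<in> gauss_field"
    "\<And>z. z ^ 4 = \<alpha> ^ 4 \<Longrightarrow> P z = coord a b c d z"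
    using assms(1) unfolding representable_def by blast
  obtain a' b' c' d' where Q: "a' \<in> gauss_field" "b' \<in> gauss_field" "c' \<in> gauss_field" "d' \<in> gauss_field"
    "\<And>z. z ^ 4 = \<alpha> ^ 4 \<Longrightarrow> Q z = coord a' b' c' d' z"
    using assms(2) unfolding representable_def by blast
  define M where "M = of_gauss (f * g\<^sup>2 * h ^ 3)"
  have M: "M \<in> gauss_field" by (simp only: M_def of_gauss_in_gauss_field)
  have "coord a b c d z * coord a' b' c' d' z =
      coord (a * a' + M * (b * d' + c * c' + d * b')) (a * b' + b * a' + M * (c * d' + d * c'))
        (a * c' + b * b' + c * a' + M * d * d') (a * d' + b * c' + c * b' + d * a') z"
    if "z ^ 4 = \<alpha> ^ 4" for z
  proof -
    have "z ^ 4 = M" using that by (simp only: \<alpha>4 M_def)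
    then show ?thesis
      unfolding coord_def \<open>z ^ 4 = M\<close>[symmetric]
      by (simp add: algebra_simps power2_eq_square power3_eq_cube power4_eq_xxxx)
  qed
  then show ?thesis
    unfolding representable_def
    by (intro bexI[of _ "a * a' + M * (b * d' + c * c' + d * b')"]
        bexI[of _ "a * b' + b * a' + M * (c * d' + d * c')"]
        bexI[of _ "a * c' + b * b' + c * a' + M * d * d'"]
        bexI[of _ "a * d' + b * c' + c * b' + d * a'"])
      (use P Q M in auto)
qed

lemma representable_poly:
  assumes "representable P"
  shows "representable (\<lambda>z. poly (map_poly of_int p) (P z))"
proof (induction p)
  case 0
  then show ?case using representable_const[of 0] by simp
next
  case (pCons a p)
  have "of_int a \<in> gauss_field"
    using of_gauss_in_gauss_field[of "GaussInt a 0"] by (simp add: of_gauss_eq)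
  moreover have "map_poly of_int (pCons a p) = pCons (of_int a) (map_poly of_int p :: complex poly)"
    by (simp add: Polynomial.map_poly_pCons)
  ultimately show ?case
    using representable_add[OF representable_const representable_mult[OF assms pCons.IH]] by simp
qed

text \<open>
  A polynomial expression over \<open>\<rat>(\<i>)\<close> vanishing at \<open>\<alpha>\<close> has zero coordinates modulo \<open>z\<^sup>4 = \<alpha>\<^sup>4\<close>,
  hence vanishes at all fourth roots of \<open>\<alpha>\<^sup>4\<close>; this replaces the Galois action.
\<close>

lemma algebraic_int_conjugate:
  assumes K: "a \<in> gauss_field" "b \<in> gauss_field" "c \<in> gauss_field" "d \<in> gauss_field"
    and int: "algebraic_int (coord a b c d \<alpha>)" and z: "z ^ 4 = \<alpha> ^ 4"
  shows "algebraic_int (coord a b c d z)"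
proof -
  obtain p where p: "poly (map_poly of_int p) (coord a b c d \<alpha>) = 0" "Polynomial.lead_coeff p = 1"
    using int by (auto simp: algebraic_int_altdef_ipoly)
  have "representable (coord a b c d)"
    using K unfolding representable_def by blast
  from representable_poly[OF this, of p] obtain a' b' c' d' where
    K': "a' \<in> gauss_field" "b' \<in> gauss_field" "c' \<in> gauss_field" "d' \<in> gauss_field" and
    eq: "\<And>z. z ^ 4 = \<alpha> ^ 4 \<Longrightarrow> poly (map_poly of_int p) (coord a b c d z) = coord a' b' c' d' z"
    unfolding representable_def by blast
  have "coord a' b' c' d' \<alpha> = 0"
    using eq[of \<alpha>] p(1) by simp
  then have "a' = 0 \<and> b' = 0 \<and> c' = 0 \<and> d' = 0"
    using gauss_adjoin_independent[OF degree K'] by (simp add: coord_def)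
  then have "poly (map_poly of_int p) (coord a b c d z) = 0"
    using eq[OF z] by (simp add: coord_def)
  then show ?thesis
    unfolding algebraic_int_altdef_ipoly using p(2) by blast
qed

text \<open>Summing the conjugates under \<alpha> -> i^k \<alpha> against the four characters of
  this cyclic group isolates the monomials; \<open>x0 + x2\<close> and \<open>x1 + x3\<close> are
  relative traces to Q(i)(\<alpha>^2).\<close>

lemma algebraic_int_coordinates:
  assumes K: "a \<in> gauss_field" "b \<in> gauss_field" "c \<in> gauss_field" "d \<in> gauss_field"
    and int: "algebraic_int (coord a b c d \<alpha>)"
  shows "algebraic_int (2 * (a + c * \<alpha>\<^sup>2))" "algebraic_int (2 * (a - c * \<alpha>\<^sup>2))"
    and "algebraic_int (4 * a)" "algebraic_int (4 * (b * \<alpha>))"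
    and "algebraic_int (4 * (c * \<alpha>\<^sup>2))" "algebraic_int (4 * (d * \<alpha> ^ 3))"
proof -
  have \<i>: "\<i>\<^sup>2 = -1" "\<i> ^ 3 = - \<i>" "\<i> ^ 4 = 1"
    by (simp_all add: power3_eq_cube power4_eq_xxxx)
  define x0 x1 x2 x3 where x: "x0 = coord a b c d \<alpha>" "x1 = coord a b c d (\<i> * \<alpha>)"
    "x2 = coord a b c d (- \<alpha>)" "x3 = coord a b c d (- \<i> * \<alpha>)"
  have x_int: "algebraic_int x0" "algebraic_int x1" "algebraic_int x2" "algebraic_int x3"
    unfolding x by (rule algebraic_int_conjugate[OF K int]; simp add: power_mult_distrib \<i>)+
  have "2 * (a + c * \<alpha>\<^sup>2) = x0 + x2" "2 * (a - c * \<alpha>\<^sup>2) = x1 + x3"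
    "4 * a = x0 + x1 + x2 + x3" "4 * (b * \<alpha>) = x0 - \<i> * x1 - x2 + \<i> * x3"
    "4 * (c * \<alpha>\<^sup>2) = x0 - x1 + x2 - x3" "4 * (d * \<alpha> ^ 3) = x0 + \<i> * x1 - x2 - \<i> * x3"
    by (simp_all add: x coord_def power_mult_distrib \<i> algebra_simps)
  then show "algebraic_int (2 * (a + c * \<alpha>\<^sup>2))" "algebraic_int (2 * (a - c * \<alpha>\<^sup>2))"
    "algebraic_int (4 * a)" "algebraic_int (4 * (b * \<alpha>))"
    "algebraic_int (4 * (c * \<alpha>\<^sup>2))" "algebraic_int (4 * (d * \<alpha> ^ 3))"
    by (simp_all only:) (intro algebraic_int_intros algebraic_int_ii x_int)+
qed

end

section \<open>Congruences modulo $1 + i$ in the ring of all algebraic integers\<close>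

definition pi_cong :: "complex \<Rightarrow> complex \<Rightarrow> bool"  (infix \<open>\<doteq>\<close> 50)
  where "x \<doteq> y \<longleftrightarrow> algebraic_int ((x - y) / (1 + \<i>))"

lemma pi_nonzero [simp]: "1 + \<i> \<noteq> 0"
  by (simp add: complex_eq_iff)

lemma pi_congI: "x = y + (1 + \<i>) * t \<Longrightarrow> algebraic_int t \<Longrightarrow> x \<doteq> y"
  by (simp add: pi_cong_def)

lemma pi_congE:
  assumes "x \<doteq> y"
  obtains t where "algebraic_int t" "x = y + (1 + \<i>) * t"
  using assms by (intro that[of "(x - y) / (1 + \<i>)"]) (simp_all add: pi_cong_def)

lemma pi_cong_refl [simp]: "x \<doteq> x"
  by (simp add: pi_cong_def)

lemma pi_cong_sym:
  assumes "x \<doteq> y"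
  shows "y \<doteq> x"
proof -
  have "(y - x) / (1 + \<i>) = - ((x - y) / (1 + \<i>))"
    by (metis minus_diff_eq minus_divide_left)
  then show ?thesis
    using assms by (simp add: pi_cong_def)
qed

lemma pi_cong_add:
  assumes "x \<doteq> y" "x' \<doteq> y'"
  shows "x + x' \<doteq> y + y'"
proof -
  have "(x + x' - (y + y')) / (1 + \<i>) = (x - y) / (1 + \<i>) + (x' - y') / (1 + \<i>)"
    by (simp only: add_diff_add add_divide_distrib)
  then show ?thesis
    using assms by (auto simp: pi_cong_def)
qed

lemma pi_cong_trans [trans]:
  assumes "x \<doteq> y" "y \<doteq> z"
  shows "x \<doteq> z"
proof -
  have "(x - z) / (1 + \<i>) = (x - y) / (1 + \<i>) + (y - z) / (1 + \<i>)"
    by (metis add_divide_distrib diff_add_cancel add_diff_eq)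
  then show ?thesis
    using assms by (auto simp: pi_cong_def)
qed

lemma pi_cong_mult_left:
  assumes "x \<doteq> y" "algebraic_int c"
  shows "c * x \<doteq> c * y"
proof -
  have "(c * x - c * y) / (1 + \<i>) = c * ((x - y) / (1 + \<i>))"
    by (metis right_diff_distrib times_divide_eq_right)
  then show ?thesis
    using assms algebraic_int_mult[of c "(x - y) / (1 + \<i>)"] by (simp only: pi_cong_def)
qed

lemma pi_cong_0_mult_left: "x \<doteq> 0 \<Longrightarrow> algebraic_int c \<Longrightarrow> c * x \<doteq> 0"
  using pi_cong_mult_left[of x 0 c] by simp

lemma pi_cong_add_0_left: "x \<doteq> 0 \<Longrightarrow> x + y \<doteq> z \<longleftrightarrow> y \<doteq> z"
  using pi_cong_add[of x 0 y y] by (metis add_0 pi_cong_refl pi_cong_sym pi_cong_trans)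

lemma algebraic_int_pi [simp, intro]: "algebraic_int (1 + \<i>)"
  by (intro algebraic_int_add) auto

lemma pi_cong_pi: "algebraic_int t \<Longrightarrow> (1 + \<i>) * t \<doteq> 0"
  by (rule pi_congI) auto

lemma pi_power_4: "(1 + \<i>) ^ 4 = - 4"
  by (simp add: power4_eq_xxxx algebra_simps)

lemma of_gauss_pi [simp]: "of_gauss (1 + gauss_i) = 1 + \<i>"
  by simp

text \<open>The quotient by 1 + i lies in Q(i), and an algebraic integer of Q(i) lies in Z[i]; hence
  passing to the large ring creates no new congruences between Gaussian integers.\<close>

lemma gauss_even_iff: "gauss_even p \<longleftrightarrow> of_gauss p \<doteq> 0"
proof
  assume "gauss_even p"
  then obtain k where "p = (1 + gauss_i) * k"
    unfolding gauss_even_def ..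
  then show "of_gauss p \<doteq> 0"
    by (intro pi_congI[of _ _ "of_gauss k"]) auto
next
  assume "of_gauss p \<doteq> 0"
  moreover have "of_gauss p / of_gauss (1 + gauss_i) \<in> gauss_field"
    by (intro gauss_field_closed of_gauss_in_gauss_field)
  ultimately obtain k where "of_gauss p / (1 + \<i>) = of_gauss k"
    unfolding pi_cong_def using gauss_field_algebraic_int by auto
  then have "of_gauss p = of_gauss ((1 + gauss_i) * k)"
    by (simp only: nonzero_divide_eq_eq[OF pi_nonzero]) (simp add: algebra_simps)
  then show "gauss_even p"
    unfolding gauss_even_def of_gauss_inject by simp
qed

lemma gauss_even_altdef: "gauss_even p \<longleftrightarrow> even (gRe p + gIm p)"
proof
  assume "gauss_even p"
  then obtain k where "p = (1 + gauss_i) * k"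
    unfolding gauss_even_def ..
  then show "even (gRe p + gIm p)"
    by (simp add: gauss_i_def)
next
  assume "even (gRe p + gIm p)"
  then obtain a where "gRe p + gIm p = 2 * a" ..
  then have "p = (1 + gauss_i) * GaussInt a (gIm p - a)"
    by (simp add: gauss_i_def gauss_int_eq_iff)
  then show "gauss_even p"
    unfolding gauss_even_def ..
qed

text \<open>The residue field is F_2. The witness \<open>k\<close> makes a parity available to
  polynomial identities later.\<close>

lemma gauss_odd_iff: "\<not> gauss_even p \<longleftrightarrow> (\<exists>k. p = 1 + (1 + gauss_i) * k)"
proof -
  have "\<not> gauss_even p \<longleftrightarrow> gauss_even (p - 1)"
    by (auto simp: gauss_even_altdef)
  also have "\<dots> \<longleftrightarrow> (\<exists>k. p = 1 + (1 + gauss_i) * k)"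
    by (auto simp: gauss_even_def dvd_def algebra_simps)
  finally show ?thesis .
qed

lemma gauss_odd_cong: "\<not> gauss_even p \<Longrightarrow> of_gauss p \<doteq> 1"
  by (auto simp: gauss_odd_iff intro: pi_congI)

lemma not_1_cong_0: "\<not> 1 \<doteq> 0"
  using gauss_even_iff[of 1] by (simp add: gauss_even_altdef)

lemma gauss_odd_mult_cong:
  assumes "\<not> gauss_even p" "algebraic_int x"
  shows "of_gauss p * x \<doteq> x"
  using pi_cong_mult_left[OF gauss_odd_cong[OF assms(1)] assms(2)] by (simp add: mult.commute)

lemma gauss_even_mult_cong:
  assumes "gauss_even p" "algebraic_int x"
  shows "of_gauss p * x \<doteq> 0"
  using pi_cong_0_mult_left[OF _ assms(2), of "of_gauss p"] assms(1)
  by (simp add: mult.commute gauss_even_iff)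

text \<open>Scalars act through F_2: an odd \<open>p\<close> would fix \<open>x\<close> modulo 1 +
  i.\<close>

lemma gauss_even_if_mult_cong_0:
  assumes "of_gauss p * x \<doteq> 0" "algebraic_int x" "\<not> x \<doteq> 0"
  shows "gauss_even p"
  using assms gauss_odd_mult_cong[of p x] pi_cong_sym pi_cong_trans by blast

lemma pi_cong_unit_cancel:
  assumes "x * \<mu> \<doteq> 0" "\<mu> * \<nu> \<doteq> 1" "algebraic_int x" "algebraic_int \<nu>"
  shows "x \<doteq> 0"
proof -
  have "x * 1 \<doteq> x * (\<mu> * \<nu>)"
    by (rule pi_cong_mult_left[OF pi_cong_sym[OF assms(2)] assms(3)])
  also have "x * (\<mu> * \<nu>) = \<nu> * (x * \<mu>)"
    by (simp add: mult_ac)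
  also have "\<dots> \<doteq> 0"
    by (rule pi_cong_0_mult_left[OF assms(1,4)])
  finally show ?thesis by simp
qed

lemma gauss_even_ring [simp]:
  "gauss_even (p + q) \<longleftrightarrow> (gauss_even p \<longleftrightarrow> gauss_even q)"
  "gauss_even (p - q) \<longleftrightarrow> (gauss_even p \<longleftrightarrow> gauss_even q)"
  "gauss_even (p * q) \<longleftrightarrow> gauss_even p \<or> gauss_even q"
  "gauss_even (p ^ n) \<longleftrightarrow> gauss_even p \<and> n > 0"
proof -
  show "gauss_even (p + q) \<longleftrightarrow> (gauss_even p \<longleftrightarrow> gauss_even q)"
    "gauss_even (p - q) \<longleftrightarrow> (gauss_even p \<longleftrightarrow> gauss_even q)"
    by (auto simp: gauss_even_altdef)
  show *: "gauss_even (p * q) \<longleftrightarrow> gauss_even p \<or> gauss_even q" for p q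
    by (auto simp: gauss_even_altdef)
  show "gauss_even (p ^ n) \<longleftrightarrow> gauss_even p \<and> n > 0"
    by (induction n) (auto simp: *, simp add: gauss_even_altdef)
qed

section \<open>Linear independence modulo $1 + i$\<close>

definition pi_independent :: "complex \<Rightarrow> complex \<Rightarrow> complex \<Rightarrow> complex \<Rightarrow> bool"
  where "pi_independent a b c d \<longleftrightarrow> (\<forall>p q r s.
    of_gauss p * a + of_gauss q * b + of_gauss r * c + of_gauss s * d \<doteq> 0 \<longrightarrow>
    gauss_even p \<and> gauss_even q \<and> gauss_even r \<and> gauss_even s)"

text \<open>A unitriangular change of basis over F_2. It transfers independence from a family
  adapted to the ramification to the generators that are wanted, which need to be known only modulo
  1 + i.\<close>

lemma pi_independent_triangular:
  assumes ind: "pi_independent a b c d"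
    and "a' \<doteq> a" "b' \<doteq> b + of_gauss k1 * a" "c' \<doteq> c + of_gauss k2 * a + of_gauss k3 * b"
    and "d' \<doteq> d + of_gauss k4 * a + of_gauss k5 * b + of_gauss k6 * c"
  shows "pi_independent a' b' c' d'"
  unfolding pi_independent_def
proof (intro allI impI)
  fix p q r s
  assume *: "of_gauss p * a' + of_gauss q * b' + of_gauss r * c' + of_gauss s * d' \<doteq> 0"
  have "of_gauss p * a' + of_gauss q * b' + of_gauss r * c' + of_gauss s * d' \<doteq>
    of_gauss p * a + of_gauss q * (b + of_gauss k1 * a) + of_gauss r * (c + of_gauss k2 * a + of_gauss k3 * b)
      + of_gauss s * (d + of_gauss k4 * a + of_gauss k5 * b + of_gauss k6 * c)"
    by (intro pi_cong_add pi_cong_mult_left assms) auto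
  also have "\<dots> = of_gauss (p + q * k1 + r * k2 + s * k4) * a + of_gauss (q + r * k3 + s * k5) * b
      + of_gauss (r + s * k6) * c + of_gauss s * d"
    by (simp add: algebra_simps)
  finally have "of_gauss (p + q * k1 + r * k2 + s * k4) * a + of_gauss (q + r * k3 + s * k5) * b
      + of_gauss (r + s * k6) * c + of_gauss s * d \<doteq> 0"
    using * pi_cong_sym pi_cong_trans by blast
  then have "gauss_even (p + q * k1 + r * k2 + s * k4) \<and> gauss_even (q + r * k3 + s * k5) \<and>
      gauss_even (r + s * k6) \<and> gauss_even s"
    using ind unfolding pi_independent_def by blast
  then show "gauss_even p \<and> gauss_even q \<and> gauss_even r \<and> gauss_even s"
    by auto
qed

lemma pi_independent_swap:
  assumes "pi_independent a b c d"
  shows "pi_independent a c b d"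
  unfolding pi_independent_def
  using assms[unfolded pi_independent_def, rule_format, of p r q s for p q r s]
  by (simp add: algebra_simps)

lemma pi_independent_reverse:
  assumes "pi_independent a b c d"
  shows "pi_independent a d c b"
  unfolding pi_independent_def
  using assms[unfolded pi_independent_def, rule_format, of p s r q for p q r s]
  by (simp add: algebra_simps)

text \<open>
  Total ramification: \<open>P\<close> behaves like a uniformizer with $P^2 \sim l$ and $l^2 \sim 1 + i$, so
  multiplication by \<open>P * l\<close>, \<open>l\<close> and \<open>P\<close> isolates the coefficients one after the other.
\<close>

lemma pi_independent_ramified:
  assumes int: "algebraic_int P" "algebraic_int l" "algebraic_int \<mu>" "algebraic_int \<nu>"
    and l: "l\<^sup>2 = (1 + \<i>) * \<mu>" and unit: "\<mu> * \<nu> \<doteq> 1" and P: "P\<^sup>2 \<doteq> l"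
  shows "pi_independent 1 P l (P * l)"
proof -
  have l2: "l * l \<doteq> 0"
    using pi_cong_pi[OF int(3)] l by (simp add: power2_eq_square)
  obtain t where t: "algebraic_int t" "P\<^sup>2 = l + (1 + \<i>) * t"
    using P by (rule pi_congE)
  \<comment> \<open>If 1 + i divided l, cancelling it once in l^2 would make \<mu> divisible by 1 +
    i, against its invertibility.\<close>
  have l0: "\<not> l \<doteq> 0"
  proof
    assume "l \<doteq> 0"
    then obtain s where s: "algebraic_int s" "l = (1 + \<i>) * s"
      by (auto elim: pi_congE)
    have "(1 + \<i>) * \<mu> = (1 + \<i>) * ((1 + \<i>) * s\<^sup>2)"
      using l s by (simp add: power2_eq_square mult_ac)
    then have "\<mu> = (1 + \<i>) * s\<^sup>2"
      by (simp only: mult_left_cancel[OF pi_nonzero])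
    then have "\<mu> \<doteq> 0"
      using s(1) by (simp add: pi_cong_pi algebraic_int_power)
    then have "1 \<doteq> 0"
      using pi_cong_unit_cancel[OF _ unit, of 1] int(4) by simp
    then show False
      using not_1_cong_0 by blast
  qed
  \<comment> \<open>Squaring and cancelling 1 + i turns divisibility of P l into that of P^2 \<mu>,
    hence of P^2, hence of l.\<close>
  have Pl: "\<not> P * l \<doteq> 0"
  proof
    assume "P * l \<doteq> 0"
    then obtain s where s: "algebraic_int s" "P * l = (1 + \<i>) * s"
      by (auto elim: pi_congE)
    have "(1 + \<i>) * (P\<^sup>2 * \<mu>) = (P * l)\<^sup>2"
      using l by (simp add: power_mult_distrib)
    also have "\<dots> = (1 + \<i>) * ((1 + \<i>) * s\<^sup>2)"
      unfolding s by (simp add: power2_eq_square)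
    finally have "P\<^sup>2 * \<mu> = (1 + \<i>) * s\<^sup>2"
      by (simp only: mult_left_cancel[OF pi_nonzero])
    then have "P\<^sup>2 * \<mu> \<doteq> 0"
      using s(1) by (simp add: pi_cong_pi algebraic_int_power)
    then have "P\<^sup>2 \<doteq> 0"
      by (rule pi_cong_unit_cancel[OF _ unit]) (use int in auto)
    then have "l \<doteq> 0"
      by (rule pi_cong_trans[OF pi_cong_sym[OF P]])
    then show False using l0 by blast
  qed
  have int_gauss: "algebraic_int (of_gauss p * x)" if "algebraic_int x" for p x
    using that by auto
  show ?thesis
    unfolding pi_independent_def
  proof (intro allI impI)
    fix p q r s
    assume *: "of_gauss p * 1 + of_gauss q * P + of_gauss r * l + of_gauss s * (P * l) \<doteq> 0"
    \<comment> \<open>After multiplication by P l every term but the first contains l^2 or P^2 l,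
      and both vanish modulo 1 + i.\<close>
    have "of_gauss p * (P * l) + (of_gauss q * l * P\<^sup>2 + (of_gauss r * P * (l * l) + of_gauss s * P\<^sup>2 * (l * l))) \<doteq> 0"
      using pi_cong_0_mult_left[OF *, of "P * l"] int by (auto simp: power2_eq_square algebra_simps)
    moreover have "of_gauss q * l * P\<^sup>2 \<doteq> of_gauss q * l * l"
      by (rule pi_cong_mult_left[OF P]) (use int in auto)
    then have "of_gauss q * l * P\<^sup>2 \<doteq> 0"
      using pi_cong_0_mult_left[OF l2, of "of_gauss q"] pi_cong_trans
      by (auto simp: mult.assoc)
    then have "of_gauss q * l * P\<^sup>2 + (of_gauss r * P * (l * l) + of_gauss s * P\<^sup>2 * (l * l)) \<doteq> 0 + (0 + 0)"
      by (intro pi_cong_add pi_cong_0_mult_left[OF l2]) (use int in auto)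
    ultimately have "of_gauss p * (P * l) \<doteq> 0"
      using pi_cong_add_0_left[of "of_gauss q * l * P\<^sup>2 + (of_gauss r * P * (l * l) + of_gauss s * P\<^sup>2 * (l * l))"]
      by (simp add: add.commute)
    then have p: "gauss_even p"
      by (rule gauss_even_if_mult_cong_0) (use int Pl in auto)
    then have "of_gauss p * 1 \<doteq> 0"
      by (simp add: gauss_even_iff)
    then have *: "of_gauss q * P + (of_gauss r * l + of_gauss s * (P * l)) \<doteq> 0"
      using * pi_cong_add_0_left[of "of_gauss p * 1"] by (simp add: add.assoc)
    have "(of_gauss r * (l * l) + of_gauss s * P * (l * l)) + of_gauss q * (P * l) \<doteq> 0"
      using pi_cong_0_mult_left[OF *, of l] int by (auto simp: algebra_simps)
    moreover have "of_gauss r * (l * l) + of_gauss s * P * (l * l) \<doteq> 0 + 0"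
      by (intro pi_cong_add pi_cong_0_mult_left[OF l2]) (use int in auto)
    ultimately have "of_gauss q * (P * l) \<doteq> 0"
      using pi_cong_add_0_left[of "of_gauss r * (l * l) + of_gauss s * P * (l * l)"] by simp
    then have q: "gauss_even q"
      by (rule gauss_even_if_mult_cong_0) (use int Pl in auto)
    then have *: "of_gauss r * l + of_gauss s * (P * l) \<doteq> 0"
      using * pi_cong_add_0_left[OF gauss_even_mult_cong[of q P]] int by simp
    have "of_gauss s * l * P\<^sup>2 + of_gauss r * (P * l) \<doteq> 0"
      using pi_cong_0_mult_left[OF *, of P] int by (auto simp: algebra_simps power2_eq_square)
    moreover have "of_gauss s * l * P\<^sup>2 \<doteq> of_gauss s * l * l"
      by (rule pi_cong_mult_left[OF P]) (use int in auto)
    then have "of_gauss s * l * P\<^sup>2 \<doteq> 0"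
      using pi_cong_0_mult_left[OF l2, of "of_gauss s"] pi_cong_trans
      by (auto simp: mult.assoc)
    ultimately have "of_gauss r * (P * l) \<doteq> 0"
      using pi_cong_add_0_left by blast
    then have r: "gauss_even r"
      by (rule gauss_even_if_mult_cong_0) (use int Pl in auto)
    then have "of_gauss s * (P * l) \<doteq> 0"
      using * pi_cong_add_0_left[OF gauss_even_mult_cong[of r l]] int by simp
    then have "gauss_even s"
      by (rule gauss_even_if_mult_cong_0) (use int Pl in auto)
    with p q r show "gauss_even p \<and> gauss_even q \<and> gauss_even r \<and> gauss_even s"
      by blast
  qed
qed

definition pi_independent_pair :: "complex \<Rightarrow> complex \<Rightarrow> bool"
  where "pi_independent_pair a b \<longleftrightarrow>
    (\<forall>p q. of_gauss p * a + of_gauss q * b \<doteq> 0 \<longrightarrow> gauss_even p \<and> gauss_even q)"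

text \<open>Frobenius in characteristic 2: the square is p^2 + q^2 w^2, congruent to (p^2 + q^2 c) +
  q^2 w. So there are no nilpotents in the span of 1 and \<open>w\<close> modulo 1 + i, as expected
  when X^2 - X - c is separable.\<close>

lemma pi_independent_pair_square:
  assumes ind: "pi_independent_pair 1 w" and int: "algebraic_int w"
    and w: "w\<^sup>2 \<doteq> w + of_gauss c"
    and sq: "(of_gauss p + of_gauss q * w)\<^sup>2 \<doteq> 0"
  shows "gauss_even p \<and> gauss_even q"
proof -
  have "of_gauss (p\<^sup>2 + q\<^sup>2 * c) * 1 + of_gauss (q\<^sup>2) * w =
      of_gauss (p\<^sup>2) + of_gauss (q\<^sup>2) * (w + of_gauss c)"
    by (simp add: algebra_simps)
  also have "\<dots> \<doteq> of_gauss (p\<^sup>2) + of_gauss (q\<^sup>2) * w\<^sup>2"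
    by (intro pi_cong_add pi_cong_mult_left pi_cong_sym[OF w]) auto
  also have "of_gauss (p\<^sup>2) + of_gauss (q\<^sup>2) * w\<^sup>2 = of_gauss (p\<^sup>2) + of_gauss (q\<^sup>2) * w\<^sup>2 + 0"
    by simp
  \<comment> \<open>The cross term 2 p q w is inserted with 2 = (1 + i)(1 - i) to complete the
    square.\<close>
  also have "\<dots> \<doteq> of_gauss (p\<^sup>2) + of_gauss (q\<^sup>2) * w\<^sup>2 + (1 + \<i>) * ((1 - \<i>) * of_gauss (p * q) * w)"
    by (intro pi_cong_add pi_cong_sym[OF pi_cong_pi] pi_cong_refl algebraic_int_mult)
      (use int in auto)
  also have "of_gauss (p\<^sup>2) + of_gauss (q\<^sup>2) * w\<^sup>2 + (1 + \<i>) * ((1 - \<i>) * of_gauss (p * q) * w)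
      = (of_gauss p + of_gauss q * w)\<^sup>2"
    by (simp add: algebra_simps power2_eq_square)
  also note sq
  finally have "of_gauss (p\<^sup>2 + q\<^sup>2 * c) * 1 + of_gauss (q\<^sup>2) * w \<doteq> 0"
    by simp
  then have "gauss_even (p\<^sup>2 + q\<^sup>2 * c) \<and> gauss_even (q\<^sup>2)"
    using ind unfolding pi_independent_pair_def by blast
  then show ?thesis by auto
qed

text \<open>
  Here $1 + i$ is unramified in the quadratic field generated by \<open>w\<close>, and \<open>x\<close> behaves like a root
  of an Eisenstein polynomial over that field.
\<close>

lemma pi_independent_unramified:
  assumes ind: "pi_independent_pair 1 w" and w: "w\<^sup>2 \<doteq> w + of_gauss c"
    and int: "algebraic_int w" "algebraic_int x" "algebraic_int \<mu>" "algebraic_int \<nu>"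
    and x: "x\<^sup>2 = (1 + \<i>) * \<mu>" and unit: "\<mu> * \<nu> \<doteq> 1"
  shows "pi_independent 1 w x (x * w)"
  unfolding pi_independent_def
proof (intro allI impI)
  fix p q r s
  define U V where "U = of_gauss p + of_gauss q * w" and "V = of_gauss r + of_gauss s * w"
  have UV_int [simp]: "algebraic_int U" "algebraic_int V"
    using int by (auto simp: U_def V_def)
  assume "of_gauss p * 1 + of_gauss q * w + of_gauss r * x + of_gauss s * (x * w) \<doteq> 0"
  then have *: "U + V * x \<doteq> 0"
    by (simp add: U_def V_def algebra_simps)
  \<comment> \<open>The difference U^2 - V^2 x^2 contains the given relation as a factor, and x^2 is
    divisible by 1 + i.\<close>
  have "U\<^sup>2 = (1 + \<i>) * (V\<^sup>2 * \<mu>) + (U - V * x) * (U + V * x)"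
    using x by (simp add: algebra_simps power2_eq_square)
  also have "\<dots> \<doteq> 0 + 0"
    by (intro pi_cong_add pi_cong_pi pi_cong_0_mult_left[OF *]) (use int in \<open>auto intro!: algebraic_int_intros\<close>)
  finally have "U\<^sup>2 \<doteq> 0" by simp
  then have pq: "gauss_even p \<and> gauss_even q"
    using pi_independent_pair_square[OF ind int(1) w] by (simp add: U_def)
  then have "U \<doteq> 0 + 0"
    unfolding U_def by (intro pi_cong_add gauss_even_mult_cong) (use int in \<open>auto simp: gauss_even_iff\<close>)
  then have "V * x \<doteq> 0"
    using * pi_cong_add_0_left by simp
  then obtain t where t: "algebraic_int t" "V * x = (1 + \<i>) * t"
    by (auto elim: pi_congE)
  \<comment> \<open>With V x divisible by 1 + i, its square has two such factors while x^2 accounts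
    for only one; the other must divide V^2 \<mu>.\<close>
  have "(1 + \<i>) * (V\<^sup>2 * \<mu>) = (V * x)\<^sup>2"
    using x by (simp add: power_mult_distrib)
  also have "\<dots> = (1 + \<i>) * ((1 + \<i>) * t\<^sup>2)"
    unfolding t by (simp add: power2_eq_square)
  finally have "V\<^sup>2 * \<mu> = (1 + \<i>) * t\<^sup>2"
    by (simp only: mult_left_cancel[OF pi_nonzero])
  then have "V\<^sup>2 * \<mu> \<doteq> 0"
    using t(1) by (simp add: pi_cong_pi algebraic_int_power)
  then have "V\<^sup>2 \<doteq> 0"
    by (rule pi_cong_unit_cancel[OF _ unit]) (use int in auto)
  then have "gauss_even r \<and> gauss_even s"
    using pi_independent_pair_square[OF ind int(1) w] by (simp add: V_def)
  with pq show "gauss_even p \<and> gauss_even q \<and> gauss_even r \<and> gauss_even s"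
    by blast
qed

section \<open>From residues modulo 1 + i back to Z[i], and odd denominators\<close>

lemma gauss_norm_pi_mult: "gauss_norm ((1 + gauss_i) * p) = 2 * gauss_norm p"
proof -
  have "real (gauss_norm ((1 + gauss_i) * p)) = real (2 * gauss_norm p)"
    unfolding gauss_norm_eq of_nat_mult by (simp add: norm_mult power_mult_distrib cmod_power2)
  then show ?thesis by linarith
qed

lemma gauss_norm_eq_0_iff: "gauss_norm p = 0 \<longleftrightarrow> p = 0"
proof -
  have "gauss_norm p = 0 \<longleftrightarrow> real (gauss_norm p) = 0"
    by simp
  then show ?thesis
    unfolding gauss_norm_eq by simp
qed

text \<open>Infinite descent: all coefficients of a relation are divisible by 1 + i, and dividing it
  out halves the sum of their norms.\<close>

lemma pi_independent_imp_independent: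
  assumes ind: "pi_independent a b c d"
    and "of_gauss p * a + of_gauss q * b + of_gauss r * c + of_gauss s * d = 0"
  shows "p = 0 \<and> q = 0 \<and> r = 0 \<and> s = 0"
  using assms(2)
proof (induction "gauss_norm p + gauss_norm q + gauss_norm r + gauss_norm s" arbitrary: p q r s
    rule: less_induct)
  case less
  have "of_gauss p * a + of_gauss q * b + of_gauss r * c + of_gauss s * d \<doteq> 0"
    unfolding less.prems by simp
  then have "gauss_even p \<and> gauss_even q \<and> gauss_even r \<and> gauss_even s"
    using ind unfolding pi_independent_def by blast
  then obtain p' q' r' s' where eq: "p = (1 + gauss_i) * p'" "q = (1 + gauss_i) * q'"
      "r = (1 + gauss_i) * r'" "s = (1 + gauss_i) * s'"
    unfolding gauss_even_def by (elim conjE dvdE)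
  have "(1 + \<i>) * (of_gauss p' * a + of_gauss q' * b + of_gauss r' * c + of_gauss s' * d) = 0"
    using less.prems unfolding eq of_gauss_hom(7) of_gauss_pi by (simp only: mult.assoc distrib_left)
  then have rel: "of_gauss p' * a + of_gauss q' * b + of_gauss r' * c + of_gauss s' * d = 0"
    by simp
  show ?case
  proof (cases "gauss_norm p + gauss_norm q + gauss_norm r + gauss_norm s = 0")
    case True
    then show ?thesis by (simp add: gauss_norm_eq_0_iff)
  next
    case False
    then have "p' = 0 \<and> q' = 0 \<and> r' = 0 \<and> s' = 0"
      by (intro less.hyps[OF _ rel]) (auto simp: eq gauss_norm_pi_mult)
    then show ?thesis by (simp add: eq)
  qed
qed

text \<open>Exactly one coordinate of an odd Gaussian integer is odd, so its norm is 1 modulo 4. In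
  other words, conjugation inverts odd elements modulo 4.\<close>

lemma gauss_odd_norm:
  assumes "\<not> gauss_even c"
  obtains k where "c * gauss_cnj c = 1 + 4 * k"
proof -
  have odd: "odd (gRe c + gIm c)"
    using assms by (simp add: gauss_even_altdef)
  have "\<exists>k. (gRe c)\<^sup>2 + (gIm c)\<^sup>2 = 1 + 4 * k"
  proof (cases "even (gRe c)")
    case True
    then obtain a b where "gRe c = 2 * a" "gIm c = 2 * b + 1"
      using odd by (auto elim!: evenE oddE)
    then show ?thesis
      by (intro exI[of _ "a\<^sup>2 + b\<^sup>2 + b"]) (simp add: power2_eq_square algebra_simps)
  next
    case False
    then obtain a b where "gRe c = 2 * a + 1" "gIm c = 2 * b"
      using odd by (auto elim!: evenE oddE)
    then show ?thesis
      by (intro exI[of _ "a\<^sup>2 + b\<^sup>2 + a"]) (simp add: power2_eq_square algebra_simps)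
  qed
  then obtain k where k: "(gRe c)\<^sup>2 + (gIm c)\<^sup>2 = 1 + 4 * k" ..
  have "of_gauss (c * gauss_cnj c) = of_gauss (1 + 4 * GaussInt k 0)"
  proof -
    have "of_gauss (c * gauss_cnj c) = of_int ((gRe c)\<^sup>2 + (gIm c)\<^sup>2)"
      by (simp add: of_gauss_def gauss_cnj_def complex_eq_iff power2_eq_square)
    also have "\<dots> = of_gauss (1 + 4 * GaussInt k 0)"
      unfolding k by (simp add: of_gauss_eq)
    finally show ?thesis .
  qed
  then show ?thesis
    using that unfolding of_gauss_inject by blast
qed

lemma cmod_of_gauss_squared: "complex_of_real ((cmod (of_gauss c))\<^sup>2) = of_gauss (c * gauss_cnj c)"
  by (simp only: complex_norm_square of_gauss_hom)

text \<open>
  The generators of the theorem carry the factors $|c|^2$ and $1/c$ with \<open>c\<close> odd. As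
  $|c|^2 \equiv 1 \pmod 4$, neither affects integrality or the class modulo $1 + i$ in an
  essential way.
\<close>

lemma odd_denominator:
  fixes x y z q q' :: complex
  assumes c: "\<not> gauss_even c"
    and int: "algebraic_int x" "algebraic_int z" "algebraic_int q'" "algebraic_int ((x + y) / q)"
    and y: "y = of_gauss c * z" and q: "q * q' = 4"
  defines "w \<equiv> (complex_of_real ((cmod (of_gauss c))\<^sup>2) * x + y) / (q * of_gauss c)"
  shows "algebraic_int w" and "\<exists>k. w \<doteq> (x + y) / q + of_gauss k * (q' * x)"
    and "z = q * w - of_gauss (gauss_cnj c) * x"
proof -
  obtain k where k: "c * gauss_cnj c = 1 + 4 * k"
    using gauss_odd_norm[OF c] .
  define C D where "C = of_gauss c" and "D = of_gauss (gauss_cnj c)"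
  have CD: "C * D = 1 + 4 * of_gauss k"
    unfolding C_def D_def of_gauss_hom(7)[symmetric] k by simp
  have nz: "C \<noteq> 0" "q \<noteq> 0"
    using c q by (auto simp: C_def gauss_even_def)
  have "w = (C * (D * x + z)) / (C * q)"
    unfolding w_def cmod_of_gauss_squared y by (simp add: C_def D_def algebra_simps)
  then have w': "w = (D * x + z) / q"
    using nz by simp
  show "z = q * w - of_gauss (gauss_cnj c) * x"
    using nz by (simp add: w' D_def)
  have "C * w = ((1 + 4 * of_gauss k) * x + C * z) / q"
    using nz unfolding w' CD[symmetric] by (simp add: field_simps)
  also have "\<dots> = (x + C * z) / q + of_gauss k * (q' * x)"
    using nz by (simp add: q[symmetric] field_simps)
  finally have Cw: "C * w = (x + y) / q + of_gauss k * (q' * x)"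
    by (simp add: y C_def)
  then have Cw_int: "algebraic_int (C * w)"
    using int by auto
  have "4 * w = q' * (D * x + z)"
    using nz by (simp add: w' q[symmetric] field_simps)
  then have w4_int: "algebraic_int (4 * w)"
    unfolding D_def by (simp only:) (intro algebraic_int_intros algebraic_int_of_gauss int)
  \<comment> \<open>Since C D - 4 k = 1, integrality of C w and of 4 w combines to integrality of
    w.\<close>
  have "w = (1 + 4 * of_gauss k) * w - of_gauss k * (4 * w)"
    by (simp add: algebra_simps)
  then have "w = D * (C * w) - of_gauss k * (4 * w)"
    unfolding CD[symmetric] by (simp add: mult_ac)
  then show w_int: "algebraic_int w"
    using Cw_int w4_int by (metis D_def algebraic_int_diff algebraic_int_mult algebraic_int_of_gauss)
  show "\<exists>k. w \<doteq> (x + y) / q + of_gauss k * (q' * x)"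
    unfolding Cw[symmetric] using gauss_odd_mult_cong[OF c w_int] Cw
    by (metis C_def pi_cong_sym)
qed

lemma pi_independent_ramified_unit:
  assumes "algebraic_int P" "algebraic_int l" "algebraic_int r"
    and l: "l\<^sup>2 = (1 + \<i>) * (1 + (1 + \<i>) * r)" and "P\<^sup>2 \<doteq> l"
  shows "pi_independent 1 P l (P * l)"
  by (rule pi_independent_ramified[OF _ _ _ _ l, of _ 1]) (use assms in \<open>auto intro: pi_congI\<close>)

text \<open>The unit 1 + l is its own inverse modulo 1 + i, because 2 l and l^2 both vanish
  there.\<close>

lemma pi_independent_ramified_unit':
  assumes int: "algebraic_int P" "algebraic_int l" "algebraic_int r"
    and l: "l\<^sup>2 = (1 + \<i>) * (1 + l + (1 + \<i>) * r)" and P: "P\<^sup>2 \<doteq> l"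
  shows "pi_independent 1 P l (P * l)"
proof (rule pi_independent_ramified[OF _ _ _ _ l _ P])
  have "(1 + l + (1 + \<i>) * r) * (1 + l) = 1 + 2 * l + l\<^sup>2 + (1 + \<i>) * (r * (1 + l))"
    by (simp add: algebra_simps power2_eq_square)
  also have "\<dots> = 1 + (1 + \<i>) * ((1 - \<i>) * l + (1 + l + (1 + \<i>) * r) + r * (1 + l))"
    unfolding l by (simp add: algebra_simps)
  finally show "(1 + l + (1 + \<i>) * r) * (1 + l) \<doteq> 1"
    by (rule pi_congI) (use int in \<open>auto intro!: algebraic_int_intros\<close>)
qed (use int in \<open>auto intro!: algebraic_int_intros\<close>)

section \<open>A criterion for integral bases of the quartic field\<close>

context pure_quartic
begin

lemma generators_in_field: "\<alpha> \<in> gauss_adjoin \<alpha>" "gauss_field \<subseteq> gauss_adjoin \<alpha>"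
  by (auto simp: gauss_adjoin_def intro: generate_field.incl)

lemmas field_closed = subfield_complex_ringD[OF field.generate_field_is_subfield[OF field_complex_ring,
    of "insert \<alpha> gauss_field", simplified, folded gauss_adjoin_def]]

lemma field_mem [simp]:
  "\<alpha> \<in> gauss_adjoin \<alpha>" "\<i> \<in> gauss_adjoin \<alpha>" "of_gauss c \<in> gauss_adjoin \<alpha>"
  "numeral n \<in> gauss_adjoin \<alpha>" "\<beta> \<in> gauss_adjoin \<alpha>" "\<gamma> \<in> gauss_adjoin \<alpha>"
  "complex_of_real ((cmod (of_gauss c))\<^sup>2) \<in> gauss_adjoin \<alpha>"
proof -
  show 1: "\<alpha> \<in> gauss_adjoin \<alpha>" and 2: "\<i> \<in> gauss_adjoin \<alpha>" and 3: "of_gauss c \<in> gauss_adjoin \<alpha>" for c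
    using generators_in_field ii_in_gauss_field by auto
  show "numeral n \<in> gauss_adjoin \<alpha>"
    using 3[of "numeral n"] by simp
  show "\<beta> \<in> gauss_adjoin \<alpha>" "\<gamma> \<in> gauss_adjoin \<alpha>"
    unfolding \<beta>_def \<gamma>_def by (intro field_closed 1 3)+
  show "complex_of_real ((cmod (of_gauss c))\<^sup>2) \<in> gauss_adjoin \<alpha>"
    unfolding cmod_of_gauss_squared by (rule 3)
qed

text \<open>A power of each monomial 4 b \<alpha>, 4 c \<alpha>^2, 4 d \<alpha>^3 lies in Q(i) and
  is a square, or a nested square, times square-free products of two of f, g, h. Peeling these
  products off bounds the denominator of each coordinate.\<close>

lemma algebraic_int_quarter:
  assumes "x \<in> gauss_adjoin \<alpha>" "algebraic_int x"
  obtains A B C D where "4 * x = of_gauss A + of_gauss B * \<alpha> + of_gauss C * \<beta> + of_gauss D * \<gamma>"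
proof -
  have "\<exists>a b c d. x = a + b * \<alpha> + c * \<alpha>\<^sup>2 + d * \<alpha> ^ 3 \<and>
      a \<in> gauss_field \<and> b \<in> gauss_field \<and> c \<in> gauss_field \<and> d \<in> gauss_field"
    using assms(1) unfolding gauss_adjoin_eq[OF degree] mem_Collect_eq .
  then obtain a b c d where x: "x = coord a b c d \<alpha>" and
    K: "a \<in> gauss_field" "b \<in> gauss_field" "c \<in> gauss_field" "d \<in> gauss_field"
    unfolding coord_def by blast
  note int = algebraic_int_coordinates[OF K assms(2)[unfolded x]]
  have 4: "4 \<in> gauss_field"
    using of_gauss_in_gauss_field[of 4] by simp
  have sf: "squarefree (f * h)" "squarefree (g * h)" "squarefree (f * g)"
    using gauss_squarefree_mult coprime squarefree by auto
  obtain A where A: "4 * a = of_gauss A"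
    using gauss_field_algebraic_int[of "4 * a"] int K 4 by auto
  obtain B where B: "4 * b = of_gauss B"
  proof -
    have "algebraic_int ((4 * (b * \<alpha>)) ^ 4)"
      by (rule algebraic_int_power[OF int(4)])
    \<comment> \<open>The splitting m = (gh)^2 fh lets square-freeness of fh and then of gh reach 4
      b in two steps.\<close>
    also have "(4 * (b * \<alpha>)) ^ 4 = ((4 * b)\<^sup>2 * of_gauss (g * h))\<^sup>2 * of_gauss (f * h)"
      unfolding power_mult_distrib \<alpha>4
      by (simp add: algebra_simps power2_eq_square power3_eq_cube power4_eq_xxxx)
    finally obtain e where "((4 * b)\<^sup>2 * of_gauss (g * h))\<^sup>2 * of_gauss (f * h) = of_gauss e"
      using gauss_field_algebraic_int K 4
      by (metis (no_types, lifting) gauss_field_closed(6,8) of_gauss_in_gauss_field)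
    then obtain e' where "(4 * b)\<^sup>2 * of_gauss (g * h) = of_gauss e'"
      using gauss_field_square_mult[OF _ sf(1)] K 4
      by (metis (no_types, lifting) gauss_field_closed(6,8) of_gauss_in_gauss_field)
    then show ?thesis
      using gauss_field_square_mult[OF _ sf(2)] K 4 that by (metis gauss_field_closed(6))
  qed
  obtain C where C: "4 * c * of_gauss (g * h) = of_gauss C"
  proof -
    have "algebraic_int ((4 * (c * \<alpha>\<^sup>2))\<^sup>2)"
      by (rule algebraic_int_power[OF int(5)])
    also have "(4 * (c * \<alpha>\<^sup>2))\<^sup>2 = (4 * c * of_gauss (g * h))\<^sup>2 * of_gauss (f * h)"
      unfolding alpha_squared by (simp add: power_mult_distrib beta_squared)
    finally obtain e where "(4 * c * of_gauss (g * h))\<^sup>2 * of_gauss (f * h) = of_gauss e"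
      using gauss_field_algebraic_int K 4
      by (metis (no_types, lifting) gauss_field_closed(6,8) of_gauss_in_gauss_field)
    then show ?thesis
      using gauss_field_square_mult[OF _ sf(1)] K 4 that
      by (metis gauss_field_closed(6) of_gauss_in_gauss_field)
  qed
  obtain D where D: "4 * d * of_gauss (g * h\<^sup>2) = of_gauss D"
  proof -
    define d' where "d' = 4 * d * of_gauss (g * h\<^sup>2)"
    have d': "d' \<in> gauss_field"
      unfolding d'_def by (intro gauss_field_closed K 4 of_gauss_in_gauss_field)
    have "algebraic_int ((4 * (d * \<alpha> ^ 3)) ^ 4)"
      by (rule algebraic_int_power[OF int(6)])
    also have "(4 * (d * \<alpha> ^ 3)) ^ 4 = ((d' * \<gamma>)\<^sup>2)\<^sup>2"
      unfolding alpha_cubed by (simp add: d'_def mult_ac flip: power_mult)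
    also have "\<dots> = (d'\<^sup>2 * of_gauss (f * g))\<^sup>2 * of_gauss (f * h)"
      by (simp add: power_mult_distrib gamma_squared beta_squared)
    finally obtain e where "(d'\<^sup>2 * of_gauss (f * g))\<^sup>2 * of_gauss (f * h) = of_gauss e"
      using gauss_field_algebraic_int d'
      by (metis (no_types, lifting) gauss_field_closed(6,8) of_gauss_in_gauss_field)
    then obtain e' where "d'\<^sup>2 * of_gauss (f * g) = of_gauss e'"
      using gauss_field_square_mult[OF _ sf(1)] d'
      by (metis (no_types, lifting) gauss_field_closed(6,8) of_gauss_in_gauss_field)
    then show ?thesis
      using gauss_field_square_mult[OF d' sf(3)] that unfolding d'_def by metis
  qed
  have "4 * x = 4 * a + (4 * b) * \<alpha> + (4 * c * of_gauss (g * h)) * \<beta> + (4 * d * of_gauss (g * h\<^sup>2)) * \<gamma>"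
    by (simp add: x coord_def alpha_squared alpha_cubed algebra_simps)
  then show ?thesis
    using that unfolding A B C D by blast
qed

lemma gauss_span_4:
  "x \<in> gauss.span {a, b, c, d} \<longleftrightarrow>
    (\<exists>p q r s. x = of_gauss p * a + of_gauss q * b + of_gauss r * c + of_gauss s * d)"
  by (simp add: gauss.span_insert gauss_scale_def algebra_simps)

lemma integral_basisI:
  assumes int: "algebraic_int a" "algebraic_int b" "algebraic_int c" "algebraic_int d"
    and mem: "a \<in> gauss_adjoin \<alpha>" "b \<in> gauss_adjoin \<alpha>" "c \<in> gauss_adjoin \<alpha>" "d \<in> gauss_adjoin \<alpha>"
    and gen: "1 \<in> gauss.span {a, b, c, d}" "\<alpha> \<in> gauss.span {a, b, c, d}"
      "\<beta> \<in> gauss.span {a, b, c, d}" "\<gamma> \<in> gauss.span {a, b, c, d}"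
    and ind: "pi_independent a b c d"
  shows "gauss_integral_basis {a, b, c, d} (gauss_adjoin \<alpha>)"
proof -
  note lin = pi_independent_imp_independent[OF ind]
  \<comment> \<open>The basis is a set, so the four coefficients correspond to a function on it only
    once its elements are known to be distinct.\<close>
  have "a \<noteq> b" "a \<noteq> c" "a \<noteq> d" "b \<noteq> c" "b \<noteq> d" "c \<noteq> d"
    using lin[of 1 "-1" 0 0] lin[of 1 0 "-1" 0] lin[of 1 0 0 "-1"] lin[of 0 1 "-1" 0]
      lin[of 0 1 0 "-1"] lin[of 0 0 1 "-1"] by auto
  then have "gauss.independent {a, b, c, d}"
    using lin by (auto simp: gauss.dependent_finite gauss_scale_def add.assoc)
  moreover have "gauss.span {a, b, c, d} = ring_of_integers (gauss_adjoin \<alpha>)"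
  proof (intro subset_antisym subsetI)
    fix x assume "x \<in> gauss.span {a, b, c, d}"
    then obtain p q r s where "x = of_gauss p * a + of_gauss q * b + of_gauss r * c + of_gauss s * d"
      unfolding gauss_span_4 by blast
    then show "x \<in> ring_of_integers (gauss_adjoin \<alpha>)"
      unfolding ring_of_integers_def using int mem
      by (auto intro!: field_closed algebraic_int_intros)
  next
    fix x assume "x \<in> ring_of_integers (gauss_adjoin \<alpha>)"
    then have x: "x \<in> gauss_adjoin \<alpha>" "algebraic_int x"
      by (auto simp: ring_of_integers_def)
    obtain A B C D where "4 * x = of_gauss A + of_gauss B * \<alpha> + of_gauss C * \<beta> + of_gauss D * \<gamma>"
      using algebraic_int_quarter[OF x] .
    also have "\<dots> = gauss_scale A 1 + gauss_scale B \<alpha> + gauss_scale C \<beta> + gauss_scale D \<gamma>"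
      by (simp add: gauss_scale_def)
    also have "\<dots> \<in> gauss.span {a, b, c, d}"
      using gen by (intro gauss.span_add gauss.span_scale)
    finally have "- (4 * x) \<in> gauss.span {a, b, c, d}"
      by (rule gauss.span_neg)
    moreover have descent: "y \<in> gauss.span {a, b, c, d}"
      if y: "algebraic_int y" "(1 + \<i>) * y \<in> gauss.span {a, b, c, d}" for y
    proof -
      obtain p q r s where eq: "(1 + \<i>) * y = of_gauss p * a + of_gauss q * b + of_gauss r * c + of_gauss s * d"
        using y(2) unfolding gauss_span_4 by blast
      have "(1 + \<i>) * y \<doteq> 0"
        by (rule pi_cong_pi[OF y(1)])
      then have "gauss_even p \<and> gauss_even q \<and> gauss_even r \<and> gauss_even s"
        using ind unfolding eq pi_independent_def by blast
      then obtain p' q' r' s' where "p = (1 + gauss_i) * p'" "q = (1 + gauss_i) * q'"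
          "r = (1 + gauss_i) * r'" "s = (1 + gauss_i) * s'"
        unfolding gauss_even_def by (elim conjE dvdE)
      then have "(1 + \<i>) * y = (1 + \<i>) *
          (of_gauss p' * a + of_gauss q' * b + of_gauss r' * c + of_gauss s' * d)"
        unfolding eq by (simp add: algebra_simps)
      then show ?thesis
        unfolding mult_left_cancel[OF pi_nonzero] gauss_span_4 by blast
    qed
    have "y \<in> gauss.span {a, b, c, d}"
      if "algebraic_int y" "(1 + \<i>) ^ n * y \<in> gauss.span {a, b, c, d}" for y n
      using that(2)
    proof (induction n)
      case (Suc n)
      have "(1 + \<i>) * ((1 + \<i>) ^ n * y) \<in> gauss.span {a, b, c, d}"
        using Suc.prems by (simp only: power_Suc mult.assoc)
      then have "(1 + \<i>) ^ n * y \<in> gauss.span {a, b, c, d}"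
        by (rule descent[rotated]) (intro algebraic_int_intros algebraic_int_pi that(1))
      then show ?case by (rule Suc.IH)
    qed simp
    \<comment> \<open>The exponent 4 comes from (1 + i)^4 = -4: four descents lead from 4 x to
      x.\<close>
    from this[of x 4] have "- (4 * x) \<in> gauss.span {a, b, c, d} \<Longrightarrow> x \<in> gauss.span {a, b, c, d}"
      using x(2) unfolding pi_power_4 by simp
    ultimately show "x \<in> gauss.span {a, b, c, d}" by blast
  qed
  ultimately show ?thesis
    by (simp add: gauss_integral_basis_def)
qed

text \<open>The conjugation \<alpha> -> i \<alpha> negates \<alpha>^2, so the trace of (p + q w)/(1
  + i) is (2 p + q d)/(1 + i). Its integrality makes q d even, hence q, and then p.\<close>

lemma pi_independent_pair_half:
  assumes d: "\<not> gauss_even d" and c: "c \<in> gauss_field"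
    and w: "w = (of_gauss d + c * \<alpha>\<^sup>2) / 2" "algebraic_int w"
  shows "pi_independent_pair 1 w"
  unfolding pi_independent_pair_def
proof (intro allI impI)
  fix p q assume *: "of_gauss p * 1 + of_gauss q * w \<doteq> 0"
  define a b where "a = (of_gauss p + of_gauss q * of_gauss d / 2) / (1 + \<i>)"
    and "b = of_gauss q * c / 2 / (1 + \<i>)"
  have two: "2 \<in> gauss_field"
    using of_gauss_in_gauss_field[of 2] by simp
  have K: "a \<in> gauss_field" "b \<in> gauss_field"
    unfolding a_def b_def
    by (intro gauss_field_closed c two ii_in_gauss_field of_gauss_in_gauss_field)+
  have "coord a 0 b 0 \<alpha> = (of_gauss p * 1 + of_gauss q * w) / (1 + \<i>)"
    by (simp add: coord_def a_def b_def w(1) add_divide_distrib distrib_left)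
  then have ab: "algebraic_int (coord a 0 b 0 \<alpha>)"
    using * by (simp add: pi_cong_def)
  then have "algebraic_int (coord a 0 b 0 (\<i> * \<alpha>))"
    by (rule algebraic_int_conjugate[rotated 4]) (use K in \<open>simp_all add: power_mult_distrib\<close>)
  with ab have "algebraic_int (coord a 0 b 0 \<alpha> + coord a 0 b 0 (\<i> * \<alpha>))"
    by (rule algebraic_int_add)
  also have "coord a 0 b 0 \<alpha> + coord a 0 b 0 (\<i> * \<alpha>) = 2 * a"
    by (simp add: coord_def power_mult_distrib)
  also have "\<dots> = (of_gauss (2 * p + q * d) - 0) / (1 + \<i>)"
    by (simp add: a_def distrib_left)
  finally have "of_gauss (2 * p + q * d) \<doteq> 0"
    by (simp only: pi_cong_def)
  then have "gauss_even (2 * p + q * d)"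
    by (simp only: gauss_even_iff)
  moreover have "gauss_even 2"
    unfolding gauss_even_def by (rule dvdI[of _ _ "1 - gauss_i"]) (simp add: gauss_int_eq_iff gauss_i_def)
  ultimately have q: "gauss_even q"
    using d by simp
  then have "of_gauss p \<doteq> 0"
    using * pi_cong_add_0_left[OF gauss_even_mult_cong[OF q w(2)]] by (simp add: add.commute)
  then show "gauss_even p \<and> gauss_even q"
    using q by (simp add: gauss_even_iff)
qed

end

section \<open>Odd radicands\<close>

lemma divide_pi: "x / (1 + \<i>) = x * (1 - \<i>) / 2"
proof -
  have "x * (1 - \<i>) / 2 * (1 + \<i>) = x"
    by (simp add: algebra_simps)
  then show ?thesis
    by (simp only: nonzero_divide_eq_eq[OF pi_nonzero])
qed

lemma mult_eq_assoc: "a * b = c \<Longrightarrow> a * (b * x) = c * (x :: complex)"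
  by (simp flip: mult.assoc)

lemma gauss_congE:
  assumes "[a = b] (gmod c)"
  obtains t where "a = b + c * t"
proof -
  from assms obtain t where "a - b = c * t"
    unfolding gauss_cong_def ..
  then show ?thesis
    using that[of t] by (simp add: algebra_simps)
qed

lemma gauss_even_i_numeral [simp]:
  "\<not> gauss_even gauss_i" "\<not> gauss_even 1" "gauss_even (numeral n) \<longleftrightarrow> even (numeral n :: int)"
  "gauss_even (- p) \<longleftrightarrow> gauss_even p"
  by (auto simp: gauss_even_altdef gauss_i_def)

context pure_quartic
begin

text \<open>Removes the factors |c|^2 and 1/c from the last two generators, so that integrality and
  independence need checking only for \<open_dummy>\<close>

lemma odd_integral_basis:
  fixes x1 x2 b w3 w4 q1 q2 :: complex
  assumes odd: "\<not> gauss_even g" "\<not> gauss_even h"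
    and b: "algebraic_int b" "b \<in> gauss_adjoin \<alpha>" "\<alpha> = of_gauss u * b + of_gauss v"
    and x1: "x1 = of_gauss s1 + of_gauss s2 * \<alpha>"
    and x2: "x2 = of_gauss t1 + of_gauss t2 * \<alpha> + of_gauss t3 * \<alpha>\<^sup>2"
    and q1: "q1 = of_gauss r1" "q1 * of_gauss r1' = 4" "gauss_even r1'"
    and q2: "q2 = of_gauss r2" "q2 * of_gauss r2' = 4" "gauss_even r2' \<or> x2 \<doteq> 1"
    and int: "algebraic_int ((x1 + \<alpha>\<^sup>2) / q1)" "algebraic_int ((x2 + \<alpha> ^ 3) / q2)"
    and ind: "pi_independent 1 b ((x1 + \<alpha>\<^sup>2) / q1) ((x2 + \<alpha> ^ 3) / q2)"
  shows "gauss_integral_basis {1, b,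
    (complex_of_real ((cmod (of_gauss (g * h)))\<^sup>2) * x1 + \<alpha>\<^sup>2) / (q1 * of_gauss (g * h)),
    (complex_of_real ((cmod (of_gauss (g * h\<^sup>2)))\<^sup>2) * x2 + \<alpha> ^ 3) / (q2 * of_gauss (g * h\<^sup>2))}
    (gauss_adjoin \<alpha>)" (is "gauss_integral_basis {1, b, ?w3, ?w4} _")
proof -
  have odd': "\<not> gauss_even (g * h)" "\<not> gauss_even (g * h\<^sup>2)"
    using odd by simp_all
  have x_int: "algebraic_int x1" "algebraic_int x2"
    unfolding x1 x2 by auto
  have sq: "\<alpha>\<^sup>2 = of_gauss (g * h) * \<beta>" and cube: "\<alpha> ^ 3 = of_gauss (g * h\<^sup>2) * \<gamma>"
    by (simp_all add: alpha_squared alpha_cubed)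
  note w3 = odd_denominator[OF odd'(1) x_int(1) algebraic_int_generators(2) algebraic_int_of_gauss
      int(1) sq q1(2)]
  note w4 = odd_denominator[OF odd'(2) x_int(2) algebraic_int_generators(3) algebraic_int_of_gauss
      int(2) cube q2(2)]
  let ?S = "gauss.span {1, b, ?w3, ?w4}"
  have S: "1 \<in> ?S" "b \<in> ?S" "?w3 \<in> ?S" "?w4 \<in> ?S"
    by (simp_all add: gauss.span_base)
  have scale: "of_gauss c * y \<in> ?S" if "y \<in> ?S" for c y
    using gauss.span_scale[OF that, of c] by (simp add: gauss_scale_def)
  have const: "of_gauss c \<in> ?S" for c
    using scale[OF S(1), of c] by simp
  have \<alpha>S: "\<alpha> \<in> ?S"
    by (subst b(3)) (intro gauss.span_add scale const S)
  have x1S: "x1 \<in> ?S"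
    using gauss.span_add[OF const scale[OF \<alpha>S], of s1 s2] by (simp only: x1)
  have \<beta>S: "\<beta> \<in> ?S"
    using gauss.span_diff[OF scale[OF S(3), of r1] scale[OF x1S]] unfolding q1(1)[symmetric] by (subst w3(3))
  have sqS: "\<alpha>\<^sup>2 \<in> ?S"
    using scale[OF \<beta>S, of "g * h"] by (simp only: sq[symmetric])
  have x2S: "x2 \<in> ?S"
    using gauss.span_add[OF gauss.span_add[OF const scale[OF \<alpha>S]] scale[OF sqS], of t1 t2 t3]
    by (simp only: x2)
  have \<gamma>S: "\<gamma> \<in> ?S"
    using gauss.span_diff[OF scale[OF S(4), of r2] scale[OF x2S]] unfolding q2(1)[symmetric] by (subst w4(3))
  have mem: "?w3 \<in> gauss_adjoin \<alpha>" "?w4 \<in> gauss_adjoin \<alpha>"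
    unfolding q1(1) q2(1) x1 x2 by (intro field_closed field_mem)+
  obtain k1 where "?w3 \<doteq> (x1 + \<alpha>\<^sup>2) / q1 + of_gauss k1 * (of_gauss r1' * x1)"
    using w3(2) by blast
  also have "\<dots> \<doteq> (x1 + \<alpha>\<^sup>2) / q1 + 0"
    by (intro pi_cong_add pi_cong_0_mult_left gauss_even_mult_cong q1(3) x_int) auto
  finally have c3: "?w3 \<doteq> (x1 + \<alpha>\<^sup>2) / q1 + of_gauss 0 * 1 + of_gauss 0 * b"
    by simp
  obtain j where j: "of_gauss r2' * x2 \<doteq> of_gauss j"
  proof (cases "gauss_even r2'")
    case True
    then show ?thesis
      using that[of 0] gauss_even_mult_cong[OF _ x_int(2)] by simp
  next
    case False
    then show ?thesis
      using that[of r2'] q2(3) pi_cong_mult_left[of x2 1 "of_gauss r2'"] by simp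
  qed
  obtain k2 where "?w4 \<doteq> (x2 + \<alpha> ^ 3) / q2 + of_gauss k2 * (of_gauss r2' * x2)"
    using w4(2) by blast
  also have "\<dots> \<doteq> (x2 + \<alpha> ^ 3) / q2 + of_gauss k2 * of_gauss j"
    by (intro pi_cong_add pi_cong_mult_left j) auto
  finally have c4: "?w4 \<doteq> (x2 + \<alpha> ^ 3) / q2 + of_gauss (k2 * j) * 1 + of_gauss 0 * b
      + of_gauss 0 * ((x1 + \<alpha>\<^sup>2) / q1)"
    by simp
  have "pi_independent 1 b ?w3 ?w4"
    by (rule pi_independent_triangular[OF ind pi_cong_refl _ c3 c4, of _ 0]) simp
  then show ?thesis
    by (intro integral_basisI) (use b(1,2) w3(1) w4(1) mem S(1) \<alpha>S \<beta>S \<gamma>S field_closed(2) in auto)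
qed

end

lemma two_mult_cong: "algebraic_int x \<Longrightarrow> 2 * x \<doteq> 0"
  by (rule pi_congI[of _ _ "(1 - \<i>) * x"]) (auto simp: algebra_simps intro!: algebraic_int_intros)

lemma one_minus_i_mult_cong: "algebraic_int x \<Longrightarrow> (1 - \<i>) * x \<doteq> 0"
  by (rule pi_congI[of _ _ "- \<i> * x"]) (auto simp: algebra_simps intro!: algebraic_int_intros)

context pure_quartic
begin

lemma theta_mem: "(1 + \<alpha>) / (1 + \<i>) \<in> gauss_adjoin \<alpha>"
  by (intro field_closed field_mem)

lemma odd_if_product_odd:
  assumes "\<not> gauss_even (f * g\<^sup>2 * h ^ 3)"
  shows "\<not> gauss_even f" "\<not> gauss_even g" "\<not> gauss_even h"
  using assms by auto

lemma integral_basis_3_plus_2i_mod_4: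
  assumes "[f * g\<^sup>2 * h ^ 3 = 3 + 2 * gauss_i] (gmod 4)"
  shows "gauss_integral_basis {1, \<alpha>,
    (complex_of_real ((cmod (of_gauss (g * h)))\<^sup>2) * 1 + \<alpha>\<^sup>2) / ((1 + \<i>) * of_gauss (g * h)),
    (complex_of_real ((cmod (of_gauss (g * h\<^sup>2)))\<^sup>2) * (1 + \<alpha> + \<alpha>\<^sup>2) + \<alpha> ^ 3) / (2 * of_gauss (g * h\<^sup>2))}
    (gauss_adjoin \<alpha>)"
proof -
  obtain t where m: "f * g\<^sup>2 * h ^ 3 = 3 + 2 * gauss_i + 4 * t"
    using assms by (rule gauss_congE)
  have odd: "\<not> gauss_even g" "\<not> gauss_even h"
    by (rule odd_if_product_odd; simp add: m)+
  define T where "T = of_gauss t"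
  have [simp]: "algebraic_int T" by (simp add: T_def)
  have a4: "\<alpha> * (\<alpha> * (\<alpha> * \<alpha>)) = 3 + 2 * \<i> + 4 * T"
    using \<alpha>4 unfolding m by (simp add: T_def power4_eq_xxxx mult.assoc)
  define l where "l = (1 + \<alpha>\<^sup>2) / (1 + \<i>)"
  define P where "P = (1 + \<alpha> + \<alpha>\<^sup>2 + \<alpha> ^ 3) / 2"
  note expand = l_def[unfolded divide_pi] P_def field_simps power2_eq_square power3_eq_cube
    a4 a4[THEN mult_eq_assoc]
  have l2: "l\<^sup>2 = (1 + \<i>) * (1 + l + (1 + \<i>) * (- 1 - l - T))"
    by (simp add: expand)
  have "l\<^sup>2 = - \<i> * (1 + \<i>) * l + - \<i> * (1 + \<i>) * (1 + (1 - \<i>) * T)"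
    by (simp add: expand)
  then have l_int: "algebraic_int l"
    by (rule algebraic_int_quadratic[rotated 2]) (auto intro!: algebraic_int_intros)
  define \<mu> where "\<mu> = - \<i> * (1 + (1 - \<i>) * T + l)"
  have P2: "P\<^sup>2 = l + (1 + \<i>) * (\<i> * l + \<i> * \<mu> + T * l + \<i> * \<alpha> * \<mu>)"
    by (simp add: \<mu>_def expand)
  have r_int: "algebraic_int (\<i> * l + \<i> * \<mu> + T * l + \<i> * \<alpha> * \<mu>)"
    using l_int by (auto simp: \<mu>_def intro!: algebraic_int_intros)
  have P_int: "algebraic_int P"
    by (rule algebraic_int_powerD[of _ 2])
      (unfold P2, use r_int l_int in \<open>auto intro!: algebraic_int_intros\<close>)
  have ind0: "pi_independent 1 P l (P * l)"
    by (rule pi_independent_ramified_unit'[OF P_int l_int _ l2 pi_congI[OF P2 r_int]])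
      (use l_int in \<open>auto intro!: algebraic_int_intros\<close>)
  have "\<alpha> = P * l + of_gauss (- 1) * 1 + of_gauss 0 * P + of_gauss 0 * l
      + (1 + \<i>) * (\<i> * P + \<i> * (1 + \<alpha>) * T)"
    by (simp add: expand)
  then have c1: "\<alpha> \<doteq> P * l + of_gauss (- 1) * 1 + of_gauss 0 * P + of_gauss 0 * l"
    by (rule pi_congI) (use P_int in \<open>auto intro!: algebraic_int_intros\<close>)
  have "pi_independent 1 P l \<alpha>"
    by (rule pi_independent_triangular[OF ind0 pi_cong_refl _ _ c1, of P 0 l 0 0]) simp_all
  then have ind: "pi_independent 1 \<alpha> l P"
    by (rule pi_independent_reverse)
  show ?thesis
    by (rule odd_integral_basis[where u = 1 and v = 0 and ?s1.0 = 1 and ?s2.0 = 0 and ?t1.0 = 1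
        and ?t2.0 = 1 and ?t3.0 = 1 and ?r1.0 = "1 + gauss_i" and ?r1'.0 = "2 * (1 - gauss_i)"
        and ?r2.0 = 2 and ?r2'.0 = 2, OF odd])
      (use ind l_int P_int in \<open>auto simp: l_def P_def algebra_simps\<close>)
qed

lemma integral_basis_1_plus_2i_mod_4:
  assumes "[f * g\<^sup>2 * h ^ 3 = 1 + 2 * gauss_i] (gmod 4)"
  shows "gauss_integral_basis {1, \<alpha>,
    (complex_of_real ((cmod (of_gauss (g * h)))\<^sup>2) * (1 + (1 + \<i>) * \<alpha>) + \<alpha>\<^sup>2) / (2 * of_gauss (g * h)),
    (complex_of_real ((cmod (of_gauss (g * h\<^sup>2)))\<^sup>2) * (\<alpha> + (1 + \<i>) * \<alpha>\<^sup>2) + \<alpha> ^ 3) / (2 * of_gauss (g * h\<^sup>2))}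
    (gauss_adjoin \<alpha>)"
proof -
  obtain t where m: "f * g\<^sup>2 * h ^ 3 = 1 + 2 * gauss_i + 4 * t"
    using assms by (rule gauss_congE)
  have odd: "\<not> gauss_even g" "\<not> gauss_even h"
    by (rule odd_if_product_odd; simp add: m)+
  define T where "T = of_gauss t"
  have [simp]: "algebraic_int T" by (simp add: T_def)
  have a4: "\<alpha> * (\<alpha> * (\<alpha> * \<alpha>)) = 1 + 2 * \<i> + 4 * T"
    using \<alpha>4 unfolding m by (simp add: T_def power4_eq_xxxx mult.assoc)
  have "gauss_even (t\<^sup>2 + t)"
    by simp
  then obtain e where e: "t\<^sup>2 + t = (1 + gauss_i) * e"
    unfolding gauss_even_def ..
  define E where "E = of_gauss e"
  have E: "T * T = (1 + \<i>) * E - T"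
    using arg_cong[OF e, of of_gauss] by (simp add: T_def E_def power2_eq_square eq_diff_eq)
  have [simp]: "algebraic_int E" by (simp add: E_def)
  define k where "k = (1 + \<alpha>\<^sup>2) / (1 + \<i>)"
  define l where "l = k + 1"
  define w where "w = (1 + (1 + \<i>) * \<alpha> + \<alpha>\<^sup>2) / 2"
  define P where "P = w + T"
  note expand = P_def l_def k_def[unfolded divide_pi] w_def field_simps power2_eq_square power3_eq_cube
    a4 a4[THEN mult_eq_assoc]
  have "k\<^sup>2 = - \<i> * (1 + \<i>) * k + (1 - 2 * \<i> * T)"
    by (simp add: expand)
  then have k_int: "algebraic_int k"
    by (rule algebraic_int_quadratic[rotated 2]) (auto intro!: algebraic_int_intros)
  have "w\<^sup>2 = T + \<i> * k * (1 + \<alpha>)"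
    by (simp add: expand)
  then have w_int: "algebraic_int w"
    by (intro algebraic_int_powerD[of w 2]) (use k_int in \<open>auto intro!: algebraic_int_intros\<close>)
  have int: "algebraic_int l" "algebraic_int P"
    using k_int w_int by (auto simp: l_def P_def)
  have l2: "l\<^sup>2 = (1 + \<i>) * (1 + l + (1 + \<i>) * (- \<i> * (1 - \<i> * T) - (1 + \<i>) * k - (1 - \<i>)))"
    by (simp add: expand)
  have "P\<^sup>2 = l + (1 + \<i>) * (E + \<i> * k - 1 - (1 - \<i>) * T - k + k * w + (1 - \<i>) * T * w)"
    by (simp add: expand E E[THEN mult_eq_assoc])
  then have P2: "P\<^sup>2 \<doteq> l"
    by (rule pi_congI) (use k_int w_int in \<open>auto intro!: algebraic_int_intros\<close>)
  have ind0: "pi_independent 1 P l (P * l)"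
    by (rule pi_independent_ramified_unit'[OF int(2,1) _ l2 P2])
      (use k_int in \<open>auto intro!: algebraic_int_intros\<close>)
  have "w = P + of_gauss (- t) * 1"
    by (simp add: P_def T_def)
  then have c1: "w \<doteq> P + of_gauss (- t) * 1"
    by simp
  have "\<alpha> = l + of_gauss (- 1) * 1 + of_gauss 0 * P + (1 + \<i>) * (- \<i> * w - (1 - \<i>) * k)"
    by (simp add: expand)
  then have c2: "\<alpha> \<doteq> l + of_gauss (- 1) * 1 + of_gauss 0 * P"
    by (rule pi_congI) (use k_int w_int in \<open>auto intro!: algebraic_int_intros\<close>)
  have "(\<alpha> + (1 + \<i>) * \<alpha>\<^sup>2 + \<alpha> ^ 3) / 2 =
      P * l + of_gauss t * 1 + of_gauss (- 1) * P + of_gauss (- t) * l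
      + (1 + \<i>) * ((- \<i> * w - (1 - \<i>) * k) * w)"
    by (simp add: expand flip: T_def)
  then have c3: "(\<alpha> + (1 + \<i>) * \<alpha>\<^sup>2 + \<alpha> ^ 3) / 2 \<doteq>
      P * l + of_gauss t * 1 + of_gauss (- 1) * P + of_gauss (- t) * l"
    by (rule pi_congI) (use k_int w_int in \<open>auto intro!: algebraic_int_intros\<close>)
  have ind: "pi_independent 1 \<alpha> w ((\<alpha> + (1 + \<i>) * \<alpha>\<^sup>2 + \<alpha> ^ 3) / 2)"
    by (rule pi_independent_swap, rule pi_independent_triangular[OF ind0 pi_cong_refl c1 c2 c3])
  have "(\<alpha> + (1 + \<i>) * \<alpha>\<^sup>2 + \<alpha> ^ 3) / 2 = \<alpha> * w"
    by (simp add: expand)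
  then have w4_int: "algebraic_int ((\<alpha> + (1 + \<i>) * \<alpha>\<^sup>2 + \<alpha> ^ 3) / 2)"
    using w_int by auto
  show ?thesis
    by (rule odd_integral_basis[where u = 1 and v = 0 and ?s1.0 = 1 and ?s2.0 = "1 + gauss_i" and ?t1.0 = 0
        and ?t2.0 = 1 and ?t3.0 = "1 + gauss_i" and ?r1.0 = 2 and ?r1'.0 = 2
        and ?r2.0 = 2 and ?r2'.0 = 2, OF odd])
      (use ind[unfolded w_def] w_int[unfolded w_def] w4_int in \<open>auto intro!: algebraic_int_intros\<close>)
qed

lemma integral_basis_3_mod_4:
  assumes "[f * g\<^sup>2 * h ^ 3 = 3] (gmod 4)"
  shows "gauss_integral_basis {1, \<alpha>,
    (complex_of_real ((cmod (of_gauss (g * h)))\<^sup>2) * \<i> + \<alpha>\<^sup>2) / (2 * of_gauss (g * h)),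
    (complex_of_real ((cmod (of_gauss (g * h\<^sup>2)))\<^sup>2) * (\<i> + \<i> * \<alpha> + \<alpha>\<^sup>2) + \<alpha> ^ 3) / (2 * of_gauss (g * h\<^sup>2))}
    (gauss_adjoin \<alpha>)"
proof -
  obtain t where m: "f * g\<^sup>2 * h ^ 3 = 3 + 4 * t"
    using assms by (rule gauss_congE)
  have odd: "\<not> gauss_even g" "\<not> gauss_even h"
    by (rule odd_if_product_odd; simp add: m)+
  define T where "T = of_gauss t"
  have [simp]: "algebraic_int T" by (simp add: T_def)
  have a4: "\<alpha> * (\<alpha> * (\<alpha> * \<alpha>)) = 3 + 4 * T"
    using \<alpha>4 unfolding m by (simp add: T_def power4_eq_xxxx mult.assoc)
  define w where "w = (\<i> + \<alpha>\<^sup>2) / 2"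
  define x where "x = 1 + \<alpha>"
  note expand = x_def w_def field_simps power2_eq_square power3_eq_cube a4 a4[THEN mult_eq_assoc]
  have "w\<^sup>2 = \<i> * w + (1 + T)"
    by (simp add: expand)
  then have w_int: "algebraic_int w"
    by (rule algebraic_int_quadratic[rotated 2]) auto
  have x_int: "algebraic_int x"
    by (auto simp: x_def)
  have "w\<^sup>2 = w + of_gauss (1 + t) + (1 + \<i>) * (\<i> * w)"
    by (simp add: expand flip: T_def)
  then have w2: "w\<^sup>2 \<doteq> w + of_gauss (1 + t)"
    by (rule pi_congI) (use w_int in auto)
  have x2: "x\<^sup>2 = (1 + \<i>) * (- \<i> + (1 - \<i>) * (w + \<alpha>))"
    by (simp add: expand)
  have "(- \<i> + (1 - \<i>) * (w + \<alpha>)) * \<i> = 1 + (1 + \<i>) * (w + \<alpha>)"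
    by (simp add: algebra_simps)
  then have unit: "(- \<i> + (1 - \<i>) * (w + \<alpha>)) * \<i> \<doteq> 1"
    by (rule pi_congI) (use w_int in auto)
  have "pi_independent_pair 1 w"
    by (rule pi_independent_pair_half[of gauss_i 1]) (use w_int in \<open>auto simp: w_def\<close>)
  then have "pi_independent 1 w x (x * w)"
    by (rule pi_independent_unramified[OF _ w2 w_int x_int _ _ x2 unit])
      (use w_int in \<open>auto intro!: algebraic_int_intros\<close>)
  moreover have "w = w + of_gauss 0 * 1" "\<alpha> = x + of_gauss (- 1) * 1 + of_gauss 0 * w"
    "(\<i> + \<i> * \<alpha> + \<alpha>\<^sup>2 + \<alpha> ^ 3) / 2 = x * w + of_gauss 0 * 1 + of_gauss 0 * w + of_gauss 0 * x"
    by (simp_all add: expand)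
  ultimately have "pi_independent 1 w \<alpha> ((\<i> + \<i> * \<alpha> + \<alpha>\<^sup>2 + \<alpha> ^ 3) / 2)"
    by (metis pi_independent_triangular pi_cong_refl)
  then have ind: "pi_independent 1 \<alpha> w ((\<i> + \<i> * \<alpha> + \<alpha>\<^sup>2 + \<alpha> ^ 3) / 2)"
    by (rule pi_independent_swap)
  have "(\<i> + \<i> * \<alpha> + \<alpha>\<^sup>2 + \<alpha> ^ 3) / 2 = x * w"
    by (simp add: expand)
  then have w4_int: "algebraic_int ((\<i> + \<i> * \<alpha> + \<alpha>\<^sup>2 + \<alpha> ^ 3) / 2)"
    using w_int x_int by auto
  show ?thesis
    by (rule odd_integral_basis[where u = 1 and v = 0 and ?s1.0 = gauss_i and ?s2.0 = 0 and ?t1.0 = gauss_i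
        and ?t2.0 = gauss_i and ?t3.0 = 1 and ?r1.0 = 2 and ?r1'.0 = 2
        and ?r2.0 = 2 and ?r2'.0 = 2, OF odd])
      (use ind[unfolded w_def] w_int[unfolded w_def] w4_int in \<open>auto intro!: algebraic_int_intros\<close>)
qed

lemma integral_basis_5_mod_8:
  assumes "[f * g\<^sup>2 * h ^ 3 = 5] (gmod 8) \<or> [f * g\<^sup>2 * h ^ 3 = 5 + 4 * gauss_i] (gmod 8)"
  shows "gauss_integral_basis {1, (1 + \<alpha>) / (1 + \<i>),
    (complex_of_real ((cmod (of_gauss (g * h)))\<^sup>2) * 1 + \<alpha>\<^sup>2) / (2 * of_gauss (g * h)),
    (complex_of_real ((cmod (of_gauss (g * h\<^sup>2)))\<^sup>2) * (1 + \<alpha> + \<alpha>\<^sup>2) + \<alpha> ^ 3) / (2 * (1 + \<i>) * of_gauss (g * h\<^sup>2))}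
    (gauss_adjoin \<alpha>)"
proof -
  obtain t e where e: "e = 0 \<or> e = 1" and m: "f * g\<^sup>2 * h ^ 3 = 1 + 4 * (1 + e * gauss_i + 2 * t)"
  proof (use assms in \<open>elim disjE\<close>)
    assume "[f * g\<^sup>2 * h ^ 3 = 5] (gmod 8)"
    then obtain t where t: "f * g\<^sup>2 * h ^ 3 = 5 + 8 * t"
      by (rule gauss_congE)
    show thesis
      by (rule that[of 0 t], simp, unfold t) (simp add: algebra_simps)
  next
    assume "[f * g\<^sup>2 * h ^ 3 = 5 + 4 * gauss_i] (gmod 8)"
    then obtain t where t: "f * g\<^sup>2 * h ^ 3 = 5 + 4 * gauss_i + 8 * t"
      by (rule gauss_congE)
    show thesis
      by (rule that[of 1 t], simp, unfold t) (simp add: algebra_simps)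
  qed
  have odd: "\<not> gauss_even g" "\<not> gauss_even h"
    by (rule odd_if_product_odd; simp add: m)+
  define T E where "T = of_gauss t" and "E = of_gauss e"
  have [simp]: "algebraic_int T" "algebraic_int E" by (simp_all add: T_def E_def)
  have EE: "E * E = E" using e by (auto simp: E_def)
  have a4: "\<alpha> * (\<alpha> * (\<alpha> * \<alpha>)) = 1 + 4 * (1 + E * \<i> + 2 * T)"
    using \<alpha>4 unfolding m by (simp add: T_def E_def power4_eq_xxxx mult.assoc)
  define \<theta> where "\<theta> = (1 + \<alpha>) / (1 + \<i>)"
  define w where "w = (1 + \<alpha>\<^sup>2) / 2"
  define x where "x = \<theta> + w + E"
  define c where "c = 1 + e * gauss_i + 2 * t"
  have c: "of_gauss c = 1 + E * \<i> + 2 * T"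
    by (simp add: c_def E_def T_def)
  note expand = x_def w_def \<theta>_def[unfolded divide_pi] field_simps power2_eq_square power3_eq_cube
    a4 a4[THEN mult_eq_assoc] EE EE[THEN mult_eq_assoc]
  have w2: "w\<^sup>2 = w + of_gauss c"
    unfolding c by (simp add: expand)
  then have w2_cong: "w\<^sup>2 \<doteq> w + of_gauss c"
    by simp
  have "w\<^sup>2 = 1 * w + of_gauss c"
    by (simp add: w2)
  then have w_int: "algebraic_int w"
    by (rule algebraic_int_quadratic[rotated 2]) auto
  have "\<theta>\<^sup>2 = - \<i> * (1 + \<i>) * \<theta> + (\<i> - \<i> * w)"
    by (simp add: expand)
  then have \<theta>_int: "algebraic_int \<theta>"
    by (rule algebraic_int_quadratic[rotated 2]) (use w_int in \<open>auto intro!: algebraic_int_intros\<close>)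
  have x_int: "algebraic_int x"
    using w_int \<theta>_int by (auto simp: x_def)
  define r where "r = - (\<theta> + w) - \<i> * (\<theta> * w + T + E * (\<theta> + w))"
  have r_int: "algebraic_int r"
    using w_int \<theta>_int by (auto simp: r_def intro!: algebraic_int_intros)
  have x2: "x\<^sup>2 = (1 + \<i>) * (1 + x + (1 + \<i>) * r)"
    by (simp add: r_def expand)
  have "(1 + x + (1 + \<i>) * r) * (1 + x) =
      1 + (1 + \<i>) * ((1 - \<i>) * x + (1 + x + (1 + \<i>) * r) + r * (1 + x))"
    using x2 by (simp add: algebra_simps power2_eq_square)
  then have unit: "(1 + x + (1 + \<i>) * r) * (1 + x) \<doteq> 1"
    by (rule pi_congI) (use x_int r_int in \<open>auto intro!: algebraic_int_intros\<close>)
  have "pi_independent_pair 1 w"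
    by (rule pi_independent_pair_half[of 1 1]) (use w_int in \<open>auto simp: w_def\<close>)
  then have "pi_independent 1 w x (x * w)"
    by (rule pi_independent_unramified[OF _ w2_cong w_int x_int _ _ x2 unit])
      (use x_int r_int in \<open>auto intro!: algebraic_int_intros\<close>)
  moreover have "w = w + of_gauss 0 * 1" "\<theta> = x + of_gauss (- e) * 1 + of_gauss (- 1) * w"
    by (simp_all add: x_def E_def)
  moreover have "\<theta> * w = x * w + of_gauss (- c) * 1 + of_gauss (- 1 - e) * w + of_gauss 0 * x"
    using w2 by (simp add: x_def E_def algebra_simps power2_eq_square)
  ultimately have "pi_independent 1 w \<theta> (\<theta> * w)"
    by (metis pi_independent_triangular pi_cong_refl)
  then have ind: "pi_independent 1 \<theta> w (\<theta> * w)"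
    by (rule pi_independent_swap)
  have w4: "(1 + \<alpha> + \<alpha>\<^sup>2 + \<alpha> ^ 3) / (2 * (1 + \<i>)) = \<theta> * w"
    by (simp add: \<theta>_def w_def field_simps power2_eq_square power3_eq_cube)
  have \<alpha>\<theta>: "\<alpha> = of_gauss (1 + gauss_i) * \<theta> + of_gauss (- 1)"
    by (simp add: \<theta>_def)
  show ?thesis
    unfolding \<theta>_def[symmetric]
    by (rule odd_integral_basis[OF odd \<theta>_int theta_mem[folded \<theta>_def] \<alpha>\<theta>,
        where ?s1.0 = 1 and ?s2.0 = 0 and ?t1.0 = 1
        and ?t2.0 = 1 and ?t3.0 = 1 and ?r1.0 = 2 and ?r1'.0 = 2
        and ?r2.0 = "2 * (1 + gauss_i)" and ?r2'.0 = "1 - gauss_i"], unfold w4 w_def[symmetric])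
      (use ind \<theta>_int w_int in \<open>auto simp: algebra_simps intro!: algebraic_int_intros\<close>)
qed

end

lemma divide_2_pi: "x / (2 * (1 + \<i>)) = x * (1 - \<i>) / 4"
  unfolding divide_divide_eq_left[symmetric] divide_pi by simp

lemma half_square:
  assumes "(2 * y)\<^sup>2 = 2 * a * (2 * y) + 4 * b"
  shows "y\<^sup>2 = a * y + (b :: complex)"
proof -
  have "4 * y\<^sup>2 = 4 * (a * y + b)"
    using assms by (simp add: power2_eq_square algebra_simps)
  then show ?thesis
    by (rule iffD1[OF mult_left_cancel, rotated]) simp
qed

context pure_quartic
begin

text \<open>
  Here $1 + i$ is unramified in $N$. The relative trace to $\mathbb{Q}(i)(\alpha^2)$ kills $1$ and
  \<open>\<theta>\<close> modulo $1 + i$ but not the other two basis elements.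
\<close>

lemma pi_independent_unramified_trace:
  assumes K: "a \<in> gauss_field" "b \<in> gauss_field" "c \<in> gauss_field" "d \<in> gauss_field"
      "a' \<in> gauss_field" "b' \<in> gauss_field" "c' \<in> gauss_field" "d' \<in> gauss_field"
    and y: "y = coord a b c d \<alpha>" "algebraic_int y" "2 * (a + c * \<alpha>\<^sup>2) \<doteq> 1"
    and z: "z = coord a' b' c' d' \<alpha>" "algebraic_int z" "2 * (a' + c' * \<alpha>\<^sup>2) \<doteq> w"
    and w: "pi_independent_pair 1 w" "algebraic_int w"
    and \<theta>: "\<theta> = (1 + \<alpha>) / (1 + \<i>)" "algebraic_int \<theta>" "\<theta>\<^sup>2 \<doteq> w + 1"
  shows "pi_independent 1 \<theta> y z"
  unfolding pi_independent_def
proof (intro allI impI)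
  fix p q r s
  assume *: "of_gauss p * 1 + of_gauss q * \<theta> + of_gauss r * y + of_gauss s * z \<doteq> 0"
  define \<pi> where "\<pi> = 1 + \<i>"
  have "2 / \<pi> = 2 * (1 - \<i>) / 2"
    unfolding \<pi>_def by (rule divide_pi)
  then have \<pi>: "\<pi> \<noteq> 0" "2 / \<pi> = 1 - \<i>" "\<pi> \<in> gauss_field"
    using ii_in_gauss_field by (auto simp: \<pi>_def)
  have \<theta>_eq: "\<theta> = (1 + \<alpha>) / \<pi>"
    by (simp add: \<theta>(1) \<pi>_def)
  define A where "A = (of_gauss p + of_gauss q / \<pi> + of_gauss r * a + of_gauss s * a') / \<pi>"
  define B where "B = (of_gauss q / \<pi> + of_gauss r * b + of_gauss s * b') / \<pi>"
  define C where "C = (of_gauss r * c + of_gauss s * c') / \<pi>"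
  define D where "D = (of_gauss r * d + of_gauss s * d') / \<pi>"
  have KK: "A \<in> gauss_field" "B \<in> gauss_field" "C \<in> gauss_field" "D \<in> gauss_field"
    unfolding A_def B_def C_def D_def
    by (intro gauss_field_closed K \<pi> of_gauss_in_gauss_field)+
  have "coord A B C D \<alpha> * \<pi> = of_gauss p * 1 + of_gauss q * \<theta> + of_gauss r * y + of_gauss s * z"
    using \<pi>(1) by (simp add: coord_def A_def B_def C_def D_def y(1) z(1) \<theta>_eq
        add_divide_distrib algebra_simps)
  then have "coord A B C D \<alpha> = (of_gauss p * 1 + of_gauss q * \<theta> + of_gauss r * y + of_gauss s * z - 0) / \<pi>"
    using \<pi>(1) by (simp add: eq_divide_eq)
  then have "algebraic_int (coord A B C D \<alpha>)"
    using * by (simp only: pi_cong_def \<pi>_def)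
  from algebraic_int_coordinates(1)[OF KK this]
  have "algebraic_int (2 * (A + C * \<alpha>\<^sup>2))" .
  also have "2 * (A + C * \<alpha>\<^sup>2) = (2 * of_gauss p + of_gauss q * (2 / \<pi>)
      + of_gauss r * (2 * (a + c * \<alpha>\<^sup>2)) + of_gauss s * (2 * (a' + c' * \<alpha>\<^sup>2)) - 0) / \<pi>"
    by (simp add: A_def C_def add_divide_distrib algebra_simps)
  finally have tr0: "2 * of_gauss p + of_gauss q * (2 / \<pi>)
      + of_gauss r * (2 * (a + c * \<alpha>\<^sup>2)) + of_gauss s * (2 * (a' + c' * \<alpha>\<^sup>2)) \<doteq> 0"
    by (simp only: pi_cong_def \<pi>_def)
  have tr1: "2 * of_gauss p + of_gauss q * (2 / \<pi>)
      + of_gauss r * (2 * (a + c * \<alpha>\<^sup>2)) + of_gauss s * (2 * (a' + c' * \<alpha>\<^sup>2)) \<doteq>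
      0 + of_gauss q * 0 + of_gauss r * 1 + of_gauss s * w"
  proof (intro pi_cong_add pi_cong_mult_left y(3) z(3) algebraic_int_of_gauss)
    show "2 * of_gauss p \<doteq> 0"
      by (rule two_mult_cong) simp
    show "2 / \<pi> \<doteq> 0"
      unfolding \<pi>(2) using one_minus_i_mult_cong[of 1] by simp
  qed
  from pi_cong_trans[OF pi_cong_sym[OF tr1] tr0] have "of_gauss r * 1 + of_gauss s * w \<doteq> 0"
    by simp
  then have rs: "gauss_even r" "gauss_even s"
    using w(1) unfolding pi_independent_pair_def by blast+
  have "of_gauss r * y + of_gauss s * z \<doteq> 0 + 0"
    by (intro pi_cong_add gauss_even_mult_cong rs y(2) z(2))
  moreover have "(of_gauss r * y + of_gauss s * z) + (of_gauss p + of_gauss q * \<theta>) \<doteq> 0"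
    using * by (simp add: add_ac)
  ultimately have **: "of_gauss p + of_gauss q * \<theta> \<doteq> 0"
    using pi_cong_add_0_left by simp
  have "of_gauss (p\<^sup>2 + q\<^sup>2) * 1 + of_gauss (q\<^sup>2) * w = of_gauss (p\<^sup>2) + of_gauss (q\<^sup>2) * (w + 1)"
    by (simp add: algebra_simps)
  also have "\<dots> \<doteq> of_gauss (p\<^sup>2) + of_gauss (q\<^sup>2) * \<theta>\<^sup>2"
    by (intro pi_cong_add pi_cong_mult_left pi_cong_refl pi_cong_sym[OF \<theta>(3)] algebraic_int_of_gauss)
  also have "\<dots> = (of_gauss p + of_gauss q * \<theta>) * (of_gauss p + of_gauss q * \<theta>) + 2 * (- of_gauss p * of_gauss q * \<theta>)"
    by (simp add: algebra_simps power2_eq_square)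
  also have "\<dots> \<doteq> 0 + 0"
    using \<theta>(2) by (intro pi_cong_add pi_cong_0_mult_left[OF **] two_mult_cong) (auto intro!: algebraic_int_intros)
  finally have "of_gauss (p\<^sup>2 + q\<^sup>2) * 1 + of_gauss (q\<^sup>2) * w \<doteq> 0"
    by simp
  then have "gauss_even (p\<^sup>2 + q\<^sup>2)" "gauss_even (q\<^sup>2)"
    using w(1) unfolding pi_independent_pair_def by blast+
  then show "gauss_even p \<and> gauss_even q \<and> gauss_even r \<and> gauss_even s"
    using rs by auto
qed

lemma gauss_field_numeral: "numeral n \<in> gauss_field"
  using of_gauss_in_gauss_field[of "numeral n"] by simp

lemma integral_basis_1_mod_8:
  assumes "[f * g\<^sup>2 * h ^ 3 = 1] (gmod 8)"
  shows "gauss_integral_basis {1, (1 + \<alpha>) / (1 + \<i>),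
    (complex_of_real ((cmod (of_gauss (g * h)))\<^sup>2) * (\<i> + (1 + \<i>) * \<alpha>) + \<alpha>\<^sup>2) / (2 * (1 + \<i>) * of_gauss (g * h)),
    (complex_of_real ((cmod (of_gauss (g * h\<^sup>2)))\<^sup>2) * (1 + \<alpha> + \<alpha>\<^sup>2) + \<alpha> ^ 3) / (4 * of_gauss (g * h\<^sup>2))}
    (gauss_adjoin \<alpha>)"
proof -
  obtain t where m: "f * g\<^sup>2 * h ^ 3 = 1 + 8 * t"
    using assms by (rule gauss_congE)
  have odd: "\<not> gauss_even g" "\<not> gauss_even h"
    by (rule odd_if_product_odd; simp add: m)+
  define T where "T = of_gauss t"
  have [simp]: "algebraic_int T" by (simp add: T_def)
  have a4: "\<alpha> * (\<alpha> * (\<alpha> * \<alpha>)) = 1 + 8 * T"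
    using \<alpha>4 unfolding m by (simp add: T_def power4_eq_xxxx mult.assoc)
  define \<theta> where "\<theta> = (1 + \<alpha>) / (1 + \<i>)"
  define w where "w = (1 + \<alpha>\<^sup>2) / 2"
  define y where "y = (\<i> + (1 + \<i>) * \<alpha> + \<alpha>\<^sup>2) / (2 * (1 + \<i>))"
  define z where "z = (1 + \<alpha> + \<alpha>\<^sup>2 + \<alpha> ^ 3) / 4"
  note expand = \<theta>_def[unfolded divide_pi] w_def y_def[unfolded divide_2_pi] z_def field_simps
    power2_eq_square power3_eq_cube a4 a4[THEN mult_eq_assoc]
  have w2: "w\<^sup>2 = 1 * w + 2 * T"
    by (simp add: expand)
  then have w_int: "algebraic_int w"
    by (rule algebraic_int_quadratic[rotated 2]) (auto intro!: algebraic_int_intros)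
  have \<theta>2: "\<theta>\<^sup>2 = - \<i> * (1 + \<i>) * \<theta> + (\<i> - \<i> * w)"
    by (simp add: expand)
  then have \<theta>_int: "algebraic_int \<theta>"
    by (rule algebraic_int_quadratic[rotated 2]) (use w_int in \<open>auto intro!: algebraic_int_intros\<close>)
  have "\<theta>\<^sup>2 = w + 1 + (1 + \<i>) * (- \<i> * \<theta> + \<i> - w)"
    by (simp add: expand)
  then have \<theta>2_cong: "\<theta>\<^sup>2 \<doteq> w + 1"
    by (rule pi_congI) (use w_int \<theta>_int in \<open>auto intro!: algebraic_int_intros\<close>)
  have mult: "w * w = w + 2 * T" "\<theta> * \<theta> = (1 - \<i>) * \<theta> + \<i> - \<i> * w"
    using w2 \<theta>2 by (simp_all add: power2_eq_square algebra_simps)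
  note ring = power2_eq_square algebra_simps mult mult[THEN mult_eq_assoc]
  have \<alpha>: "\<alpha> = (1 + \<i>) * \<theta> - 1" "\<alpha>\<^sup>2 = 2 * w - 1" "\<alpha> ^ 3 = ((1 + \<i>) * \<theta> - 1) * (2 * w - 1)"
    by (simp_all add: \<theta>_def w_def power3_eq_cube power2_eq_square)
  have "2 * y = (\<i> + (1 + \<i>) * \<alpha> + \<alpha>\<^sup>2) / (1 + \<i>)"
    unfolding y_def by (simp only: times_divide_eq_right mult_divide_mult_cancel_left_if) simp
  also have "\<dots> = (\<i> * \<theta> + w - 1) * (1 - \<i>)"
    unfolding nonzero_divide_eq_eq[OF pi_nonzero] \<alpha>(2) unfolding \<alpha>(1) by (simp add: algebra_simps)
  finally have y2: "2 * y = (\<i> * \<theta> + w - 1) * (1 - \<i>)" .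
  have "2 * (2 * z) = 1 + \<alpha> + \<alpha>\<^sup>2 + \<alpha> ^ 3"
    by (simp add: z_def)
  also have "\<dots> = 2 * ((1 + \<i>) * \<theta> * w)"
    unfolding \<alpha>(2,3) unfolding \<alpha>(1) by (simp add: algebra_simps)
  finally have z2: "2 * z = (1 + \<i>) * \<theta> * w"
    by simp
  note 2 = y2 z2
  have "(2 * y)\<^sup>2 = 2 * \<i> * (2 * y) + 4 * (\<theta> * w - \<i> * T)"
    unfolding 2 by (simp add: ring)
  then have "y\<^sup>2 = \<i> * y + (\<theta> * w - \<i> * T)"
    by (rule half_square)
  then have y_int: "algebraic_int y"
    by (rule algebraic_int_quadratic[rotated 2]) (use w_int \<theta>_int in \<open>auto intro!: algebraic_int_intros\<close>)
  have "(2 * z)\<^sup>2 = 2 * 1 * (2 * z) + 4 * (T * w + (1 + \<i>) * T * \<theta>)"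
    unfolding 2 by (simp add: ring)
  then have "z\<^sup>2 = 1 * z + (T * w + (1 + \<i>) * T * \<theta>)"
    by (rule half_square)
  then have z_int: "algebraic_int z"
    by (rule algebraic_int_quadratic[rotated 2]) (use w_int \<theta>_int in \<open>auto intro!: algebraic_int_intros\<close>)
  have pair: "pi_independent_pair 1 w"
    by (rule pi_independent_pair_half[of 1 1]) (use w_int in \<open>auto simp: w_def\<close>)
  have y_coord: "y = coord (\<i> / (2 * (1 + \<i>))) (1 / 2) (1 / (2 * (1 + \<i>))) 0 \<alpha>"
    unfolding y_def coord_def divide_2_pi by (simp add: field_simps)
  have y_trace: "2 * (\<i> / (2 * (1 + \<i>)) + 1 / (2 * (1 + \<i>)) * \<alpha>\<^sup>2) = 1 + (1 + \<i>) * (\<i> - \<i> * w)"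
    unfolding divide_2_pi by (simp add: expand)
  have z_coord: "z = coord (1 / 4) (1 / 4) (1 / 4) (1 / 4) \<alpha>"
    by (simp add: z_def coord_def add_divide_distrib)
  have z_trace: "2 * (1 / 4 + 1 / 4 * \<alpha>\<^sup>2) = w"
    by (simp add: w_def)
  have ind: "pi_independent 1 \<theta> y z"
    by (rule pi_independent_unramified_trace[OF _ _ _ _ _ _ _ _ y_coord y_int pi_congI[OF y_trace] z_coord z_int
          _ pair w_int \<theta>_def \<theta>_int \<theta>2_cong], unfold z_trace)
      (auto intro!: gauss_field_closed gauss_field_numeral ii_in_gauss_field algebraic_int_intros w_int)
  have "1 + \<alpha> + \<alpha>\<^sup>2 = 1 + (1 + \<i>) * (\<theta> + (1 - \<i>) * w - (1 - \<i>))"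
    by (simp add: expand)
  then have x2: "1 + \<alpha> + \<alpha>\<^sup>2 \<doteq> 1"
    by (rule pi_congI) (use w_int \<theta>_int in \<open>auto intro!: algebraic_int_intros\<close>)
  have \<alpha>\<theta>: "\<alpha> = of_gauss (1 + gauss_i) * \<theta> + of_gauss (- 1)"
    by (simp add: \<theta>_def)
  show ?thesis
    unfolding \<theta>_def[symmetric]
    by (rule odd_integral_basis[OF odd \<theta>_int theta_mem[folded \<theta>_def] \<alpha>\<theta>,
        where ?s1.0 = gauss_i and ?s2.0 = "1 + gauss_i" and ?t1.0 = 1
        and ?t2.0 = 1 and ?t3.0 = 1 and ?r1.0 = "2 * (1 + gauss_i)" and ?r1'.0 = "1 - gauss_i"
        and ?r2.0 = 4 and ?r2'.0 = 1], unfold y_def[symmetric] z_def[symmetric])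
      (use ind y_int z_int x2 in \<open>simp_all add: algebra_simps\<close>)
qed

lemma integral_basis_1_plus_4i_mod_8:
  assumes "[f * g\<^sup>2 * h ^ 3 = 1 + 4 * gauss_i] (gmod 8)"
  shows "gauss_integral_basis {1, (1 + \<alpha>) / (1 + \<i>),
    (complex_of_real ((cmod (of_gauss (g * h)))\<^sup>2) * (- \<i> + (1 + \<i>) * \<alpha>) + \<alpha>\<^sup>2) / (2 * (1 + \<i>) * of_gauss (g * h)),
    (complex_of_real ((cmod (of_gauss (g * h\<^sup>2)))\<^sup>2) * (2 - \<i> + \<alpha> + \<i> * \<alpha>\<^sup>2) + \<alpha> ^ 3) / (4 * of_gauss (g * h\<^sup>2))}
    (gauss_adjoin \<alpha>)"
proof -
  obtain t where m: "f * g\<^sup>2 * h ^ 3 = 1 + 4 * gauss_i + 8 * t"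
    using assms by (rule gauss_congE)
  have odd: "\<not> gauss_even g" "\<not> gauss_even h"
    by (rule odd_if_product_odd; simp add: m)+
  define T where "T = of_gauss t"
  have [simp]: "algebraic_int T" by (simp add: T_def)
  have a4: "\<alpha> * (\<alpha> * (\<alpha> * \<alpha>)) = 1 + 4 * \<i> + 8 * T"
    using \<alpha>4 unfolding m by (simp add: T_def power4_eq_xxxx mult.assoc)
  define \<theta> where "\<theta> = (1 + \<alpha>) / (1 + \<i>)"
  define w where "w = (1 + \<alpha>\<^sup>2) / 2"
  define y where "y = (- \<i> + (1 + \<i>) * \<alpha> + \<alpha>\<^sup>2) / (2 * (1 + \<i>))"
  define z where "z = (2 - \<i> + \<alpha> + \<i> * \<alpha>\<^sup>2 + \<alpha> ^ 3) / 4"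
  note expand = \<theta>_def[unfolded divide_pi] w_def y_def[unfolded divide_2_pi] z_def field_simps
    power2_eq_square power3_eq_cube a4 a4[THEN mult_eq_assoc]
  have w2: "w\<^sup>2 = 1 * w + (\<i> + 2 * T)"
    by (simp add: expand)
  then have w_int: "algebraic_int w"
    by (rule algebraic_int_quadratic[rotated 2]) (auto intro!: algebraic_int_intros)
  have \<theta>2: "\<theta>\<^sup>2 = - \<i> * (1 + \<i>) * \<theta> + (\<i> - \<i> * w)"
    by (simp add: expand)
  then have \<theta>_int: "algebraic_int \<theta>"
    by (rule algebraic_int_quadratic[rotated 2]) (use w_int in \<open>auto intro!: algebraic_int_intros\<close>)
  have "\<theta>\<^sup>2 = w + 1 + (1 + \<i>) * (- \<i> * \<theta> + \<i> - w)"
    by (simp add: expand)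
  then have \<theta>2_cong: "\<theta>\<^sup>2 \<doteq> w + 1"
    by (rule pi_congI) (use w_int \<theta>_int in \<open>auto intro!: algebraic_int_intros\<close>)
  have mult: "w * w = w + \<i> + 2 * T" "\<theta> * \<theta> = (1 - \<i>) * \<theta> + \<i> - \<i> * w"
    using w2 \<theta>2 by (simp_all add: power2_eq_square algebra_simps)
  note ring = power2_eq_square algebra_simps mult mult[THEN mult_eq_assoc]
  have \<alpha>: "\<alpha> = (1 + \<i>) * \<theta> - 1" "\<alpha>\<^sup>2 = 2 * w - 1" "\<alpha> ^ 3 = ((1 + \<i>) * \<theta> - 1) * (2 * w - 1)"
    by (simp_all add: \<theta>_def w_def power3_eq_cube power2_eq_square)
  have "2 * y = (- \<i> + (1 + \<i>) * \<alpha> + \<alpha>\<^sup>2) / (1 + \<i>)"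
    unfolding y_def by (simp only: times_divide_eq_right mult_divide_mult_cancel_left_if) simp
  also have "\<dots> = (\<i> * \<theta> + w - 1 - \<i>) * (1 - \<i>)"
    unfolding nonzero_divide_eq_eq[OF pi_nonzero] \<alpha>(2) unfolding \<alpha>(1) by (simp add: algebra_simps)
  finally have y2: "2 * y = (\<i> * \<theta> + w - 1 - \<i>) * (1 - \<i>)" .
  have "2 * (2 * z) = 2 - \<i> + \<alpha> + \<i> * \<alpha>\<^sup>2 + \<alpha> ^ 3"
    by (simp add: z_def)
  also have "\<dots> = 2 * ((1 + \<i>) * (\<theta> * w + \<i> * w - \<i>))"
    unfolding \<alpha>(2,3) unfolding \<alpha>(1) by (simp add: algebra_simps)
  finally have z2: "2 * z = (1 + \<i>) * (\<theta> * w + \<i> * w - \<i>)"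
    by simp
  note 2 = y2 z2
  have "(2 * y)\<^sup>2 = 2 * - 1 * (2 * y) + 4 * (\<theta> * w - \<i> * T)"
    unfolding 2 by (simp add: ring)
  then have "y\<^sup>2 = - 1 * y + (\<theta> * w - \<i> * T)"
    by (rule half_square)
  then have y_int: "algebraic_int y"
    by (rule algebraic_int_quadratic[rotated 2]) (use w_int \<theta>_int in \<open>auto intro!: algebraic_int_intros\<close>)
  have "(2 * z)\<^sup>2 = 2 * (2 * z) - 2 * (2 * y) + 4 * (w - 1 - \<i> * T + T * (\<i> - 1) * \<theta> + T * w)"
    unfolding 2 by (simp add: ring)
  also have "\<dots> = 2 * 1 * (2 * z) + 4 * (- y + w - 1 - \<i> * T + T * (\<i> - 1) * \<theta> + T * w)"
    by (simp add: algebra_simps)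
  finally have "z\<^sup>2 = 1 * z + (- y + w - 1 - \<i> * T + T * (\<i> - 1) * \<theta> + T * w)"
    by (rule half_square)
  then have z_int: "algebraic_int z"
    by (rule algebraic_int_quadratic[rotated 2]) (use w_int \<theta>_int y_int in \<open>auto intro!: algebraic_int_intros\<close>)
  have pair: "pi_independent_pair 1 w"
    by (rule pi_independent_pair_half[of 1 1]) (use w_int in \<open>auto simp: w_def\<close>)
  have y_coord: "y = coord (- \<i> / (2 * (1 + \<i>))) (1 / 2) (1 / (2 * (1 + \<i>))) 0 \<alpha>"
    unfolding y_def coord_def divide_2_pi by (simp add: field_simps)
  have y_trace: "2 * (- \<i> / (2 * (1 + \<i>)) + 1 / (2 * (1 + \<i>)) * \<alpha>\<^sup>2) = 1 + (1 + \<i>) * (- (1 - \<i>) - \<i> * w)"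
    unfolding divide_2_pi by (simp add: expand)
  have z_coord: "z = coord ((2 - \<i>) / 4) (1 / 4) (\<i> / 4) (1 / 4) \<alpha>"
    by (simp add: z_def coord_def add_divide_distrib)
  have z_trace: "2 * ((2 - \<i>) / 4 + \<i> / 4 * \<alpha>\<^sup>2) = w + (1 + \<i>) * (\<i> * w - \<i>)"
    by (simp add: expand)
  have ind: "pi_independent 1 \<theta> y z"
    by (rule pi_independent_unramified_trace[OF _ _ _ _ _ _ _ _ y_coord y_int pi_congI[OF y_trace] z_coord z_int
          pi_congI[OF z_trace] pair w_int \<theta>_def \<theta>_int \<theta>2_cong])
      (auto intro!: gauss_field_closed gauss_field_numeral ii_in_gauss_field algebraic_int_intros w_int)
  have "2 - \<i> + \<alpha> + \<i> * \<alpha>\<^sup>2 = 1 + (1 + \<i>) * (\<theta> + (1 + \<i>) * w - (1 + \<i>))"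
    by (simp add: expand)
  then have x2: "2 - \<i> + \<alpha> + \<i> * \<alpha>\<^sup>2 \<doteq> 1"
    by (rule pi_congI) (use w_int \<theta>_int in \<open>auto intro!: algebraic_int_intros\<close>)
  have \<alpha>\<theta>: "\<alpha> = of_gauss (1 + gauss_i) * \<theta> + of_gauss (- 1)"
    by (simp add: \<theta>_def)
  show ?thesis
    unfolding \<theta>_def[symmetric]
    by (rule odd_integral_basis[OF odd \<theta>_int theta_mem[folded \<theta>_def] \<alpha>\<theta>,
        where ?s1.0 = "- gauss_i" and ?s2.0 = "1 + gauss_i" and ?t1.0 = "2 - gauss_i"
        and ?t2.0 = 1 and ?t3.0 = gauss_i and ?r1.0 = "2 * (1 + gauss_i)" and ?r1'.0 = "1 - gauss_i"
        and ?r2.0 = 4 and ?r2'.0 = 1], unfold y_def[symmetric] z_def[symmetric])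
      (use ind y_int z_int x2 in \<open>simp_all add: algebra_simps\<close>)
qed

end

section \<open>Radicands divisible by $1 + i$\<close>

context pure_quartic
begin

lemma pi_multiple_if_even:
  assumes "squarefree c" "gauss_even c"
  obtains c' where "c = (1 + gauss_i) * c'" "\<not> gauss_even c'"
proof -
  obtain c' where c': "c = (1 + gauss_i) * c'"
    using assms(2) unfolding gauss_even_def ..
  have "\<not> gauss_even c'"
  proof
    assume "gauss_even c'"
    then have "(1 + gauss_i)\<^sup>2 dvd c"
      unfolding gauss_even_def c' power2_eq_square by (rule mult_dvd_mono[OF dvd_refl])
    then have "1 + gauss_i dvd 1"
      using assms(1) by (rule squarefreeD[rotated])
    then have "gauss_even 1"
      by (simp only: gauss_even_def)
    then show False by simp
  qed
  then show ?thesis using that c' by blast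
qed

lemma not_both_even: "\<not> (gauss_even f \<and> gauss_even g)" "\<not> (gauss_even f \<and> gauss_even h)"
  "\<not> (gauss_even g \<and> gauss_even h)"
proof -
  have "\<not> (gauss_even a \<and> gauss_even b)" if "coprime a b" for a b
  proof
    assume "gauss_even a \<and> gauss_even b"
    then have "1 + gauss_i dvd 1"
      using that unfolding gauss_even_def by (meson coprime_common_divisor)
    then have "gauss_even 1"
      by (simp only: gauss_even_def)
    then show False by simp
  qed
  then show "\<not> (gauss_even f \<and> gauss_even g)" "\<not> (gauss_even f \<and> gauss_even h)"
    "\<not> (gauss_even g \<and> gauss_even h)"
    using coprime by blast+
qed

lemma integral_basis_pure:
  assumes "gauss_even f \<or> gauss_even h \<or> [f * g\<^sup>2 * h ^ 3 = gauss_i] (gmod 2)"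
  shows "gauss_integral_basis {1, \<alpha>, \<alpha>\<^sup>2 / of_gauss (g * h), \<alpha> ^ 3 / of_gauss (g * h\<^sup>2)}
    (gauss_adjoin \<alpha>)"
proof -
  have "pi_independent 1 \<alpha> \<beta> \<gamma>"
    using assms
  proof (elim disjE)
    assume f: "gauss_even f"
    then have odd: "\<not> gauss_even g" "\<not> gauss_even h"
      using not_both_even by blast+
    obtain f' where f': "f = (1 + gauss_i) * f'" "\<not> gauss_even f'"
      using pi_multiple_if_even[OF squarefree(1) f] .
    obtain k where k: "f' * h = 1 + (1 + gauss_i) * k"
      using gauss_odd_iff[of "f' * h"] f'(2) odd(2) by auto
    have "of_gauss f' * H = 1 + (1 + \<i>) * of_gauss k"
      using arg_cong[OF k, of of_gauss] by simp
    then have "\<beta>\<^sup>2 = (1 + \<i>) * (1 + (1 + \<i>) * of_gauss k)"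
      unfolding beta_squared f' by (simp add: mult.assoc)
    moreover have "\<alpha>\<^sup>2 \<doteq> \<beta>"
      using gauss_odd_mult_cong[of "g * h" \<beta>] odd by (simp add: alpha_squared)
    ultimately have "pi_independent 1 \<alpha> \<beta> (\<alpha> * \<beta>)"
      by (intro pi_independent_ramified_unit) auto
    moreover have "\<gamma> \<doteq> \<alpha> * \<beta>"
      unfolding alpha_beta using pi_cong_sym[OF gauss_odd_mult_cong[of h \<gamma>]] odd by simp
    ultimately show ?thesis
      by (intro pi_independent_triangular[of 1 \<alpha> \<beta> "\<alpha> * \<beta>" 1 \<alpha> 0 \<beta> 0 0 \<gamma> 0 0 0]) simp_all
  next
    assume h: "gauss_even h"
    then have odd: "\<not> gauss_even f" "\<not> gauss_even g"
      using not_both_even by blast+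
    obtain h' where h': "h = (1 + gauss_i) * h'" "\<not> gauss_even h'"
      using pi_multiple_if_even[OF squarefree(3) h] .
    obtain k where k: "f * h' = 1 + (1 + gauss_i) * k"
      using gauss_odd_iff[of "f * h'"] h'(2) odd(1) by auto
    have H: "H = (1 + \<i>) * of_gauss h'"
      by (subst h'(1)) simp
    have "F * of_gauss h' = 1 + (1 + \<i>) * of_gauss k"
      using arg_cong[OF k, of of_gauss] by simp
    then have "\<beta>\<^sup>2 = (1 + \<i>) * (1 + (1 + \<i>) * of_gauss k)"
      unfolding beta_squared H by (simp add: mult.left_commute)
    moreover have "\<gamma>\<^sup>2 \<doteq> \<beta>"
      using gauss_odd_mult_cong[of "f * g" \<beta>] odd by (simp add: gamma_squared)
    ultimately have "pi_independent 1 \<gamma> \<beta> (\<gamma> * \<beta>)"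
      by (intro pi_independent_ramified_unit) auto
    moreover have "\<alpha> \<doteq> \<gamma> * \<beta>"
      unfolding mult.commute[of \<gamma>] beta_gamma
      using pi_cong_sym[OF gauss_odd_mult_cong[of f \<alpha>]] odd by simp
    ultimately have "pi_independent 1 \<gamma> \<beta> \<alpha>"
      by (intro pi_independent_triangular[of 1 \<gamma> \<beta> "\<gamma> * \<beta>" 1 \<gamma> 0 \<beta> 0 0 \<alpha> 0 0 0]) simp_all
    then show ?thesis
      by (rule pi_independent_reverse)
  next
    assume "[f * g\<^sup>2 * h ^ 3 = gauss_i] (gmod 2)"
    then obtain t where m: "f * g\<^sup>2 * h ^ 3 = gauss_i + 2 * t"
      by (rule gauss_congE)
    have odd: "\<not> gauss_even g" "\<not> gauss_even h"
      by (rule odd_if_product_odd; simp add: m)+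
    define T where "T = of_gauss t"
    have [simp]: "algebraic_int T" by (simp add: T_def)
    have a4: "\<alpha> * (\<alpha> * (\<alpha> * \<alpha>)) = \<i> + 2 * T"
      using \<alpha>4 unfolding m by (simp add: T_def power4_eq_xxxx mult.assoc)
    define P where "P = 1 + \<alpha>"
    define l where "l = 1 + \<alpha>\<^sup>2"
    note expand = P_def l_def power2_eq_square power3_eq_cube algebra_simps a4
    have int: "algebraic_int P" "algebraic_int l"
      by (auto simp: P_def l_def)
    have l2: "l\<^sup>2 = (1 + \<i>) * (1 + (1 + \<i>) * (- \<i> * (T + \<alpha>\<^sup>2)))"
      by (simp add: expand)
    have "P\<^sup>2 = l + (1 + \<i>) * ((1 - \<i>) * \<alpha>)"
      by (simp add: expand)
    then have "P\<^sup>2 \<doteq> l"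
      by (rule pi_congI) (auto intro!: algebraic_int_intros)
    then have ind: "pi_independent 1 P l (P * l)"
      by (intro pi_independent_ramified_unit[OF int _ l2]) (auto intro!: algebraic_int_intros)
    have "\<alpha>\<^sup>2 \<doteq> \<beta>" "\<alpha> ^ 3 \<doteq> \<gamma>"
      using gauss_odd_mult_cong[of "g * h" \<beta>] gauss_odd_mult_cong[of "g * h\<^sup>2" \<gamma>] odd
      by (simp_all add: alpha_squared alpha_cubed)
    moreover have "\<alpha>\<^sup>2 = l + of_gauss (- 1) * 1 + of_gauss 0 * P"
      "\<alpha> ^ 3 = P * l + of_gauss 1 * 1 + of_gauss (- 1) * P + of_gauss (- 1) * l"
      by (simp_all add: expand)
    ultimately have \<beta>\<gamma>: "\<beta> \<doteq> l + of_gauss (- 1) * 1 + of_gauss 0 * P"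
      "\<gamma> \<doteq> P * l + of_gauss 1 * 1 + of_gauss (- 1) * P + of_gauss (- 1) * l"
      by (metis pi_cong_sym)+
    show ?thesis
      by (rule pi_independent_triangular[OF ind pi_cong_refl _ \<beta>\<gamma>, of \<alpha> "- 1"]) (simp add: P_def)
  qed
  then have "gauss_integral_basis {1, \<alpha>, \<beta>, \<gamma>} (gauss_adjoin \<alpha>)"
    by (intro integral_basisI) (auto simp: gauss.span_base field_closed(2))
  then show ?thesis
    by (simp add: \<beta>_def \<gamma>_def)
qed

lemma even_integral_basis:
  assumes int: "algebraic_int y" "algebraic_int z" and mem: "y \<in> gauss_adjoin \<alpha>" "z \<in> gauss_adjoin \<alpha>"
    and \<beta>: "\<beta> = of_gauss p * y + of_gauss q" and \<gamma>: "\<gamma> = of_gauss r * z + of_gauss s * \<alpha>"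
    and ind: "pi_independent 1 \<alpha> y z"
  shows "gauss_integral_basis {1, \<alpha>, y, z} (gauss_adjoin \<alpha>)"
proof -
  let ?S = "gauss.span {1, \<alpha>, y, z}"
  have S: "1 \<in> ?S" "\<alpha> \<in> ?S" "y \<in> ?S" "z \<in> ?S"
    by (simp_all add: gauss.span_base)
  have scale: "of_gauss c * x \<in> ?S" if "x \<in> ?S" for c x
    using gauss.span_scale[OF that, of c] by (simp add: gauss_scale_def)
  have "\<beta> \<in> ?S"
    unfolding \<beta> using gauss.span_add[OF scale[OF S(3)] scale[OF S(1)], of p q] by simp
  moreover have "\<gamma> \<in> ?S"
    unfolding \<gamma> by (intro gauss.span_add scale S)
  ultimately show ?thesis
    by (intro integral_basisI) (use int mem ind S field_closed(2) in auto)
qed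

lemma integral_basis_fh_i_mod_2:
  assumes fh: "[f * h = gauss_i] (gmod 2)" and g: "gauss_even g"
  shows "gauss_integral_basis {1, \<alpha>, \<alpha>\<^sup>2 / of_gauss (g * h),
    (\<i> * \<alpha> + \<alpha> ^ 3 / of_gauss (g * h\<^sup>2)) / (1 + \<i>)} (gauss_adjoin \<alpha>)"
proof -
  obtain t where t: "f * h = gauss_i + 2 * t"
    using fh by (rule gauss_congE)
  have "\<not> gauss_even (f * h)"
    by (simp add: t)
  then have odd: "\<not> gauss_even f" "\<not> gauss_even h"
    by auto
  obtain g' where g': "g = (1 + gauss_i) * g'" "\<not> gauss_even g'"
    using pi_multiple_if_even[OF squarefree(2) g] .
  obtain a where a: "f = 1 + (1 + gauss_i) * a"
    using odd(1) gauss_odd_iff by blast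
  obtain b where b: "h = 1 + (1 + gauss_i) * b"
    using odd(2) gauss_odd_iff by blast
  define k where "k = a - b"
  have fk: "f - h = (1 + gauss_i) * k"
    by (simp add: a b k_def algebra_simps)
  have k: "\<not> gauss_even k"
  proof -
    have "(1 + gauss_i) * (a + b + (1 + gauss_i) * (a * b)) = (1 + gauss_i) * (gauss_i + (1 - gauss_i) * t)"
      using t unfolding a b by (simp add: gauss_int_eq_iff gauss_i_def algebra_simps)
    moreover have "(1 + gauss_i) \<noteq> 0"
      by (simp add: gauss_int_eq_iff gauss_i_def)
    ultimately have "a + b + (1 + gauss_i) * (a * b) = gauss_i + (1 - gauss_i) * t"
      by (metis mult_left_cancel)
    then have "gauss_even (a + b + (1 + gauss_i) * (a * b)) \<longleftrightarrow> gauss_even (gauss_i + (1 - gauss_i) * t)"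
      by simp
    then show ?thesis
      by (simp add: k_def)
  qed
  obtain e where e: "g' * k = 1 + (1 + gauss_i) * e"
    using gauss_odd_iff[of "g' * k"] g'(2) k by auto
  obtain e1 where e1: "k + (1 - gauss_i) * h = 1 + (1 + gauss_i) * e1"
    using gauss_odd_iff[of "k + (1 - gauss_i) * h"] k by auto
  obtain e2 where e2: "gauss_i * h = 1 + (1 + gauss_i) * e2"
    using gauss_odd_iff[of "gauss_i * h"] odd by auto
  define w where "w = (\<i> * \<alpha> + \<gamma>) / (1 + \<i>)"
  have \<gamma>: "\<gamma> = (1 + \<i>) * w - \<i> * \<alpha>"
    by (simp add: w_def)
  have FH: "F * H = \<i> + 2 * of_gauss t"
    using arg_cong[OF t, of of_gauss] by simp
  have "(1 + \<i>)\<^sup>2 * w\<^sup>2 = (\<i> * \<alpha> + \<gamma>)\<^sup>2"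
    by (simp add: w_def power_divide)
  also have "\<dots> = G * ((F - H) * \<beta> + 2 * \<i> * (F * H))"
    using alpha_squared gamma_squared alpha_gamma by (simp add: power2_eq_square algebra_simps)
  also have "\<dots> = (1 + \<i>)\<^sup>2 * (of_gauss (g' * k) * \<beta> + (1 + \<i>) * of_gauss g' * (F * H))"
    using arg_cong[OF fk, of of_gauss] unfolding g'(1) by (simp add: power2_eq_square algebra_simps)
  finally have w2: "w\<^sup>2 = of_gauss (g' * k) * \<beta> + (1 + \<i>) * of_gauss g' * (F * H)"
    by simp
  have w_int: "algebraic_int w"
    by (rule algebraic_int_powerD[of _ 2]) (unfold w2, auto intro!: algebraic_int_intros)
  define l where "l = 1 + \<beta>"
  define P where "P = w + 1"
  have int: "algebraic_int P" "algebraic_int l"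
    using w_int by (auto simp: P_def l_def)
  have l2: "l\<^sup>2 = (1 + \<i>) * (1 + (1 + \<i>) * (- \<i> * (\<beta> + of_gauss t)))"
    using beta_squared FH by (simp add: l_def power2_eq_square algebra_simps)
  have "P\<^sup>2 = l + (1 + \<i>) * (of_gauss e * \<beta> + of_gauss g' * (F * H) + (1 - \<i>) * w)"
    using w2 unfolding e by (simp add: P_def l_def power2_eq_square algebra_simps)
  then have "P\<^sup>2 \<doteq> l"
    by (rule pi_congI) (use w_int in \<open>auto intro!: algebraic_int_intros\<close>)
  then have ind: "pi_independent 1 P l (P * l)"
    by (intro pi_independent_ramified_unit[OF int _ l2]) (auto intro!: algebraic_int_intros)
  have "(1 + \<i>) * (w * \<beta>) = (\<i> * \<alpha> + \<gamma>) * \<beta>"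
    by (simp add: w_def)
  also have "\<dots> = \<i> * H * \<gamma> + F * \<alpha>"
    using alpha_beta beta_gamma by (simp add: algebra_simps)
  also have "\<dots> = (1 + \<i>) * (\<i> * H * w + (of_gauss k + (1 - \<i>) * H) * \<alpha>)"
    unfolding \<gamma> using arg_cong[OF fk, of of_gauss] by (simp add: algebra_simps)
  finally have "w * \<beta> = of_gauss (gauss_i * h) * w + of_gauss (k + (1 - gauss_i) * h) * \<alpha>"
    by (simp add: mult.assoc)
  then have "w * \<beta> = w + \<alpha> + (1 + \<i>) * (of_gauss e2 * w + of_gauss e1 * \<alpha>)"
    unfolding e1 e2 by (simp add: algebra_simps)
  then have "\<alpha> = P * l + of_gauss 0 * 1 + of_gauss 0 * P + of_gauss (- 1) * l
      + (1 + \<i>) * (- (1 - \<i>) * w - (of_gauss e2 * w + of_gauss e1 * \<alpha>))"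
    by (simp add: P_def l_def algebra_simps)
  then have \<alpha>: "\<alpha> \<doteq> P * l + of_gauss 0 * 1 + of_gauss 0 * P + of_gauss (- 1) * l"
    by (rule pi_congI) (use w_int in \<open>auto intro!: algebraic_int_intros\<close>)
  have "w \<doteq> P + of_gauss (- 1) * 1" "\<beta> \<doteq> l + of_gauss (- 1) * 1 + of_gauss 0 * P"
    by (simp_all add: P_def l_def)
  then have "pi_independent 1 w \<beta> \<alpha>"
    by (rule pi_independent_triangular[OF ind pi_cong_refl _ _ \<alpha>])
  then have "pi_independent 1 \<alpha> \<beta> w"
    by (rule pi_independent_reverse)
  moreover have w_mem: "w \<in> gauss_adjoin \<alpha>"
    unfolding w_def by (intro field_closed field_mem)
  ultimately have "gauss_integral_basis {1, \<alpha>, \<beta>, w} (gauss_adjoin \<alpha>)"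
    by (intro even_integral_basis[where p = 1 and q = 0 and r = "1 + gauss_i" and s = "- gauss_i"])
      (use w_int w_mem in \<open>auto simp: \<gamma>\<close>)
  then show ?thesis
    by (simp add: w_def \<beta>_def \<gamma>_def)
qed

end

lemma gauss_odd_square:
  assumes "\<not> gauss_even c"
  obtains k where "c\<^sup>2 = 1 + 4 * k" | k where "c\<^sup>2 = - 1 + 4 * k"
proof -
  have "odd (gRe c + gIm c)"
    using assms by (simp add: gauss_even_altdef)
  then consider a b where "gRe c = 2 * a + 1" "gIm c = 2 * b" | a b where "gRe c = 2 * a" "gIm c = 2 * b + 1"
    by (auto elim!: evenE oddE)
  then show ?thesis
  proof cases
    case 1
    then show ?thesis
      by (intro that(1)[of "GaussInt (a\<^sup>2 + a - b\<^sup>2) (2 * a * b + b)"])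
        (simp add: gauss_int_eq_iff power2_eq_square algebra_simps)
  next
    case 2
    then show ?thesis
      by (intro that(2)[of "GaussInt (a\<^sup>2 - b - b\<^sup>2) (2 * a * b + a)"])
        (simp add: gauss_int_eq_iff power2_eq_square algebra_simps)
  qed
qed

lemma gauss_i_square: "gauss_i * gauss_i = - 1"
  by (simp add: gauss_int_eq_iff gauss_i_def)

text \<open>
  Multiply by \<open>h\<close> and use $h \bar h \equiv 1 \pmod 4$.
\<close>

lemma cnj_cong_imp:
  assumes "\<not> gauss_even h" "[f * gauss_cnj h = e] (gmod 2 * (1 + gauss_i))"
  obtains s where "f = e * h + 2 * (1 + gauss_i) * s"
proof -
  obtain k where k: "h * gauss_cnj h = 1 + 4 * k"
    using gauss_odd_norm[OF assms(1)] .
  obtain a where a: "f * gauss_cnj h = e + 2 * (1 + gauss_i) * a"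
    using assms(2) by (rule gauss_congE)
  have four: "4 = 2 * (1 + gauss_i) * (1 - gauss_i)"
    by (simp add: gauss_int_eq_iff gauss_i_def)
  have "f * (1 + 4 * k) = (e + 2 * (1 + gauss_i) * a) * h"
    unfolding k[symmetric] a[symmetric] by (simp add: mult_ac)
  then have "f = e * h + 2 * (1 + gauss_i) * a * h - 4 * (k * f)"
    by (simp add: algebra_simps)
  also have "\<dots> = e * h + 2 * (1 + gauss_i) * (a * h - (1 - gauss_i) * (k * f))"
    unfolding four by (simp add: algebra_simps)
  finally show ?thesis using that by blast
qed

lemma gauss_four_dvd_iff: "4 dvd (2 * (1 + gauss_i) * s) \<longleftrightarrow> gauss_even s"
proof
  assume "4 dvd (2 * (1 + gauss_i) * s)"
  then obtain k where "2 * (1 + gauss_i) * s = 4 * k" ..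
  also have "\<dots> = 2 * (1 + gauss_i) * ((1 - gauss_i) * k)"
    by (simp add: gauss_int_eq_iff gauss_i_def algebra_simps)
  finally have "2 * (1 + gauss_i) * s = 2 * (1 + gauss_i) * ((1 - gauss_i) * k)" .
  moreover have "2 * (1 + gauss_i) \<noteq> 0"
    by (simp add: gauss_int_eq_iff gauss_i_def)
  ultimately have "s = (1 - gauss_i) * k"
    by (metis mult_left_cancel)
  then show "gauss_even s" by simp
next
  assume "gauss_even s"
  then obtain k where "s = (1 + gauss_i) * k"
    unfolding gauss_even_def ..
  then have "2 * (1 + gauss_i) * s = 4 * (gauss_i * k)"
    by (simp add: gauss_int_eq_iff gauss_i_def algebra_simps)
  then show "4 dvd (2 * (1 + gauss_i) * s)"
    by simp
qed

lemma gauss_2_dvd_if_mult_4_dvd: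
  assumes x: "gauss_even x" "4 dvd x * y" "x - y = 2 * z" "\<not> gauss_even z"
  shows "2 dvd x"
proof -
  obtain a where a: "x = (1 + gauss_i) * a"
    using x(1) unfolding gauss_even_def ..
  have y: "y = (1 + gauss_i) * (a - (1 - gauss_i) * z)"
    using x(3) unfolding a by (simp add: gauss_int_eq_iff gauss_i_def algebra_simps)
  obtain k where "x * y = 4 * k"
    using x(2) ..
  then have "(2 * gauss_i) * (a * (a - (1 - gauss_i) * z)) = (2 * gauss_i) * (- 2 * gauss_i * k)"
    unfolding a y by (simp add: gauss_int_eq_iff gauss_i_def algebra_simps)
  moreover have "2 * gauss_i \<noteq> 0"
    by (simp add: gauss_int_eq_iff gauss_i_def)
  ultimately have "a * (a - (1 - gauss_i) * z) = - 2 * gauss_i * k"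
    by (metis mult_left_cancel)
  then have "gauss_even (a * (a - (1 - gauss_i) * z)) \<longleftrightarrow> gauss_even (- 2 * gauss_i * k)"
    by simp
  then have "gauss_even a"
    by simp
  then obtain b where "a = (1 + gauss_i) * b"
    unfolding gauss_even_def ..
  then have "x = 2 * (gauss_i * b)"
    unfolding a by (simp add: gauss_int_eq_iff gauss_i_def algebra_simps)
  then show "2 dvd x" by simp
qed

context pure_quartic
begin

text \<open>
  The signs in the congruences for $fh$ and $f \bar h$ are written as \<open>\<delta>\<^sup>2\<close> and \<open>\<epsilon>\<^sup>2\<close>, because \<open>\<delta>\<close> and
  \<open>\<epsilon>\<close> are the coefficients of the basis elements.
\<close>

lemma integral_basis_fh_unit_square:
  assumes g: "gauss_even g" and \<epsilon>: "\<epsilon> = 1 \<or> \<epsilon> = gauss_i" and \<delta>: "\<delta> = 1 \<or> \<delta> = gauss_i"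
    and fh: "[f * h = \<delta>\<^sup>2] (gmod 4)" and fh': "[f * gauss_cnj h = \<epsilon>\<^sup>2] (gmod 2 * (1 + gauss_i))"
  shows "gauss_integral_basis {1, \<alpha>, (of_gauss \<delta> * of_gauss (g * h) + \<alpha>\<^sup>2) / (2 * of_gauss (g * h)),
    (of_gauss \<epsilon> * \<alpha> + \<alpha> ^ 3 / of_gauss (g * h\<^sup>2)) / 2} (gauss_adjoin \<alpha>)"
proof -
  obtain e where e: "f * h = \<delta>\<^sup>2 + 4 * e"
    using fh by (rule gauss_congE)
  have units: "\<not> gauss_even \<delta>" "\<not> gauss_even \<epsilon>"
    using \<delta> \<epsilon> by auto
  have "\<not> gauss_even (f * h)"
    using units by (simp add: e)
  then have odd: "\<not> gauss_even f" "\<not> gauss_even h"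
    by auto
  obtain g' where g': "g = (1 + gauss_i) * g'" "\<not> gauss_even g'"
    using pi_multiple_if_even[OF squarefree(2) g] .
  obtain s where s: "f = \<epsilon>\<^sup>2 * h + 2 * (1 + gauss_i) * s"
    using cnj_cong_imp[OF odd(2) fh'] .
  have \<delta>2: "\<delta>\<^sup>2 = 1 \<or> \<delta>\<^sup>2 = - 1" and \<epsilon>2: "\<epsilon>\<^sup>2 = 1 \<or> \<epsilon>\<^sup>2 = - 1"
    using \<delta> \<epsilon> by (auto simp: power2_eq_square gauss_i_square)
  have "gauss_even s"
  proof -
    have eq: "2 * (1 + gauss_i) * (s * h) = \<delta>\<^sup>2 + 4 * e - \<epsilon>\<^sup>2 * h\<^sup>2"
      using e unfolding s by (simp add: algebra_simps power2_eq_square)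
    have sgn: "\<exists>k. \<epsilon>\<^sup>2 * h\<^sup>2 = 1 + 4 * k \<or> \<epsilon>\<^sup>2 * h\<^sup>2 = - 1 + 4 * k"
      using gauss_odd_square[OF odd(2)] \<epsilon>2
      by (metis (no_types, opaque_lifting) add.inverse_inverse minus_add_distrib mult_1 mult_minus1 mult_minus_right)
    have "4 dvd (2 * (1 + gauss_i) * (s * h)) \<or> (\<exists>k. 2 * (1 + gauss_i) * (s * h) = 2 + 4 * k)"
    proof -
      obtain k where "\<epsilon>\<^sup>2 * h\<^sup>2 = 1 + 4 * k \<or> \<epsilon>\<^sup>2 * h\<^sup>2 = - 1 + 4 * k"
        using sgn ..
      then have "2 * (1 + gauss_i) * (s * h) = 4 * (e - k) \<or> 2 * (1 + gauss_i) * (s * h) = 2 + 4 * (e - k)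
          \<or> 2 * (1 + gauss_i) * (s * h) = 2 + 4 * (e - k - 1)"
        using \<delta>2 unfolding eq by (elim disjE) (simp_all add: algebra_simps)
      then show ?thesis by (metis dvd_triv_left)
    qed
    then have "gauss_even (s * h)"
    proof
      assume "\<exists>k. 2 * (1 + gauss_i) * (s * h) = 2 + 4 * k"
      then obtain k where "2 * ((1 + gauss_i) * (s * h)) = 2 * (1 + 2 * k)"
        by (auto simp: algebra_simps)
      then have "(1 + gauss_i) * (s * h) = 1 + 2 * k"
        by (rule iffD1[OF mult_left_cancel, rotated]) (simp add: gauss_int_eq_iff)
      then have "gauss_even ((1 + gauss_i) * (s * h)) \<longleftrightarrow> gauss_even (1 + 2 * k)"
        by simp
      then show ?thesis by simp
    qed (simp only: gauss_four_dvd_iff)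
    then show ?thesis using odd by simp
  qed
  then have "4 dvd 2 * (1 + gauss_i) * s"
    by (simp only: gauss_four_dvd_iff)
  then obtain s' where s': "f = \<epsilon>\<^sup>2 * h + 4 * s'"
    using s by (metis dvdE)
  have "2 dvd \<epsilon> * h - \<delta>"
  proof (rule gauss_2_dvd_if_mult_4_dvd[of _ "\<epsilon> * h + \<delta>" "- \<delta>"])
    have "(\<epsilon> * h - \<delta>) * (\<epsilon> * h + \<delta>) = 4 * (e - s' * h)"
      using e unfolding s' by (simp add: algebra_simps power2_eq_square)
    then show "4 dvd (\<epsilon> * h - \<delta>) * (\<epsilon> * h + \<delta>)"
      by simp
  qed (use units odd in simp_all)
  then obtain v where v: "\<epsilon> * h - \<delta> = 2 * v" ..
  define w where "w = (of_gauss \<delta> + \<beta>) / 2"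
  define z where "z = (of_gauss \<epsilon> * \<alpha> + \<gamma>) / 2"
  define D where "D = of_gauss \<delta>"
  define E where "E = of_gauss \<epsilon>"
  define S where "S = of_gauss s'"
  define e0 where "e0 = of_gauss e"
  define v0 where "v0 = of_gauss v"
  have \<beta>: "\<beta> = 2 * w - D" and \<gamma>: "\<gamma> = 2 * z - E * \<alpha>"
    by (simp_all add: w_def z_def D_def E_def)
  have FH: "F * H = D\<^sup>2 + 4 * e0"
    using arg_cong[OF e, of of_gauss] by (simp add: D_def e0_def)
  have Fs: "F = E\<^sup>2 * H + 4 * S"
    using arg_cong[OF s', of of_gauss] by (simp add: E_def S_def)
  have EH: "E * H = D + 2 * v0"
    using arg_cong[OF v, of of_gauss] by (simp add: E_def D_def v0_def algebra_simps)
  have "4 * w\<^sup>2 = (D + \<beta>)\<^sup>2"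
    by (simp add: w_def D_def power_divide)
  also have "\<dots> = 4 * (D * w + e0)"
    using beta_squared FH by (simp add: \<beta> power2_eq_square algebra_simps)
  finally have w2: "w\<^sup>2 = D * w + e0"
    by (rule iffD1[OF mult_left_cancel, rotated]) simp
  have w_int: "algebraic_int w"
    by (rule algebraic_int_quadratic[OF _ _ w2]) (simp_all add: D_def e0_def)
  obtain d where d: "\<delta> = 1 + (1 + gauss_i) * d"
    using units(1) gauss_odd_iff by blast
  have "w\<^sup>2 = w + of_gauss e + (1 + \<i>) * (of_gauss d * w)"
    unfolding w2 D_def e0_def d by (simp add: algebra_simps)
  then have w2_cong: "w\<^sup>2 \<doteq> w + of_gauss e"
    by (rule pi_congI) (use w_int in auto)
  have "4 * z\<^sup>2 = (E * \<alpha> + \<gamma>)\<^sup>2"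
    by (simp add: z_def E_def power_divide)
  also have "\<dots> = E\<^sup>2 * \<alpha>\<^sup>2 + 2 * E * (\<alpha> * \<gamma>) + \<gamma>\<^sup>2"
    by (simp add: power2_eq_square algebra_simps)
  also have "\<dots> = G * (2 * E * (F * H) + (E\<^sup>2 * H + F) * \<beta>)"
    unfolding alpha_squared alpha_gamma gamma_squared by (simp add: algebra_simps)
  also have "2 * E * (F * H) + (E\<^sup>2 * H + F) * \<beta> = 4 * (E * H * (E * (w + v0) + 2 * S) + S * \<beta>)"
  proof -
    have "2 * E * (F * H) + (E\<^sup>2 * H + F) * \<beta> =
        2 * E * H * (F + E * \<beta>) + (F - E\<^sup>2 * H) * \<beta>"
      by (simp add: power2_eq_square algebra_simps)
    also have "F + E * \<beta> = E * (E * H - D) + E * (2 * w) + 4 * S"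
      unfolding Fs \<beta> by (simp add: power2_eq_square algebra_simps)
    also have "E * H - D = 2 * v0"
      by (simp add: EH)
    also have "F - E\<^sup>2 * H = 4 * S"
      by (simp add: Fs)
    finally show ?thesis
      by (simp add: algebra_simps)
  qed
  also have "G * (4 * (E * H * (E * (w + v0) + 2 * S) + S * \<beta>)) = 4 * (G * (E * H * (E * (w + v0) + 2 * S) + S * \<beta>))"
    by (rule mult.left_commute)
  finally have z2: "z\<^sup>2 = G * (E * H * (E * (w + v0) + 2 * S) + S * \<beta>)"
    by (rule iffD1[OF mult_left_cancel, rotated]) simp
  have z_int: "algebraic_int z"
    by (rule algebraic_int_powerD[of _ 2])
      (unfold z2, use w_int in \<open>auto simp: E_def v0_def S_def intro!: algebraic_int_intros\<close>)
  have G: "G = (1 + \<i>) * of_gauss g'"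
    by (subst g'(1)) simp
  have x2: "\<alpha>\<^sup>2 = (1 + \<i>) * (of_gauss (g' * h) * \<beta>)"
    by (simp add: alpha_squared G)
  have "\<beta> = 1 + (1 + \<i>) * ((1 - \<i>) * (w - 1) - of_gauss d)"
    unfolding \<beta> D_def d by (simp add: algebra_simps)
  then have "\<beta> \<doteq> 1"
    by (rule pi_congI) (use w_int in \<open>auto intro!: algebraic_int_intros\<close>)
  moreover have "of_gauss (g' * h) * \<beta> * 1 \<doteq> \<beta>"
    using gauss_odd_mult_cong[of "g' * h" \<beta>] g'(2) odd by simp
  ultimately have unit: "of_gauss (g' * h) * \<beta> * 1 \<doteq> 1"
    by (rule pi_cong_trans[rotated])
  have "pi_independent_pair 1 w"
    by (rule pi_independent_pair_half[OF units(1), of "1 / (G * H)"])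
      (use w_int in \<open>auto simp: w_def \<beta>_def intro!: gauss_field_closed\<close>)
  then have ind: "pi_independent 1 w \<alpha> (\<alpha> * w)"
    by (rule pi_independent_unramified[OF _ w2_cong w_int _ _ _ x2 unit]) auto
  have "2 * (H * z) = E * H * \<alpha> + \<alpha> * \<beta>"
    unfolding alpha_beta by (simp add: z_def E_def algebra_simps)
  also have "\<dots> = 2 * (\<alpha> * w + v0 * \<alpha>)"
    unfolding EH by (simp add: \<beta> algebra_simps)
  finally have "H * z = \<alpha> * w + v0 * \<alpha>"
    by (rule iffD1[OF mult_left_cancel, rotated]) simp
  then have "H * z = \<alpha> * w + of_gauss 0 * 1 + of_gauss 0 * w + of_gauss v * \<alpha>"
    by (simp add: v0_def)
  then have z: "z \<doteq> \<alpha> * w + of_gauss 0 * 1 + of_gauss 0 * w + of_gauss v * \<alpha>"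
    using pi_cong_sym[OF gauss_odd_mult_cong[OF odd(2) z_int]] by simp
  have "pi_independent 1 w \<alpha> z"
    by (rule pi_independent_triangular[OF ind pi_cong_refl _ _ z, of w 0 \<alpha> 0 0]) simp_all
  then have ind': "pi_independent 1 \<alpha> w z"
    by (rule pi_independent_swap)
  have mem: "w \<in> gauss_adjoin \<alpha>" "z \<in> gauss_adjoin \<alpha>"
    unfolding w_def z_def by (intro field_closed field_mem)+
  have "\<beta> = of_gauss 2 * w + of_gauss (- \<delta>)" "\<gamma> = of_gauss 2 * z + of_gauss (- \<epsilon>) * \<alpha>"
    by (simp_all add: w_def z_def)
  then have "gauss_integral_basis {1, \<alpha>, w, z} (gauss_adjoin \<alpha>)"
    by (rule even_integral_basis[OF w_int z_int mem _ _ ind'])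
  moreover have "(of_gauss \<delta> * of_gauss (g * h) + \<alpha>\<^sup>2) / (2 * of_gauss (g * h)) = w"
  proof -
    have "of_gauss \<delta> * of_gauss (g * h) + \<alpha>\<^sup>2 = of_gauss (g * h) * (of_gauss \<delta> + \<beta>)"
      by (simp add: alpha_squared algebra_simps)
    then show ?thesis
      using nonzero by (simp add: w_def)
  qed
  ultimately show ?thesis
    by (simp add: z_def \<gamma>_def)
qed

lemma integral_basis_fh_not_unit_square:
  assumes g: "gauss_even g" and \<epsilon>: "\<epsilon> = 1 \<or> \<epsilon> = gauss_i"
    and not4: "\<not> [f * h = 1] (gmod 4)" "\<not> [f * h = - 1] (gmod 4)"
    and fh: "[f * h = 1] (gmod 2 * (1 + gauss_i)) \<or> [f * h = - 1] (gmod 2 * (1 + gauss_i))"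
    and fh': "[f * gauss_cnj h = \<epsilon>\<^sup>2] (gmod 2 * (1 + gauss_i))"
  shows "gauss_integral_basis {1, \<alpha>, (of_gauss (g * h) + \<alpha>\<^sup>2) / ((1 + \<i>) * of_gauss (g * h)),
    (of_gauss \<epsilon> * \<alpha> + \<alpha> ^ 3 / of_gauss (g * h\<^sup>2)) / 2} (gauss_adjoin \<alpha>)"
proof -
  obtain j e where j: "j = 0 \<or> j = 1" and e: "f * h = 1 - 2 * j + 2 * (1 + gauss_i) * e"
  proof (use fh in \<open>elim disjE\<close>)
    assume "[f * h = 1] (gmod 2 * (1 + gauss_i))"
    then obtain e where "f * h = 1 + 2 * (1 + gauss_i) * e"
      by (rule gauss_congE)
    then show thesis by (intro that[of 0 e]) simp_all
  next
    assume "[f * h = - 1] (gmod 2 * (1 + gauss_i))"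
    then obtain e where "f * h = - 1 + 2 * (1 + gauss_i) * e"
      by (rule gauss_congE)
    then show thesis by (intro that[of 1 e]) simp_all
  qed
  have unit: "\<not> gauss_even \<epsilon>"
    using \<epsilon> by auto
  have "\<not> gauss_even (f * h)"
    by (simp add: e)
  then have odd: "\<not> gauss_even f" "\<not> gauss_even h"
    by auto
  have \<epsilon>2: "\<epsilon>\<^sup>2 = 1 \<or> \<epsilon>\<^sup>2 = - 1"
    using \<epsilon> by (auto simp: power2_eq_square gauss_i_square)
  obtain g' where g': "g = (1 + gauss_i) * g'" "\<not> gauss_even g'"
    using pi_multiple_if_even[OF squarefree(2) g] .
  obtain s where s: "f = \<epsilon>\<^sup>2 * h + 2 * (1 + gauss_i) * s"
    using cnj_cong_imp[OF odd(2) fh'] .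
  have e_odd: "\<not> gauss_even e"
  proof
    assume "gauss_even e"
    then have "4 dvd 2 * (1 + gauss_i) * e"
      by (simp only: gauss_four_dvd_iff)
    then show False
      using not4 j e by (auto simp: gauss_cong_def)
  qed
  have s_odd: "\<not> gauss_even s"
  proof
    assume "gauss_even s"
    then have "gauss_even (s * h)" by simp
    then have "4 dvd 2 * (1 + gauss_i) * (s * h)"
      by (simp only: gauss_four_dvd_iff)
    then obtain k where "2 * (1 + gauss_i) * (s * h) = 4 * k" ..
    then have fh: "f * h = \<epsilon>\<^sup>2 * h\<^sup>2 + 4 * k"
      unfolding s by (simp add: algebra_simps power2_eq_square)
    obtain l where "h\<^sup>2 = 1 + 4 * l \<or> h\<^sup>2 = - 1 + 4 * l"
      using gauss_odd_square[OF odd(2)] by metis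
    then have "f * h = 1 + 4 * (l + k) \<or> f * h = - 1 + 4 * (l + k) \<or>
        f * h = - 1 + 4 * (k - l) \<or> f * h = 1 + 4 * (k - l)"
      using \<epsilon>2 unfolding fh by (elim disjE) (simp_all add: algebra_simps)
    then show False
      using not4 unfolding gauss_cong_def by (metis add_diff_cancel_left' dvd_triv_left)
  qed
  obtain \<epsilon>' where \<epsilon>': "\<epsilon> * \<epsilon>' = 1"
    using \<epsilon> gauss_i_square by (metis minus_minus mult_1 mult_minus_right)
  have "\<not> gauss_even (\<epsilon>' * f)"
    using arg_cong[OF \<epsilon>', of gauss_even] odd by simp
  then obtain v where v: "\<epsilon>' * f = 1 + (1 + gauss_i) * v"
    using gauss_odd_iff by blast
  have "gauss_even (1 + \<epsilon> * h)"
    using unit odd by simp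
  then obtain u where u: "1 + \<epsilon> * h = (1 + gauss_i) * u"
    unfolding gauss_even_def ..
  obtain e1 where e1: "e = 1 + (1 + gauss_i) * e1"
    using e_odd gauss_odd_iff by blast
  obtain s1 where s1: "s = 1 + (1 + gauss_i) * s1"
    using s_odd gauss_odd_iff by blast
  define d where "d = v + 1 + j"
  define k where "k = (1 + \<beta>) / (1 + \<i>)"
  define z where "z = (of_gauss \<epsilon> * \<alpha> + \<gamma>) / 2"
  define E where "E = of_gauss \<epsilon>"
  define E' where "E' = of_gauss \<epsilon>'"
  define S where "S = of_gauss s"
  define J where "J = of_gauss j"
  define V where "V = of_gauss v"
  define D where "D = of_gauss d"
  define U where "U = of_gauss u"
  define e2 where "e2 = of_gauss e1"
  define l where "l = k + J"
  define P where "P = z + D"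
  have [simp]: "algebraic_int E" "algebraic_int S" "algebraic_int J" "algebraic_int V" "algebraic_int D"
    "algebraic_int U" "algebraic_int e2"
    by (simp_all add: E_def S_def J_def V_def D_def U_def e2_def)
  have JJ: "J * J = J"
    using j by (auto simp: J_def)
  have EE: "E * E' = 1"
    using arg_cong[OF \<epsilon>', of of_gauss] by (simp add: E_def E'_def)
  have \<beta>: "\<beta> = (1 + \<i>) * k - 1" and \<gamma>: "\<gamma> = 2 * z - E * \<alpha>"
    by (simp_all add: k_def z_def E_def)
  have FH: "F * H = 1 - 2 * J + 2 * (1 + \<i>) * (1 + (1 + \<i>) * e2)"
    using arg_cong[OF e[unfolded e1], of of_gauss] by (simp add: J_def e2_def)
  have Fs: "F = E\<^sup>2 * H + 2 * (1 + \<i>) * S"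
    using arg_cong[OF s, of of_gauss] by (simp add: E_def S_def)
  have "E' * F = 1 + (1 + \<i>) * V"
    using arg_cong[OF v, of of_gauss] by (simp add: E'_def V_def)
  then have FE: "F = E * (1 + (1 + \<i>) * V)"
    using EE by (metis mult.assoc mult.left_commute mult_1)
  have EH: "1 + E * H = (1 + \<i>) * U"
    using arg_cong[OF u, of of_gauss] by (simp add: E_def U_def)
  have S1: "S = 1 + (1 + \<i>) * of_gauss s1"
    using arg_cong[OF s1, of of_gauss] by (simp add: S_def)
  have G: "G = (1 + \<i>) * of_gauss g'"
    by (subst g'(1)) simp
  have "(1 + \<i>)\<^sup>2 * k\<^sup>2 = (1 + \<beta>)\<^sup>2"
    by (simp add: k_def power_divide)
  also have "\<dots> = 1 + 2 * \<beta> + F * H"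
    unfolding beta_squared[symmetric] by (simp add: power2_eq_square algebra_simps)
  also have "\<dots> = (1 + \<i>)\<^sup>2 * (- \<i> * (1 + \<i>) * k + (\<i> * J - \<i> * (1 + \<i>) * (1 + (1 + \<i>) * e2)))"
    unfolding FH \<beta> by (simp add: power2_eq_square algebra_simps)
  finally have k2: "k\<^sup>2 = - \<i> * (1 + \<i>) * k + (\<i> * J - \<i> * (1 + \<i>) * (1 + (1 + \<i>) * e2))"
    by simp
  have k_int: "algebraic_int k"
    by (rule algebraic_int_quadratic[OF _ _ k2]) (auto intro!: algebraic_int_intros)
  have l_int: "algebraic_int l"
    using k_int by (auto simp: l_def)
  have l2: "l\<^sup>2 = (1 + \<i>) * (1 + l + (1 + \<i>) * (- (1 + \<i> * e2) - k - \<i> * J * k))"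
    using k2 by (simp add: l_def power2_eq_square algebra_simps JJ)
  have "4 * z\<^sup>2 = (E * \<alpha> + \<gamma>)\<^sup>2"
    by (simp add: z_def E_def power_divide)
  also have "\<dots> = E\<^sup>2 * \<alpha>\<^sup>2 + 2 * E * (\<alpha> * \<gamma>) + \<gamma>\<^sup>2"
    by (simp add: power2_eq_square algebra_simps)
  also have "\<dots> = G * (2 * E * (F * H) + (E\<^sup>2 * H + F) * \<beta>)"
    unfolding alpha_squared alpha_gamma gamma_squared by (simp add: algebra_simps)
  also have "2 * E * (F * H) + (E\<^sup>2 * H + F) * \<beta> = 2 * (1 + \<i>) * (E\<^sup>2 * H * (V + k) + S * \<beta>)"
  proof -
    have "2 * E * (F * H) + (E\<^sup>2 * H + F) * \<beta> =
        2 * E * H * (F + E * \<beta>) + (F - E\<^sup>2 * H) * \<beta>"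
      by (simp add: power2_eq_square algebra_simps)
    also have "F + E * \<beta> = E * ((1 + \<i>) * (V + k))"
      unfolding FE \<beta> by (simp add: algebra_simps)
    also have "F - E\<^sup>2 * H = 2 * (1 + \<i>) * S"
      by (simp add: Fs)
    finally show ?thesis
      by (simp add: algebra_simps power2_eq_square)
  qed
  also have "G * (2 * (1 + \<i>) * (E\<^sup>2 * H * (V + k) + S * \<beta>)) =
      4 * (of_gauss (gauss_i * g' * \<epsilon>\<^sup>2 * h) * (V + k) + of_gauss (gauss_i * g' * s) * \<beta>)"
    unfolding G by (simp add: E_def S_def algebra_simps)
  finally have z2: "z\<^sup>2 = of_gauss (gauss_i * g' * \<epsilon>\<^sup>2 * h) * (V + k) + of_gauss (gauss_i * g' * s) * \<beta>"
    by (rule iffD1[OF mult_left_cancel, rotated]) simp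
  have z_int: "algebraic_int z"
    by (rule algebraic_int_powerD[of _ 2])
      (unfold z2, use k_int in \<open>auto intro!: algebraic_int_intros\<close>)
  have P_int: "algebraic_int P"
    using z_int by (auto simp: P_def)
  have \<beta>_cong: "\<beta> \<doteq> 1"
    by (rule pi_congI[of _ _ "k - (1 - \<i>)"]) (use k_int in \<open>auto simp: \<beta> algebra_simps intro!: algebraic_int_intros\<close>)
  have "z\<^sup>2 \<doteq> (V + k) + \<beta>"
    unfolding z2
    by (intro pi_cong_add gauss_odd_mult_cong) (use unit odd g'(2) s_odd k_int in \<open>auto intro!: algebraic_int_intros\<close>)
  also have "\<dots> \<doteq> (V + k) + 1"
    by (intro pi_cong_add pi_cong_refl \<beta>_cong)
  finally have z2_cong: "z\<^sup>2 \<doteq> (V + k) + 1" .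
  have "gauss_even (d\<^sup>2 + d)"
    by simp
  then obtain c where "d\<^sup>2 + d = (1 + gauss_i) * c"
    unfolding gauss_even_def ..
  from arg_cong[OF this, of of_gauss] have DD: "D\<^sup>2 + D = (1 + \<i>) * of_gauss c"
    by (simp add: D_def)
  have "P\<^sup>2 = z\<^sup>2 + (1 + \<i>) * ((1 - \<i>) * D * z + of_gauss c) - D"
    unfolding P_def using DD by (simp add: power2_eq_square algebra_simps)
  also have "\<dots> = (z\<^sup>2 + - D) + (1 + \<i>) * ((1 - \<i>) * D * z + of_gauss c)"
    by simp
  also have "\<dots> \<doteq> (V + k + 1 + - D) + 0"
    using z_int by (intro pi_cong_add z2_cong pi_cong_refl pi_cong_pi) (auto intro!: algebraic_int_intros)
  also have "\<dots> = l + 2 * (- J)"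
    by (simp add: D_def d_def l_def V_def J_def)
  also have "\<dots> \<doteq> l + 0"
    by (intro pi_cong_add pi_cong_refl two_mult_cong) auto
  finally have P2: "P\<^sup>2 \<doteq> l"
    by simp
  have ind: "pi_independent 1 P l (P * l)"
    by (rule pi_independent_ramified_unit'[OF P_int l_int _ l2 P2])
      (use k_int in \<open>auto intro!: algebraic_int_intros\<close>)
  have "2 * ((1 + \<i>) * (z * k)) = (2 * z) * ((1 + \<i>) * k)"
    by (simp only: mult_ac)
  also have "\<dots> = (E * \<alpha> + \<gamma>) * (1 + \<beta>)"
    unfolding \<beta> \<gamma> by simp
  also have "\<dots> = E * \<alpha> + \<gamma> + E * (\<alpha> * \<beta>) + \<beta> * \<gamma>"
    by (simp add: algebra_simps)
  also have "\<dots> = 2 * ((1 + E * H) * z) + (F - E\<^sup>2 * H) * \<alpha>"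
    unfolding alpha_beta beta_gamma unfolding \<gamma> by (simp add: algebra_simps power2_eq_square)
  also have "\<dots> = 2 * ((1 + \<i>) * (U * z + S * \<alpha>))"
    unfolding EH Fs by (simp add: algebra_simps)
  finally have "z * k = U * z + S * \<alpha>"
    by simp
  then have "\<alpha> = P * l + of_gauss ((u + j) * d) * 1 + of_gauss (- (u + j)) * P + of_gauss (- d) * l
      + (1 + \<i>) * (- of_gauss s1 * \<alpha>)"
    unfolding S1 by (simp add: P_def l_def U_def J_def D_def algebra_simps)
  then have \<alpha>: "\<alpha> \<doteq> P * l + of_gauss ((u + j) * d) * 1 + of_gauss (- (u + j)) * P + of_gauss (- d) * l"
    by (rule pi_congI) (auto intro!: algebraic_int_intros)
  have "z \<doteq> P + of_gauss (- d) * 1" "k \<doteq> l + of_gauss (- j) * 1 + of_gauss 0 * P"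
    by (simp_all add: P_def l_def D_def J_def)
  then have "pi_independent 1 z k \<alpha>"
    by (rule pi_independent_triangular[OF ind pi_cong_refl _ _ \<alpha>])
  then have ind': "pi_independent 1 \<alpha> k z"
    by (rule pi_independent_reverse)
  have mem: "k \<in> gauss_adjoin \<alpha>" "z \<in> gauss_adjoin \<alpha>"
    unfolding k_def z_def by (intro field_closed field_closed(2) field_mem)+
  have "\<beta> = of_gauss (1 + gauss_i) * k + of_gauss (- 1)" "\<gamma> = of_gauss 2 * z + of_gauss (- \<epsilon>) * \<alpha>"
    by (simp_all add: k_def z_def)
  then have "gauss_integral_basis {1, \<alpha>, k, z} (gauss_adjoin \<alpha>)"
    by (rule even_integral_basis[OF k_int z_int mem _ _ ind'])
  moreover have "(of_gauss (g * h) + \<alpha>\<^sup>2) / ((1 + \<i>) * of_gauss (g * h)) = k"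
  proof -
    have "of_gauss (g * h) + \<alpha>\<^sup>2 = of_gauss (g * h) * (1 + \<beta>)"
      by (simp add: alpha_squared algebra_simps)
    then show ?thesis
      using nonzero by (simp add: k_def)
  qed
  ultimately show ?thesis
    by (simp add: z_def \<gamma>_def)
qed

end

theorem theorem2:
  fixes f g h m :: gauss_int and \<alpha> gh gh2 :: complex and N :: "complex set"
  assumes "coprime f g" and "coprime f h" and "coprime g h"
    and "squarefree f" and "squarefree g" and "squarefree h"
    and "m = f * g\<^sup>2 * h ^ 3"
    and "\<alpha> ^ 4 = of_gauss m"
    and "N = gauss_adjoin \<alpha>"
    and "gauss_degree N 4"
    and "gh = of_gauss (g * h)" and "gh2 = of_gauss (g * h\<^sup>2)"
  shows "
    ([m = 1] (gmod 8) \<longrightarrow>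
      gauss_integral_basis
        {1, (1 + \<alpha>) / (1 + \<i>),
         ((cmod gh)\<^sup>2 * (\<i> + (1 + \<i>) * \<alpha>) + \<alpha>\<^sup>2) / (2 * (1 + \<i>) * gh),
         ((cmod gh2)\<^sup>2 * (1 + \<alpha> + \<alpha>\<^sup>2) + \<alpha> ^ 3) / (4 * gh2)} N) \<and>
    ([m = 1 + 4 * gauss_i] (gmod 8) \<longrightarrow>
      gauss_integral_basis
        {1, (1 + \<alpha>) / (1 + \<i>),
         ((cmod gh)\<^sup>2 * (- \<i> + (1 + \<i>) * \<alpha>) + \<alpha>\<^sup>2) / (2 * (1 + \<i>) * gh),
         ((cmod gh2)\<^sup>2 * (2 - \<i> + \<alpha> + \<i> * \<alpha>\<^sup>2) + \<alpha> ^ 3) / (4 * gh2)} N) \<and>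
    ([m = 2 * gauss_i] (gmod 4) \<and>
      [f * h = 1] (gmod 4) \<and>
      [f * gauss_cnj h = 1] (gmod 2 * (1 + gauss_i)) \<longrightarrow>
      gauss_integral_basis
        {1, \<alpha>, (gh + \<alpha>\<^sup>2) / (2 * gh), (\<alpha> + \<alpha> ^ 3 / gh2) / 2} N) \<and>
    ([m = 2 * gauss_i] (gmod 4) \<and>
      [f * h = - 1] (gmod 4) \<and>
      [f * gauss_cnj h = - 1] (gmod 2 * (1 + gauss_i)) \<longrightarrow>
      gauss_integral_basis
        {1, \<alpha>, (\<i> * gh + \<alpha>\<^sup>2) / (2 * gh), (\<i> * \<alpha> + \<alpha> ^ 3 / gh2) / 2} N) \<and>
    ([m = 2 * gauss_i] (gmod 4) \<and>
      \<not> [f * h = 1] (gmod 4) \<and>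
      \<not> [f * h = - 1] (gmod 4) \<and>
      ([f * h = 1] (gmod 2 * (1 + gauss_i)) \<or> [f * h = - 1] (gmod 2 * (1 + gauss_i))) \<and>
      [f * gauss_cnj h = 1] (gmod 2 * (1 + gauss_i)) \<longrightarrow>
      gauss_integral_basis
        {1, \<alpha>, (gh + \<alpha>\<^sup>2) / ((1 + \<i>) * gh), (\<alpha> + \<alpha> ^ 3 / gh2) / 2} N) \<and>
    ([m = 2 * gauss_i] (gmod 4) \<and>
      \<not> [f * h = 1] (gmod 4) \<and>
      \<not> [f * h = - 1] (gmod 4) \<and>
      ([f * h = 1] (gmod 2 * (1 + gauss_i)) \<or> [f * h = - 1] (gmod 2 * (1 + gauss_i))) \<and>
      [f * gauss_cnj h = - 1] (gmod 2 * (1 + gauss_i)) \<longrightarrow>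
      gauss_integral_basis
        {1, \<alpha>, (gh + \<alpha>\<^sup>2) / ((1 + \<i>) * gh), (\<i> * \<alpha> + \<alpha> ^ 3 / gh2) / 2} N) \<and>
    ([m = 3 + 2 * gauss_i] (gmod 4) \<longrightarrow>
      gauss_integral_basis
        {1, \<alpha>, ((cmod gh)\<^sup>2 + \<alpha>\<^sup>2) / ((1 + \<i>) * gh),
         ((cmod gh2)\<^sup>2 * (1 + \<alpha> + \<alpha>\<^sup>2) + \<alpha> ^ 3) / (2 * gh2)} N) \<and>
    ([m = 1 + 2 * gauss_i] (gmod 4) \<longrightarrow>
      gauss_integral_basis
        {1, \<alpha>, ((cmod gh)\<^sup>2 * (1 + (1 + \<i>) * \<alpha>) + \<alpha>\<^sup>2) / (2 * gh),
         ((cmod gh2)\<^sup>2 * (\<alpha> + (1 + \<i>) * \<alpha>\<^sup>2) + \<alpha> ^ 3) / (2 * gh2)} N) \<and>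
    ([m = 3] (gmod 4) \<longrightarrow>
      gauss_integral_basis
        {1, \<alpha>, (\<i> * (cmod gh)\<^sup>2 + \<alpha>\<^sup>2) / (2 * gh),
         ((cmod gh2)\<^sup>2 * (\<i> + \<i> * \<alpha> + \<alpha>\<^sup>2) + \<alpha> ^ 3) / (2 * gh2)} N) \<and>
    ([m = 5] (gmod 8) \<or> [m = 5 + 4 * gauss_i] (gmod 8) \<longrightarrow>
      gauss_integral_basis
        {1, (1 + \<alpha>) / (1 + \<i>), ((cmod gh)\<^sup>2 + \<alpha>\<^sup>2) / (2 * gh),
         ((cmod gh2)\<^sup>2 * (1 + \<alpha> + \<alpha>\<^sup>2) + \<alpha> ^ 3) / (2 * (1 + \<i>) * gh2)} N) \<and>
    (gauss_even f \<or> gauss_even h \<or> [m = gauss_i] (gmod 2) \<longrightarrow>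
      gauss_integral_basis
        {1, \<alpha>, \<alpha>\<^sup>2 / gh, \<alpha> ^ 3 / gh2} N) \<and>
    ([f * h = gauss_i] (gmod 2) \<and>
      gauss_even g \<longrightarrow>
      gauss_integral_basis
        {1, \<alpha>, \<alpha>\<^sup>2 / gh, (\<i> * \<alpha> + \<alpha> ^ 3 / gh2) / (1 + \<i>)} N) \<and>
    ([m = 2 * gauss_i] (gmod 4) \<and>
      [f * h = 1] (gmod 4) \<and>
      [f * gauss_cnj h = - 1] (gmod 2 * (1 + gauss_i)) \<longrightarrow>
      gauss_integral_basis
        {1, \<alpha>, (gh + \<alpha>\<^sup>2) / (2 * gh), (\<i> * \<alpha> + \<alpha> ^ 3 / gh2) / 2} N) \<and>
    ([m = 2 * gauss_i] (gmod 4) \<and>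
      [f * h = - 1] (gmod 4) \<and>
      [f * gauss_cnj h = 1] (gmod 2 * (1 + gauss_i)) \<longrightarrow>
      gauss_integral_basis
        {1, \<alpha>, (\<i> * gh + \<alpha>\<^sup>2) / (2 * gh), (\<alpha> + \<alpha> ^ 3 / gh2) / 2} N)"
proof -
  interpret pure_quartic f g h \<alpha>
    by unfold_locales (use assms in auto)
  note m = assms(7) and N = assms(9) and gh = assms(11) and gh2 = assms(12)
  have i2: "gauss_i\<^sup>2 = - 1"
    by (simp add: power2_eq_square gauss_i_square)
  have fh_odd: "\<not> gauss_even f" "\<not> gauss_even h"
    if fh: "[f * h = e] (gmod 2 * c)" "\<not> gauss_even e" for e c
  proof -
    obtain t where "f * h = e + 2 * c * t"
      using fh(1) by (rule gauss_congE)
    then have "\<not> gauss_even (f * h)"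
      using fh(2) by simp
    then show "\<not> gauss_even f" "\<not> gauss_even h" by auto
  qed
  have g_even: "gauss_even g" if mfh: "[m = 2 * gauss_i] (gmod 4)"
      "\<exists>c. [f * h = 1] (gmod 2 * c) \<or> [f * h = - 1] (gmod 2 * c)"
  proof -
    have "\<not> gauss_even f" "\<not> gauss_even h"
      using mfh(2) fh_odd[of 1] fh_odd[of "- 1"] by auto
    moreover obtain t where "m = 2 * gauss_i + 4 * t"
      using mfh(1) by (rule gauss_congE)
    then have "gauss_even m" by simp
    ultimately show ?thesis by (simp add: m)
  qed
  have g_even4: "gauss_even g"
    if "[m = 2 * gauss_i] (gmod 4)" "[f * h = 1] (gmod 4) \<or> [f * h = - 1] (gmod 4)"
  proof -
    have "(4 :: gauss_int) = 2 * 2" by simp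
    then show ?thesis using g_even that by metis
  qed
  note unit_simps = of_gauss_hom(2,3) mult_1_left power_one i2
  show ?thesis
    unfolding N gh gh2
  proof (intro conjI impI, goal_cases)
    case 1
    then show ?case unfolding m by (rule integral_basis_1_mod_8)
  next
    case 2
    then show ?case unfolding m by (rule integral_basis_1_plus_4i_mod_8)
  next
    case 3
    then show ?case
      using integral_basis_fh_unit_square[of 1 1, unfolded unit_simps] g_even4 by blast
  next
    case 4
    then show ?case
      using integral_basis_fh_unit_square[of gauss_i gauss_i, unfolded unit_simps] g_even4 by blast
  next
    case 5
    then show ?case
      using integral_basis_fh_not_unit_square[of 1, unfolded unit_simps] g_even by blast
  next
    case 6
    then show ?case
      using integral_basis_fh_not_unit_square[of gauss_i, unfolded unit_simps] g_even by blast
  next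
    case 7
    then show ?case
      unfolding m by (rule integral_basis_3_plus_2i_mod_4[unfolded mult_1_right])
  next
    case 8
    then show ?case unfolding m by (rule integral_basis_1_plus_2i_mod_4)
  next
    case 9
    then show ?case
      unfolding m by (rule integral_basis_3_mod_4[unfolded mult.commute[of _ \<i>]])
  next
    case 10
    then show ?case
      unfolding m by (rule integral_basis_5_mod_8[unfolded mult_1_right])
  next
    case 11
    then show ?case unfolding m by (rule integral_basis_pure)
  next
    case 12
    then show ?case by (intro integral_basis_fh_i_mod_2) blast+
  next
    case 13
    then show ?case
      using integral_basis_fh_unit_square[of gauss_i 1, unfolded unit_simps] g_even4 by blast
  next
    case 14
    then show ?case
      using integral_basis_fh_unit_square[of 1 gauss_i, unfolded unit_simps] g_even4 by blast
  qed
qed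

end
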